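(* Let $n=1$ and let $\{x^k:k\in\mathbb N\}$ be generated by algorithm iRPMVR with $\gamma_k\equiv1$, with exact tangent steps $\hat\eta^k$ and surrogate errors $e^k$. Suppose the error-dissipation condition holds (with constants $c_e,\mu,\nu$), and that there are $\kappa_1,\kappa_2\ge0$, $k_0\in\mathbb N$, $r>2$ with $$\Delta_k\le\min\bigl\{\bar\Delta,\max\{\kappa_1\|\eta^{k-1}\|^2,\kappa_2(k-k_0)^{-r}\}\bigr\},\qquad k\ge k_0+1.$$ Let $\rho_1,\rho_2>0$, $\chi_e>\rho_1$, $a:=\frac1{2\alpha}-\frac{\ell_f}2-\frac{\rho_2}2$, $c_\eta:=\frac1{4\alpha}+\ell_f^2\rho_1+2L_\Phi$, $C_{\rm sh}:=\frac{C_1^2}{\alpha}+2L_\Phi C_1^2+\frac{C_1^2}{2\rho_1}+2C_0\ell_R$, $d_\alpha:=a-c_\eta$, and assume $$0<\bar\alpha<\min\Bigl\{C_\alpha,\tfrac1{\ell_f+\rho_2},\tfrac1{2\ell_f+2\rho_2+4\ell_f^2\rho_1+8L_\Phi+8\nu/\rho_2+16\chi_e\nu}\Bigr\},\qquad 0\le\kappa_1<\frac{d_\alpha/4-\nu/(2\rho_2)-\chi_e\nu}{(d_\alpha C_1^2)/2+C_{\rm sh}}.$$ Let $\Phi_*$ be the limit of $\Phi_0(x^k,\hat\eta^k)$ (which exists and, in this deterministic setting, is a constant), and assume that $\Omega_*:=\{(x,\eta)\in T\mathcal M:\|\eta\|\le(M_u+\ell_R)\bar\alpha,\ \Phi_0(x,\eta)=\Phi_*,\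 0\in\partial\Phi_0(x,\eta)\}$ is nonempty and that $\Phi_0$ satisfies the KL property at every point of $\Omega_*$. Under these assumptions $x^k$ converges to a critical point $x^*$ of $\min_{x\in\mathcal M}\Phi(x)$. Set $z^k:=(x^k,\hat\eta^k)$, $z^*:=(x^*,0)$ and assume that $\Phi_0$ has KL exponent $\theta\in[0,1)$ at $z^*$. If $\kappa_2=0$ and $\theta\in[0,1/2]$, then for some $\rho\in(0,1)$, $$|\Phi_0(z^k)-\Phi_0(z^* )|=O(\rho^k),\qquad\|\hat\eta^k\|+\|\eta^k\|=O(\rho^k),\qquad\|x^k-x^*\|=O(\rho^k).$$ In the remaining cases, set $\bar\theta:=\max\{\theta,\frac r{2(r-1)}\}$ if $\kappa_2>0$ and $\bar\theta:=\theta$ if $\kappa_2=0$. If $\bar\theta\in(1/2,1)$, then $$|\Phi_0(z^k)-\Phi_0(z^* )|=O\bigl(k^{-1/(2\bar\theta-1)}+k^{-r/(2\bar\theta)}\bigr),\qquad\|\hat\eta^k\|+\|\eta^k\|=O\bigl(k^{-1/(4\bar\theta-2)}+k^{-r/(4\bar\theta)}\bigr),$$ and $\|x^k-x^*\|=O(k^{-\kappa})$, where $\kappa:=\frac{1-\theta}{2\theta-1}$ if $\kappa_2=0$ and $\kappa:=\min\bigl\{\frac{1-\bar\theta}{2\bar\theta-1},\frac{r(1-\bar\theta)}{2\bar\theta},\frac{r-2}2\bigr\}$ if $\kappa_2>0$.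
   Context: Setting. $\mathcal M\subseteq\mathbb R^d$ is a compact embedded Riemannian submanifold (induced Euclidean metric) of dimension $d-p$, with tangent spaces $T_x\mathcal M$, normal spaces $N_x\mathcal M=(T_x\mathcal M)^\perp$, tangent bundle $T\mathcal M=\{(x,\eta):x\in\mathcal M,\eta\in T_x\mathcal M\}\subset\mathbb R^d\times\mathbb R^d$; $P_S$ is Euclidean projection onto a closed convex set $S$. $\Phi=F+R$, $F=\frac1n\sum_{j=1}^nf_j$ (here $n=1$, so everything is deterministic). Each $f_j:\mathbb R^d\to\mathbb R$ is $C^1$; there is an open neighborhood $U$ of $\mathcal M$ on which every $\nabla f_j$ is Lipschitz with common constant $\ell_f$; $\|\nabla f_j(x)\|\le M_f$ for all $x\in\mathcal M$ and all $j$ ($M_f>0$); $R:\mathbb R^d\to\mathbb R$ is convex and $\ell_R$-Lipschitz. $\operatorname{grad}h(x)=P_{T_x\mathcal M}\nabla h(x)$. $\operatorname{Retr}:T\mathcal M\to\mathcal M$ is a retraction (smooth, $\operatorname{Retr}_x(0)=x$, $D\operatorname{Retr}_x(0)=\mathrm{Id}$). $\mathcal M$ is covered by finitely many open sets $V_\ell$ with $\overline{V_\ell}\subseteq U_\ell$, $U_\ell$ open carrying smooth local defining functions $\psi_\ell:U_\ell\to\mathbb R^p$ of $\mathcal M$ whose differential has full row rank on $U_\ell\cap\mathcal M$; for $x\in\mathcal M$ pick $\ell(x)$ with $x\in V_{\ell(x)}$ and set $B_x:=D\psi_{\ell(x)}(x)$, so $\ker B_x=T_x\mathcal M$. $C_0>0$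 is a constant with $\operatorname{dist}(v,T_x\mathcal M)\le C_0\|B_xv\|$ for all $x\in\mathcal M$, $v\in\mathbb R^d$. A point $x\in\mathcal M$ is critical if $0\in\nabla F(x)+\partial R(x)+N_x\mathcal M$. Algorithm iRPMVR. Choose $x^0\in\mathcal M$, stepsize $0<\alpha\le\bar\alpha$, $0<\gamma\le1$, $\bar\Delta\ge0$, $0\le\bar\chi<1$, $M_u:=c_fM_f$ with $c_f\ge1$. Parameters $\gamma_k\in[\gamma,1]$, $\Delta_k\in[0,\bar\Delta]$, $\chi_k\in[0,\bar\chi]$ are chosen before sampling the $k$-th batch using only available history. Initialize $u^0=\hat u^0=\bar m^0=\operatorname{grad}F(x^0)$. For $k=0,1,\dots$: (a) if $k\ne0$, sample a random batch $\mathcal B_k$ from $\{1,\dots,n\}$, form from it and the current estimator state an estimator $u^k\in T_{x^k}\mathcal M$ of $\operatorname{grad}F(x^k)$, and set $\hat u^k=P_{\overline B(0,M_u)}u^k$; (b) $m^k=\chi_k\bar m^k+(1-\chi_k)\hat u^k$; (c) with $F_k(\eta):=\langle m^k,\eta\rangle+\frac1{2\alpha}\|\eta\|^2+R(x^k+\eta)$ and $G_k(\lambda):=F_k^*(-B_{x^k}^\top\lambda)$ ($F_k^*$ the Fenchel conjugate) find $\lambda^k\in\mathbb R^p$ with $\|\nabla G_k(\lambda^k)\|\le\Delta_k$; (d) $w^k=\operatorname{prox}_{\alpha R}(x^k-\alpha(m^k+B_{x^k}^\top\lambda^k))-x^k$, $\eta^k=P_{T_{x^k}\mathcal M}w^k$;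 (e) $x^{k+1}=\operatorname{Retr}_{x^k}(\gamma_k\eta^k)$; (f) $\bar m^{k+1}=P_{T_{x^{k+1}}\mathcal M}m^k$. The exact tangent step is $\hat\eta^k:=\arg\min_{\eta\in T_{x^k}\mathcal M}F_k(\eta)$ and $e^k:=m^k-\operatorname{grad}F(x^k)$. $\mathcal F_k$ is the history before $\mathcal B_k$ is sampled; $\mathbb E_k=\mathbb E[\cdot\mid\mathcal F_k]$ (trivial conditioning when $n=1$). Error-dissipation condition: there are constants $c_e,\mu,\nu>0$ and nonnegative $\mathcal F_k$-measurable $\mathcal E_k$, $\mathbb E[\mathcal E_0]<\infty$, with $\mathbb E_k[\|e^k\|^2]+\mu\mathcal E_k\le c_e(\mathcal E_k-\mathbb E_k[\mathcal E_{k+1}])+\nu\mathbb E_k[\|\eta^k\|^2]$ for every $k\ge0$. Constants. $\delta,C_R,C_Q,L_R,L_\Phi,L_F>0$ are fixed such that for all $x\in\mathcal M$, $\eta\in T_x\mathcal M$, $\|\eta\|\le\delta$: $x+\eta\in U$, $\|\operatorname{Retr}_x(\eta)-x\|\le C_R\|\eta\|$, $\|\operatorname{Retr}_x(\eta)-x-\eta\|\le C_Q\|\eta\|^2$, $|R(\operatorname{Retr}_x(\eta))-R(x+\eta)|\le L_R\|\eta\|^2$, $|\Phi(\operatorname{Retr}_x(\eta))-\Phi(x+\eta)|\le L_\Phi\|\eta\|^2$, $F(\operatorname{Retr}_x(\eta))-F(x)-\langle\operatorname{grad}F(x),\eta\rangle\le\frac{L_F}2\|\eta\|^2$. $\delta_T,L_T>0$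 are fixed such that $\|\operatorname{grad}f_j(\operatorname{Retr}_x(\eta))-P_{T_{\operatorname{Retr}_x(\eta)}\mathcal M}\operatorname{grad}f_j(x)\|\le L_T\|\eta\|$ for all $j$, $x\in\mathcal M$, $\eta\in T_x\mathcal M$ with $\|\eta\|\le\delta_T$ (and likewise for $F$). $C_1:=2\sqrt{\ell_RC_0\bar\alpha}$ (for which $\|\eta^k-\hat\eta^k\|\le C_1\sqrt{\Delta_k}$ for all $k$), and $$C_\alpha:=\left(\frac{\sqrt{\ell_RC_0\bar\Delta+(M_u+\ell_R)\min\{\delta,\delta_T\}}-\sqrt{\ell_RC_0\bar\Delta}}{M_u+\ell_R}\right)^2.$$ Shifted objective: $\Phi_0(x,\eta):=\Phi(x+\eta)+\iota_{T\mathcal M}(x,\eta)$ on $\mathbb R^d\times\mathbb R^d$ ($\iota$ the $0/+\infty$ indicator); $\partial\Phi_0$ is the limiting subdifferential. A proper lsc $\phi$ has the KL property at $\bar x$ with $\partial\phi(\bar x)\neq\emptyset$ if there are $\varepsilon,\delta'>0$ and a continuous concave $\varphi:[0,\varepsilon)\to[0,\infty)$, $\varphi(0)=0$, $\varphi\in C^1(0,\varepsilon)$, $\varphi'>0$, with $\varphi'(\phi(x)-\phi(\bar x))\operatorname{dist}(0,\partial\phi(x))\ge1$ whenever $\|x-\bar x\|<\delta'$ and $\phi(\bar x)<\phi(x)<\phi(\bar x)+\varepsilon$; it has KL exponent $\theta\in[0,1)$ at $\bar x$ if one can take $\varphi(s)=cs^{1-\theta}$, $c>0$. *)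

theory Defs
  imports "HOL-Analysis.Analysis" "HOL-Library.Landau_Symbols"
begin

section \<open>Smooth maps and embedded submanifolds\<close>

fun Ck_on :: "nat \<Rightarrow> ('a::euclidean_space \<Rightarrow> 'b::euclidean_space) \<Rightarrow> 'a set \<Rightarrow> bool" where
  "Ck_on 0 f S \<longleftrightarrow> continuous_on S f"
| "Ck_on (Suc k) f S \<longleftrightarrow> (\<forall>x\<in>S. f differentiable (at x)) \<and>
     (\<forall>v. Ck_on k (\<lambda>x. frechet_derivative f (at x) v) S)"

text \<open>Only meaningful for open \<open>S\<close>.\<close>
definition smooth_on :: "('a::euclidean_space \<Rightarrow> 'b::euclidean_space) \<Rightarrow> 'a set \<Rightarrow> bool" where
  "smooth_on f S \<longleftrightarrow> (\<forall>k. Ck_on k f S)"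

text \<open>Smoothness on a set that need not be open (here: the tangent bundle, a submanifold of the
  product space): existence of smooth local extensions to the ambient space.\<close>
definition smooth_map_on :: "('a::euclidean_space \<Rightarrow> 'b::euclidean_space) \<Rightarrow> 'a set \<Rightarrow> bool" where
  "smooth_map_on f S \<longleftrightarrow>
     (\<forall>z\<in>S. \<exists>W g. open W \<and> z \<in> W \<and> smooth_on g W \<and> (\<forall>y\<in>W \<inter> S. g y = f y))"

text \<open>The differential has full row rank iff, as a linear map into \<open>'b\<close>, it is onto.\<close>
definition local_defining_function ::
  "'a::euclidean_space set \<Rightarrow> 'a set \<Rightarrow> ('a \<Rightarrow> 'b::euclidean_space) \<Rightarrow> bool" where
  "local_defining_function M W \<psi> \<longleftrightarrow>
     open W \<and> smooth_on \<psi> W \<and> M \<inter> W = {x\<in>W. \<psi> x = 0} \<and>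
     (\<forall>x\<in>M \<inter> W. surj (frechet_derivative \<psi> (at x)))"

text \<open>A finite cover of \<open>M\<close> by sets \<open>V i\<close> whose closures lie in domains \<open>W i\<close> of local defining
  functions. Such a cover makes \<open>M\<close> an embedded submanifold of codimension \<open>DIM('b)\<close>.\<close>
definition defining_cover ::
  "'a::euclidean_space set \<Rightarrow> 'i set \<Rightarrow> ('i \<Rightarrow> 'a set) \<Rightarrow> ('i \<Rightarrow> 'a set) \<Rightarrow>
     ('i \<Rightarrow> 'a \<Rightarrow> 'b::euclidean_space) \<Rightarrow> bool" where
  "defining_cover M I V W \<psi> \<longleftrightarrow>
     finite I \<and> M \<subseteq> (\<Union>i\<in>I. V i) \<and>
     (\<forall>i\<in>I. open (V i) \<and> closure (V i) \<subseteq> W i \<and> local_defining_function M (W i) (\<psi> i))"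

text \<open>For an embedded submanifold, velocities of \<open>C\<^sup>1\<close> curves and of smooth curves form the same space.\<close>
definition tangent_space :: "'a::euclidean_space set \<Rightarrow> 'a \<Rightarrow> 'a set" where
  "tangent_space M x = {v. \<exists>c e. e > 0 \<and> c C1_differentiable_on {-e<..<e} \<and> c ` {-e<..<e} \<subseteq> M \<and>
     c 0 = x \<and> (c has_vector_derivative v) (at 0)}"

definition normal_space :: "'a::euclidean_space set \<Rightarrow> 'a \<Rightarrow> 'a set" where
  "normal_space M x = (tangent_space M x)\<^sup>\<bottom>"

definition tangent_bundle :: "'a::euclidean_space set \<Rightarrow> ('a \<times> 'a) set" where
  "tangent_bundle M = {(x, \<eta>). x \<in> M \<and> \<eta> \<in> tangent_space M x}"

text \<open>The differential of \<open>Retr x\<close> at \<open>0\<close> is a map on the tangent space, hence the restricted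
  filter \<open>at 0 within tangent_space M x\<close>.\<close>
definition manifold_retraction :: "'a::euclidean_space set \<Rightarrow> ('a \<Rightarrow> 'a \<Rightarrow> 'a) \<Rightarrow> bool" where
  "manifold_retraction M Retr \<longleftrightarrow>
     (\<forall>x\<in>M. \<forall>\<eta>\<in>tangent_space M x. Retr x \<eta> \<in> M) \<and>
     smooth_map_on (\<lambda>(x, \<eta>). Retr x \<eta>) (tangent_bundle M) \<and>
     (\<forall>x\<in>M. Retr x 0 = x \<and> (Retr x has_derivative (\<lambda>h. h)) (at 0 within tangent_space M x))"

section \<open>Gradients and convex analysis\<close>

definition nabla :: "('a::real_inner \<Rightarrow> real) \<Rightarrow> 'a \<Rightarrow> 'a" where
  "nabla h x = (THE D. GDERIV h x :> D)"

text \<open>\<open>closest_point S\<close> is the Euclidean projection onto a nonempty closed convex set \<open>S\<close>.\<close>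
definition riem_grad :: "'a::euclidean_space set \<Rightarrow> ('a \<Rightarrow> real) \<Rightarrow> 'a \<Rightarrow> 'a" where
  "riem_grad M h x = closest_point (tangent_space M x) (nabla h x)"

definition prox :: "('a::euclidean_space \<Rightarrow> real) \<Rightarrow> 'a \<Rightarrow> 'a" where
  "prox h y = (ARG_MIN (\<lambda>z. h z + (norm (z - y))\<^sup>2 / 2) z. True)"

text \<open>Real-valued: it is applied only to superlinear \<open>h\<close>, where the supremum is finite.\<close>
definition fenchel_conjugate :: "('a::euclidean_space \<Rightarrow> real) \<Rightarrow> 'a \<Rightarrow> real" where
  "fenchel_conjugate h y = (SUP x. inner y x - h x)"

definition convex_subdifferential :: "('a::euclidean_space \<Rightarrow> real) \<Rightarrow> 'a \<Rightarrow> 'a set" where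
  "convex_subdifferential h x = {g. \<forall>y. h y \<ge> h x + inner g (y - x)}"

definition critical_point ::
  "'a::euclidean_space set \<Rightarrow> ('a \<Rightarrow> real) \<Rightarrow> ('a \<Rightarrow> real) \<Rightarrow> 'a \<Rightarrow> bool" where
  "critical_point M F R x \<longleftrightarrow> x \<in> M \<and>
     (\<exists>g\<in>convex_subdifferential R x. \<exists>v\<in>normal_space M x. 0 = nabla F x + g + v)"

section \<open>Limiting subdifferential and the Kurdyka-Lojasiewicz property\<close>

definition regular_subdifferential :: "('c::euclidean_space \<Rightarrow> ereal) \<Rightarrow> 'c \<Rightarrow> 'c set" where
  "regular_subdifferential \<phi> x = {v. \<bar>\<phi> x\<bar> \<noteq> \<infinity> \<and>
     (\<forall>\<epsilon>>0. \<forall>\<^sub>F y in at x. \<phi> y \<ge> \<phi> x + ereal (inner v (y - x) - \<epsilon> * norm (y - x)))}"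

definition limiting_subdifferential :: "('c::euclidean_space \<Rightarrow> ereal) \<Rightarrow> 'c \<Rightarrow> 'c set" where
  "limiting_subdifferential \<phi> x = {v. \<bar>\<phi> x\<bar> \<noteq> \<infinity> \<and>
     (\<exists>y w. y \<longlonglongrightarrow> x \<and> (\<lambda>i. \<phi> (y i)) \<longlonglongrightarrow> \<phi> x \<and>
        (\<forall>i. w i \<in> regular_subdifferential \<phi> (y i)) \<and> w \<longlonglongrightarrow> v)}"

text \<open>Distance from \<open>0\<close>, with value \<open>\<infinity>\<close> on the empty set (unlike \<open>infdist\<close>).\<close>
definition dist_zero :: "'c::real_normed_vector set \<Rightarrow> ereal" where
  "dist_zero S = (INF v\<in>S. ereal (norm v))"

definition KL_with :: "('c::euclidean_space \<Rightarrow> ereal) \<Rightarrow> 'c \<Rightarrow> real \<Rightarrow> real \<Rightarrow> (real \<Rightarrow> real) \<Rightarrow> bool" where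
  "KL_with \<phi> xb \<epsilon> \<delta> g \<longleftrightarrow>
     limiting_subdifferential \<phi> xb \<noteq> {} \<and> \<epsilon> > 0 \<and> \<delta> > 0 \<and>
     continuous_on {0..<\<epsilon>} g \<and> concave_on {0..<\<epsilon>} g \<and> g 0 = 0 \<and> (\<forall>s\<in>{0..<\<epsilon>}. g s \<ge> 0) \<and>
     (\<forall>s\<in>{0<..<\<epsilon>}. g differentiable (at s)) \<and> continuous_on {0<..<\<epsilon>} (deriv g) \<and>
     (\<forall>s\<in>{0<..<\<epsilon>}. deriv g s > 0) \<and>
     (\<forall>x. norm (x - xb) < \<delta> \<and> \<phi> xb < \<phi> x \<and> \<phi> x < \<phi> xb + ereal \<epsilon> \<longrightarrow>
        ereal (deriv g (real_of_ereal (\<phi> x - \<phi> xb))) * dist_zero (limiting_subdifferential \<phi> x) \<ge> 1)"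

definition KL_property :: "('c::euclidean_space \<Rightarrow> ereal) \<Rightarrow> 'c \<Rightarrow> bool" where
  "KL_property \<phi> xb \<longleftrightarrow> (\<exists>\<epsilon> \<delta> g. KL_with \<phi> xb \<epsilon> \<delta> g)"

definition KL_exponent :: "('c::euclidean_space \<Rightarrow> ereal) \<Rightarrow> 'c \<Rightarrow> real \<Rightarrow> bool" where
  "KL_exponent \<phi> xb \<theta> \<longleftrightarrow> 0 \<le> \<theta> \<and> \<theta> < 1 \<and>
     (\<exists>\<epsilon> \<delta> c. c > 0 \<and> KL_with \<phi> xb \<epsilon> \<delta> (\<lambda>s. c * s powr (1 - \<theta>)))"

definition shifted_objective :: "'a::euclidean_space set \<Rightarrow> ('a \<Rightarrow> real) \<Rightarrow> 'a \<times> 'a \<Rightarrow> ereal" where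
  "shifted_objective M \<Phi> z = (if z \<in> tangent_bundle M then ereal (\<Phi> (fst z + snd z)) else \<infinity>)"

section \<open>The algorithm\<close>

text \<open>With \<open>x = x\<^sup>k\<close> and \<open>m = m\<^sup>k\<close>, \<open>step_model\<close> is \<open>F\<^sub>k\<close> and \<open>dual_model\<close> is \<open>G\<^sub>k\<close>; \<open>Bx\<close> is the linear map
  \<open>B\<close> at \<open>x\<close>.\<close>
definition step_model :: "('a::euclidean_space \<Rightarrow> real) \<Rightarrow> real \<Rightarrow> 'a \<Rightarrow> 'a \<Rightarrow> 'a \<Rightarrow> real" where
  "step_model R \<alpha> x m \<eta> = inner m \<eta> + (norm \<eta>)\<^sup>2 / (2 * \<alpha>) + R (x + \<eta>)"

definition dual_model ::
  "('a::euclidean_space \<Rightarrow> real) \<Rightarrow> real \<Rightarrow> ('a \<Rightarrow> 'b::euclidean_space) \<Rightarrow> 'a \<Rightarrow> 'a \<Rightarrow> 'b \<Rightarrow> real" where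
  "dual_model R \<alpha> Bx x m l = fenchel_conjugate (step_model R \<alpha> x m) (- adjoint Bx l)"

text \<open>A run of iRPMVR, for one realisation of the batches. For \<open>k \<noteq> 0\<close> the estimator
  \<open>u k\<close> may be any tangent vector at \<open>x k\<close>; its quality is constrained separately, by the
  error-dissipation condition. Here \<open>uh\<close>, \<open>mb\<close> stand for the estimator clipped to the ball of
  radius \<open>Mu\<close> and the transported momentum.\<close>
definition iRPMVR ::
  "'a::euclidean_space set \<Rightarrow> ('a \<Rightarrow> real) \<Rightarrow> ('a \<Rightarrow> real) \<Rightarrow> ('a \<Rightarrow> 'a \<Rightarrow> 'b::euclidean_space) \<Rightarrow>
   ('a \<Rightarrow> 'a \<Rightarrow> 'a) \<Rightarrow> real \<Rightarrow> real \<Rightarrow> (nat \<Rightarrow> real) \<Rightarrow> (nat \<Rightarrow> real) \<Rightarrow> (nat \<Rightarrow> real) \<Rightarrow>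
   (nat \<Rightarrow> 'a) \<Rightarrow> (nat \<Rightarrow> 'a) \<Rightarrow> (nat \<Rightarrow> 'a) \<Rightarrow> (nat \<Rightarrow> 'a) \<Rightarrow> (nat \<Rightarrow> 'a) \<Rightarrow> (nat \<Rightarrow> 'b) \<Rightarrow>
   (nat \<Rightarrow> 'a) \<Rightarrow> (nat \<Rightarrow> 'a) \<Rightarrow> bool" where
  "iRPMVR M F R B Retr \<alpha> Mu \<gamma> tol chi x u uh mb m l w \<eta> \<longleftrightarrow>
     x 0 \<in> M \<and> u 0 = riem_grad M F (x 0) \<and> uh 0 = u 0 \<and> mb 0 = u 0 \<and>
     (\<forall>k. k \<noteq> 0 \<longrightarrow> u k \<in> tangent_space M (x k) \<and> uh k = closest_point (cball 0 Mu) (u k)) \<and>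
     (\<forall>k. m k = chi k *\<^sub>R mb k + (1 - chi k) *\<^sub>R uh k) \<and>
     (\<forall>k. norm (nabla (dual_model R \<alpha> (B (x k)) (x k) (m k)) (l k)) \<le> tol k) \<and>
     (\<forall>k. w k = prox (\<lambda>z. \<alpha> * R z) (x k - \<alpha> *\<^sub>R (m k + adjoint (B (x k)) (l k))) - x k) \<and>
     (\<forall>k. \<eta> k = closest_point (tangent_space M (x k)) (w k)) \<and>
     (\<forall>k. x (Suc k) = Retr (x k) (\<gamma> k *\<^sub>R \<eta> k)) \<and>
     (\<forall>k. mb (Suc k) = closest_point (tangent_space M (x (Suc k))) (m k))"

end

theory Submission
  imports Defs
begin

text \<open>With \<open>c = ce (chie + 1 / (2 \<rho>2))\<close> and a suitable \<open>S > 0\<close>, the merit values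
  \<open>V k = \<Phi> (x k) + c * Er k + S * tol k\<close> satisfy
  \<open>V (k + 1) + q s\<^sup>2 \<le> V k + const * k powr (- r)\<close>, where \<open>s\<^sup>2\<close> is the sum of the
  squared norms of error, exact step and inexact step and of \<open>Er k\<close> and \<open>tol k\<close>; moreover \<open>V (k + 1)\<close> and the
  surrogate value \<open>\<Phi> (x k + \<eta>h k)\<close> differ by \<open>O(s\<^sup>2)\<close> up to the same perturbation.
  The optimality condition of the exact step yields a subgradient of the shifted objective of size \<open>O(s)\<close>.
  The KL inequality thus bounds the surrogate gap in terms of \<open>s\<close>, and the usual
  finite-length argument applies to the sequence \<open>D k = V k + const * k powr (1 - r) - \<Phi>s\<close>.
  The perturbations act like a KL exponent \<open>r / (2 (r - 1))\<close>, which is why this number enters \<open>\<theta>b\<close>.\<close>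

section \<open>Tangent spaces of covered manifolds\<close>

text \<open>Two obstacles shape the proof. The decreasing quantity is the merit gap
  \<open>D\<close>, but the KL inequality speaks of the surrogate gap \<open>g\<close> at the pair
  of iterate and exact step. A dichotomy at every k reconciles them: if \<open>g k\<close> is at
  least half of \<open>D (Suc k)\<close>, KL applies up to a factor; otherwise
  \<open>D (Suc k)\<close> is itself bounded by a multiple of \<open>(s k)\<^sup>2\<close> plus the
  perturbation \<open>T k\<close>, and this alone acts like a KL inequality of exponent
  \<open>\<theta>0\<close>, which must therefore be at least 1/2. As \<open>T k\<close> has order
  \<open>k powr (1 - r)\<close>, the power \<open>T k powr \<theta>0\<close> has the order of the
  square root of a single perturbation, \<open>k powr (- r / 2)\<close>, exactly when
  \<open>(r - 1) * \<theta>0 = r / 2\<close>; this is summable because r > 2. The other obstacle is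
  that the shifted objective lives on the tangent bundle, whose normal vectors involve second
  derivatives of the defining functions. These terms carry the norm of the fibre component as a
  factor, so they shrink with the step and the subgradient keeps the order of
  \<open>s\<close>.\<close>

lemma Ck_on_1_D:
  assumes "Ck_on (Suc 0) f S" "y \<in> S"
  shows "(f has_derivative frechet_derivative f (at y)) (at y)"
    and "continuous_on S (\<lambda>y. frechet_derivative f (at y) v)"
  using assms by (auto simp: frechet_derivative_works)

text \<open>Needed for the velocity of the curve constructed in
  \<open>kernel_subset_tangent_space\<close>. With w = u t - u t0 the equations give A t0 w = (A t0
  - A t) (u t). Injectivity bounds A t0 from below, and for t near t0 half of that lower bound
  absorbs the part of the right side that contains w.\<close>

lemma continuous_on_solve:
  fixes A :: "real \<Rightarrow> 'a::euclidean_space \<Rightarrow>\<^sub>L 'a"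
  assumes "continuous_on S A" "\<And>t. t \<in> S \<Longrightarrow> inj (blinfun_apply (A t))"
    and "\<And>t. t \<in> S \<Longrightarrow> blinfun_apply (A t) (u t) = v"
  shows "continuous_on S u"
proof (clarsimp simp: continuous_on_iff)
  fix t0 and e :: real assume t0: "t0 \<in> S" and "e > 0"
  have lin: "bounded_linear (blinfun_apply (A t0))" by (rule blinfun.bounded_linear_right)
  then have "linear (blinfun_apply (A t0))" using bounded_linear.linear by blast
  then obtain b where b: "b > 0" "\<And>h. b * norm h \<le> norm (blinfun_apply (A t0) h)"
    using linear_inj_bounded_below_pos assms(2)[OF t0] by blast
  \<comment> \<open>The first entry lets d * norm w be absorbed on the left; the second makes d *
    (norm (u t0) + 1) at most e * b / 4.\<close>
  define d where "d = min (b/2) (e * b / (2 * (norm (u t0) + 1)) / 2)"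
  have "d > 0" using b \<open>e > 0\<close> by (auto simp: d_def add_nonneg_pos)
  then obtain r where r: "r > 0" "\<And>t. t \<in> S \<Longrightarrow> dist t t0 < r \<Longrightarrow> dist (A t) (A t0) < d"
    using assms(1) t0 unfolding continuous_on_iff by metis
  show "\<exists>d>0. \<forall>x'\<in>S. dist x' t0 < d \<longrightarrow> dist (u x') (u t0) < e"
  proof (intro exI[of _ r] conjI ballI impI r(1))
    fix t assume t: "t \<in> S" "dist t t0 < r"
    let ?w = "u t - u t0"
    have "blinfun_apply (A t0) ?w = blinfun_apply (A t0 - A t) (u t)"
      using assms(3)[OF t0] assms(3)[OF t(1)] by (simp add: blinfun.diff_left blinfun.diff_right)
    then have "b * norm ?w \<le> norm (A t0 - A t) * norm (u t)"
      using b(2)[of ?w] norm_blinfun[of "A t0 - A t" "u t"] by simp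
    also have "\<dots> \<le> d * norm (u t)"
      using r(2)[OF t] by (intro mult_right_mono) (auto simp: dist_norm norm_minus_commute)
    also have "\<dots> \<le> d * (norm ?w + norm (u t0))"
      using \<open>d > 0\<close> norm_triangle_ineq[of ?w "u t0"] by (intro mult_left_mono) auto
    also have "\<dots> \<le> b/2 * norm ?w + d * (norm (u t0) + 1)"
    proof -
      have "d \<le> b/2" unfolding d_def by (rule min.cobounded1)
      then have "d * norm ?w \<le> b/2 * norm ?w" by (intro mult_right_mono) auto
      then show ?thesis using \<open>d > 0\<close> by (simp add: algebra_simps)
    qed
    also have "d * (norm (u t0) + 1) \<le> (e * b / (2 * (norm (u t0) + 1)) / 2) * (norm (u t0) + 1)"
      by (intro mult_right_mono) (auto simp: d_def)
    also have "(e * b / (2 * (norm (u t0) + 1)) / 2) * (norm (u t0) + 1) = e * b / 4"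
      by (simp add: divide_simps add_nonneg_eq_0_iff)
    finally have "b * (norm ?w / 2) \<le> b * (e / 4)" by (simp add: field_simps)
    then have "norm ?w / 2 \<le> e / 4" using b(1) by simp
    then show "dist (u t) (u t0) < e" using \<open>e > 0\<close> by (simp add: dist_norm)
  qed
qed

text \<open>Along a curve in \<open>M\<close> the function \<psi> vanishes near time 0, so by the
  chain rule its differential annihilates the velocity.\<close>

lemma tangent_space_subset_kernel:
  assumes W: "local_defining_function M W \<psi>" and y: "y \<in> M \<inter> W" and v: "v \<in> tangent_space M y"
  shows "frechet_derivative \<psi> (at y) v = 0"
proof -
  obtain c e where e: "e > 0" and cM: "c ` {-e<..<e} \<subseteq> M" and c0: "c 0 = y"
    and der: "(c has_vector_derivative v) (at 0)"
    using v unfolding tangent_space_def by blast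
  have W': "open W" "M \<inter> W = {x\<in>W. \<psi> x = 0}" and C1: "Ck_on (Suc 0) \<psi> W"
    using W unfolding local_defining_function_def smooth_on_def by blast+
  have dc: "(c has_derivative (\<lambda>t. t *\<^sub>R v)) (at 0)"
    using der unfolding has_vector_derivative_def .
  have "(\<psi> has_derivative frechet_derivative \<psi> (at (c 0))) (at (c 0))"
    using Ck_on_1_D(1)[OF C1] y c0 by auto
  then have D: "((\<lambda>t. \<psi> (c t)) has_derivative (\<lambda>t. frechet_derivative \<psi> (at y) (t *\<^sub>R v))) (at 0)"
    using has_derivative_compose[OF dc] c0 by simp
  have "(c \<longlongrightarrow> c 0) (at 0)"
    using has_derivative_continuous[OF dc] by (simp add: continuous_within)
  then have "\<forall>\<^sub>F t in at 0. c t \<in> W"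
    using topological_tendstoD[OF _ W'(1)] y c0 by auto
  moreover have "\<forall>\<^sub>F t in at 0. t \<in> {-e<..<e}"
    using e by (intro eventually_at_in_open') auto
  ultimately have "\<forall>\<^sub>F t in at 0. \<psi> (c t) = (0::'b)"
    by eventually_elim (use cM W'(2) in blast)
  moreover have "\<psi> (c 0) = 0" using y W'(2) c0 by auto
  ultimately have "((\<lambda>t. 0) has_derivative (\<lambda>t. frechet_derivative \<psi> (at y) (t *\<^sub>R v))) (at (0::real))"
    using has_derivative_transform_eventually[OF D, of "\<lambda>_. 0"] by auto
  then have "(\<lambda>t::real. frechet_derivative \<psi> (at y) (t *\<^sub>R v)) = (\<lambda>t. 0)"
    by (rule has_derivative_unique) (rule has_derivative_const)
  then show ?thesis by (metis scaleR_one)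
qed

text \<open>Near y the set \<open>M\<close> is straightened by \<open>\<Psi>\<close>, which adds a
  linear projection \<open>P\<close> of z - y onto the kernel to the adjoint of \<open>B\<close>
  applied to \<psi> z. The adjoint keeps \<open>\<Psi>\<close> a self-map of the ambient space, as
  the inverse function theorem requires. The preimage of the segment t v is a curve in
  \<open>M\<close>: since v lies in the kernel, the adjoint part of \<open>\<Psi>\<close> must lie
  there too, and hence vanishes.\<close>

lemma kernel_subset_tangent_space:
  fixes \<psi> :: "'a::euclidean_space \<Rightarrow> 'b::euclidean_space"
  assumes W: "local_defining_function M W \<psi>" and y: "y \<in> M \<inter> W"
    and v: "frechet_derivative \<psi> (at y) v = 0"
  shows "v \<in> tangent_space M y"
proof -
  have W': "open W" "M \<inter> W = {x\<in>W. \<psi> x = 0}" and C1: "Ck_on (Suc 0) \<psi> W"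
    and surj: "surj (frechet_derivative \<psi> (at y))"
    using W y unfolding local_defining_function_def smooth_on_def by blast+
  define B where "B = frechet_derivative \<psi> (at y)"
  define D where "D = (\<lambda>z. frechet_derivative \<psi> (at z))"
  have hd: "(\<psi> has_derivative D z) (at z)" if "z \<in> W" for z
    using Ck_on_1_D(1)[OF C1 that] unfolding D_def .
  have bl: "bounded_linear (D z)" if "z \<in> W" for z using hd[OF that] by (rule has_derivative_bounded_linear)
  have blB: "bounded_linear B" using bl y unfolding B_def D_def by auto
  then have linB: "linear B" by (rule bounded_linear.linear)
  have blA: "bounded_linear (adjoint B)" using adjoint_linear[OF linB] by (simp add: linear_conv_bounded_linear)
  define K where "K = {h. B h = 0}"
  have sK: "subspace K" unfolding K_def using linB by (rule linear_subspace_kernel)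
  obtain P where P: "linear P" "\<And>h. P h \<in> K" "\<And>h. h \<in> K \<Longrightarrow> P h = h"
  proof -
    obtain f where "linear f" "f ` UNIV \<subseteq> K" "\<forall>h\<in>K. f h = h"
      using linear_exists_left_inverse_on[of id K] sK
      by (metis (no_types) linear_id inj_on_id id_apply)
    then show ?thesis using that[of f] by auto
  qed
  define A where "A z = Blinfun (\<lambda>h. P h + adjoint B (D z h))" for z
  define \<Psi> where "\<Psi> z = P (z - y) + adjoint B (\<psi> z)" for z
  have AT: "adjoint B z = 0 \<Longrightarrow> z = 0" for z
  proof -
    assume "adjoint B z = 0"
    obtain h where "z = B h" using surj unfolding B_def by (metis surjD)
    then have "z \<bullet> z = h \<bullet> adjoint B z" using adjoint_works[OF linB] by (metis)
    then show "z = 0" using \<open>adjoint B z = 0\<close> by simp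
  qed
  \<comment> \<open>The range of the adjoint meets \<open>K\<close> only in 0. This gives the
    injectivity of \<open>A y\<close> and, at the end, that the curve stays in
    \<open>M\<close>.\<close>
  have ATK: "z = 0" if "adjoint B z \<in> K" for z
  proof -
    have "adjoint B z \<bullet> adjoint B z = B (adjoint B z) \<bullet> z"
      using adjoint_works[OF linB] by metis
    then show ?thesis using that AT unfolding K_def by auto
  qed
  have blP: "bounded_linear P" using P(1) by (simp add: linear_conv_bounded_linear)
  have blS: "bounded_linear (\<lambda>h. P h + adjoint B (D z h))" if "z \<in> W" for z
    by (intro bounded_linear_add blP bounded_linear_compose[OF blA] bl[OF that])
  have Aap: "blinfun_apply (A z) = (\<lambda>h. P h + adjoint B (D z h))" if "z \<in> W" for z
    unfolding A_def by (rule bounded_linear_Blinfun_apply[OF blS[OF that]])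
  have contA: "continuous_on W A"
  proof (rule continuous_on_blinfun_componentwise)
    fix i :: 'a
    have "continuous_on W (\<lambda>z. P i + adjoint B (D z i))"
      unfolding D_def by (intro continuous_intros Ck_on_1_D(2)[OF C1, of y] bounded_linear.continuous_on[OF blA])
        (use y in auto)
    then show "continuous_on W (\<lambda>z. blinfun_apply (A z) i)"
      by (rule continuous_on_eq) (simp add: Aap)
  qed
  have der\<Psi>: "(\<Psi> has_derivative blinfun_apply (A z)) (at z)" if "z \<in> W" for z
  proof -
    have d: "((\<lambda>z. z - y) has_derivative (\<lambda>h. h)) (at z)"
      by (auto intro!: derivative_eq_intros)
    show ?thesis
      unfolding Aap[OF that] \<Psi>_def
      by (rule has_derivative_add[OF bounded_linear.has_derivative[OF blP d]
          bounded_linear.has_derivative[OF blA hd[OF that]]])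
  qed
  have yW: "y \<in> W" and Dy: "D y = B" using y by (auto simp: B_def D_def)
  have injA: "inj (blinfun_apply (A y))"
  proof -
    have "h = 0" if "P h + adjoint B (B h) = 0" for h
    proof -
      have "adjoint B (B (- h)) = P h"
        using that unfolding linear_neg[OF linB] linear_neg[OF adjoint_linear[OF linB]]
        by (metis add_eq_0_iff2 minus_minus)
      then have "B (- h) = 0" by (intro ATK) (simp only: P(2))
      then have Bh: "B h = 0" using linear_neg[OF linB, of h] by simp
      then have "h \<in> K" unfolding K_def by simp
      then show "h = 0" using P(3)[of h] that linear_0[OF adjoint_linear[OF linB]] unfolding Bh by simp
    qed
    then show ?thesis
      unfolding Aap[OF yW] Dy
      unfolding linear_injective_0[OF bounded_linear.linear[OF blS[OF yW, unfolded Dy]]] by blast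
  qed
  obtain G where G: "linear G" "G \<circ> blinfun_apply (A y) = id"
    using linear_injective_left_inverse[OF bounded_linear.linear[OF blinfun.bounded_linear_right] injA] by blast
  have blG: "bounded_linear G" using G(1) by (simp add: linear_conv_bounded_linear)
  have invf: "Blinfun G o\<^sub>L A y = id_blinfun"
    by (rule blinfun_eqI) (use G(2) in \<open>simp add: bounded_linear_Blinfun_apply[OF blG] fun_eq_iff\<close>)
  have "\<exists>U' Y g g'. open U' \<and> U' \<subseteq> W \<and> y \<in> U' \<and> open Y \<and> \<Psi> y \<in> Y \<and> homeomorphism U' Y \<Psi> g \<and>
    (\<forall>z\<in>Y. (g has_derivative (g' z)) (at z) \<and> g' z = inv (blinfun_apply (A (g z))) \<and> bij (blinfun_apply (A (g z))))"
    by (rule inverse_function_theorem[OF W'(1) der\<Psi> contA yW invf], assumption) blast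
  then obtain U' Y g g' where U': "open U'" "U' \<subseteq> W" "y \<in> U'" and Y: "open Y" "\<Psi> y \<in> Y"
    and hom: "homeomorphism U' Y \<Psi> g"
    and dg: "\<And>z. z \<in> Y \<Longrightarrow> (g has_derivative (g' z)) (at z)"
    and g': "\<And>z. z \<in> Y \<Longrightarrow> g' z = inv (blinfun_apply (A (g z)))"
    and bij: "\<And>z. z \<in> Y \<Longrightarrow> bij (blinfun_apply (A (g z)))"
    by blast
  have \<psi>y: "\<psi> y = 0" using y W'(2) by auto
  have \<Psi>y: "\<Psi> y = 0" unfolding \<Psi>_def \<psi>y
    using linear_0[OF P(1)] linear_0[OF adjoint_linear[OF linB]] by simp
  have "open ((\<lambda>t. t *\<^sub>R v) -` Y)"
    by (intro open_vimage[OF Y(1)] continuous_intros)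
  moreover have "0 \<in> (\<lambda>t. t *\<^sub>R v) -` Y" using Y(2) \<Psi>y by simp
  ultimately obtain e where e: "e > 0" "ball 0 e \<subseteq> (\<lambda>t::real. t *\<^sub>R v) -` Y"
    using open_contains_ball by metis
  have tY: "t *\<^sub>R v \<in> Y" if "t \<in> {-e<..<e}" for t
    using e(2) that by (auto simp: subset_iff dist_real_def)
  define c where "c t = g (t *\<^sub>R v)" for t
  define u where "u t = g' (t *\<^sub>R v) v" for t
  have dc: "(c has_vector_derivative u t) (at t)" if "t \<in> {-e<..<e}" for t
  proof -
    have "((\<lambda>t. t *\<^sub>R v) has_derivative (\<lambda>s. s *\<^sub>R v)) (at t)" by (auto intro!: derivative_eq_intros)
    from has_derivative_compose[OF this dg[OF tY[OF that]]]
    have "(c has_derivative (\<lambda>s. g' (t *\<^sub>R v) (s *\<^sub>R v))) (at t)" unfolding c_def .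
    moreover have "linear (g' (t *\<^sub>R v))" using dg[OF tY[OF that]] has_derivative_linear by blast
    ultimately show ?thesis unfolding has_vector_derivative_def u_def by (simp add: linear_cmul)
  qed
  have cU: "c t \<in> U'" "\<Psi> (c t) = t *\<^sub>R v" if "t \<in> {-e<..<e}" for t
    using hom tY[OF that] unfolding homeomorphism_def c_def by auto
  have Au: "blinfun_apply (A (c t)) (u t) = v" if "t \<in> {-e<..<e}" for t
    using bij[OF tY[OF that]] g'[OF tY[OF that]] unfolding u_def c_def
    by (simp add: bij_is_surj surj_f_inv_f)
  have cc: "continuous_on {-e<..<e} c"
    using dc has_vector_derivative_continuous continuous_at_imp_continuous_on by blast
  \<comment> \<open>The derivative of the inverse is known only pointwise, as an \<open>inv\<close>.
    Continuity of the velocity comes from the equation \<open>Au\<close>, whose coefficients are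
    continuous along the curve.\<close>
  have cu: "continuous_on {-e<..<e} u"
  proof (rule continuous_on_solve[where A = "\<lambda>t. A (c t)" and v = v])
    show "continuous_on {-e<..<e} (\<lambda>t. A (c t))"
      using continuous_on_compose2[OF contA cc] cU(1) U'(2) by blast
    show "inj (blinfun_apply (A (c t)))" if "t \<in> {-e<..<e}" for t
      using bij[OF tY[OF that]] unfolding c_def bij_def by blast
  qed (rule Au)
  have c0: "c 0 = y"
  proof -
    have "g (\<Psi> y) = y" using hom U'(3) unfolding homeomorphism_def by blast
    then show ?thesis unfolding c_def \<Psi>y by simp
  qed
  have vK: "v \<in> K" using v unfolding K_def B_def by simp
  have cM: "c t \<in> M" if "t \<in> {-e<..<e}" for t
  proof -
    have "adjoint B (\<psi> (c t)) = t *\<^sub>R v - P (c t - y)"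
      using cU(2)[OF that] unfolding \<Psi>_def by (simp add: algebra_simps)
    also have "\<dots> \<in> K" using sK vK P(2) by (intro subspace_diff subspace_scale) auto
    finally have "\<psi> (c t) = 0" by (rule ATK)
    then show ?thesis using W'(2) cU(1)[OF that] U'(2) by blast
  qed
  have 0: "0 \<in> {-e<..<e}" using e by auto
  have "blinfun_apply (A y) v = v"
    using P(3)[OF vK] v linear_0[OF adjoint_linear[OF linB]] unfolding Aap[OF yW] Dy by (simp add: B_def)
  then have "u 0 = v" using Au[OF 0] injA unfolding c0 by (metis injD)
  then have "(c has_vector_derivative v) (at 0)" using dc[OF 0] by simp
  moreover have "c C1_differentiable_on {-e<..<e}"
    unfolding C1_differentiable_on_def using dc cu by blast
  ultimately show ?thesis
    unfolding tangent_space_def using e(1) c0 cM by blast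
qed

lemma tangent_space_eq_kernel:
  fixes \<psi> :: "'a::euclidean_space \<Rightarrow> 'b::euclidean_space"
  assumes "local_defining_function M W \<psi>" "y \<in> M \<inter> W"
  shows "tangent_space M y = {v. frechet_derivative \<psi> (at y) v = 0}"
  using tangent_space_subset_kernel[OF assms] kernel_subset_tangent_space[OF assms] by blast

lemma closest_point_subspace:
  fixes S :: "'a::euclidean_space set"
  assumes "subspace S"
  shows "closest_point S v \<in> S"
    and "w \<in> S \<Longrightarrow> inner (v - closest_point S v) w = 0"
    and "w \<in> S \<Longrightarrow> inner (closest_point S v) w = inner v w"
    and "norm (v - closest_point S v) = infdist v S"
    and "norm (closest_point S v) \<le> norm v"
proof -
  have S: "closed S" "S \<noteq> {}" "convex S"
    using assms closed_subspace subspace_0 subspace_imp_convex by auto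
  show 1: "closest_point S v \<in> S" using S by (intro closest_point_in_set) auto
  \<comment> \<open>On a subspace the variational inequality of the closest point can be tested with
    both w and - w.\<close>
  have 2: "inner (v - closest_point S v) w = 0" if "w \<in> S" for w
  proof -
    have "inner (v - closest_point S v) w \<le> 0" if "w \<in> S" for w
      using closest_point_dot[OF S(3,1), of "closest_point S v + w" v] subspace_add[OF assms 1 that] by simp
    from this[OF that] this[OF subspace_neg[OF assms that]] show ?thesis by simp
  qed
  then show "w \<in> S \<Longrightarrow> inner (v - closest_point S v) w = 0" by blast
  then show "w \<in> S \<Longrightarrow> inner (closest_point S v) w = inner v w" by (simp add: inner_diff_left)
  show "norm (v - closest_point S v) = infdist v S"
  proof (rule antisym)
    show "norm (v - closest_point S v) \<le> infdist v S"
      unfolding infdist_notempty[OF S(2)]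
      by (rule cINF_greatest[OF S(2)]) (use closest_point_le[OF S(1)] in \<open>auto simp: dist_norm\<close>)
    show "infdist v S \<le> norm (v - closest_point S v)"
      using infdist_le[OF 1, of v] by (simp add: dist_norm)
  qed
  have "inner (closest_point S v) (closest_point S v) = inner v (closest_point S v)"
    using 2[OF 1] by (simp add: inner_diff_left)
  then have "norm (closest_point S v) * norm (closest_point S v) \<le> norm v * norm (closest_point S v)"
    using norm_cauchy_schwarz[of v "closest_point S v"] by (simp add: power2_norm_eq_inner[symmetric] power2_eq_square)
  then show "norm (closest_point S v) \<le> norm v"
    by (cases "closest_point S v = 0") auto
qed

section \<open>Second derivatives of the defining functions\<close>

lemma joint_derivative:
  fixes \<psi> :: "'a::euclidean_space \<Rightarrow> 'b::euclidean_space"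
  assumes W: "open W" "smooth_on \<psi> W" and y: "y \<in> W"
  defines "D \<equiv> \<lambda>z. frechet_derivative \<psi> (at z)"
  shows "((\<lambda>z. D (fst z) (snd z)) has_derivative
    (\<lambda>h. (\<Sum>b\<in>Basis. \<Sum>c\<in>Basis. ((v \<bullet> b) * (fst h \<bullet> c)) *\<^sub>R frechet_derivative (\<lambda>z. D z b) (at y) c) + D y (snd h)))
    (at (y, v))"
proof -
  have C1: "Ck_on (Suc 0) \<psi> W" and C2: "Ck_on (Suc (Suc 0)) \<psi> W"
    using W(2) unfolding smooth_on_def by blast+
  have lin: "linear (D z)" if "z \<in> W" for z
    unfolding D_def using Ck_on_1_D(1)[OF C1 that] has_derivative_linear by blast
  have dD: "((\<lambda>z. D z b) has_derivative frechet_derivative (\<lambda>z. D z b) (at y)) (at y)" for b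
    using C2 Ck_on_1_D(1)[of "\<lambda>z. D z b" W y] y unfolding D_def by auto
  let ?E = "\<lambda>b. frechet_derivative (\<lambda>z. D z b) (at y)"
  have linE: "linear (?E b)" for b using dD has_derivative_linear by blast
  \<comment> \<open>Smoothness is available for z \<mapsto> D z b with a fixed direction b. The map
    of both variables is therefore expanded in the basis of the second one before the product rule
    is applied.\<close>
  have expand: "f v = (\<Sum>b\<in>Basis. (v \<bullet> b) *\<^sub>R f b)" if "linear f" for f :: "'a \<Rightarrow> 'b" and v
    using linear_sum[OF that, of "\<lambda>b. (v \<bullet> b) *\<^sub>R b" Basis] linear_cmul[OF that]
    by (simp add: euclidean_representation)
  have fst': "(fst has_derivative fst) (at (y, v))" and snd': "(snd has_derivative snd) (at (y, v))"
    by (auto intro: bounded_linear_imp_has_derivative bounded_linear_fst bounded_linear_snd)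
  have A: "((\<lambda>z. (snd z \<bullet> b) *\<^sub>R D (fst z) b) has_derivative
      (\<lambda>h. (v \<bullet> b) *\<^sub>R ?E b (fst h) + (snd h \<bullet> b) *\<^sub>R D y b)) (at (y, v))" for b
  proof -
    have 1: "((\<lambda>z. snd z \<bullet> b) has_derivative (\<lambda>h. snd h \<bullet> b)) (at (y, v))"
      by (rule has_derivative_inner_left[OF snd'])
    have 2: "((\<lambda>z. D (fst z) b) has_derivative (\<lambda>h. ?E b (fst h))) (at (y, v))"
      using has_derivative_compose[OF fst', of "\<lambda>z. D z b" "?E b"] dD by simp
    from has_derivative_scaleR[OF 1 2] show ?thesis by simp
  qed
  have "((\<lambda>z. \<Sum>b\<in>Basis. (snd z \<bullet> b) *\<^sub>R D (fst z) b) has_derivative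
      (\<lambda>h. \<Sum>b\<in>Basis. (v \<bullet> b) *\<^sub>R ?E b (fst h) + (snd h \<bullet> b) *\<^sub>R D y b)) (at (y, v))"
    by (rule has_derivative_sum[OF A])
  moreover have "(\<Sum>b\<in>Basis. (v \<bullet> b) *\<^sub>R ?E b (fst h) + (snd h \<bullet> b) *\<^sub>R D y b) =
     (\<Sum>b\<in>Basis. \<Sum>c\<in>Basis. ((v \<bullet> b) * (fst h \<bullet> c)) *\<^sub>R ?E b c) + D y (snd h)" for h
    using expand[OF lin[OF y], of "snd h"] expand[OF linE, of _ "fst h"]
    by (simp add: sum.distrib scaleR_sum_right)
  ultimately have der: "((\<lambda>z. \<Sum>b\<in>Basis. (snd z \<bullet> b) *\<^sub>R D (fst z) b) has_derivative
      (\<lambda>h. (\<Sum>b\<in>Basis. \<Sum>c\<in>Basis. ((v \<bullet> b) * (fst h \<bullet> c)) *\<^sub>R ?E b c) + D y (snd h))) (at (y, v))"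
    by simp
  show ?thesis
  proof (rule has_derivative_transform_within_open[OF der])
    show "open (W \<times> (UNIV :: 'a set))" using W(1) by (simp add: open_Times)
    show "(y, v) \<in> W \<times> UNIV" using y by simp
    show "(\<Sum>b\<in>Basis. (snd z \<bullet> b) *\<^sub>R D (fst z) b) = D (fst z) (snd z)" if "z \<in> W \<times> UNIV" for z
      using expand[OF lin, of "fst z" "snd z"] that by auto
  qed
qed

text \<open>\<open>L a\<close> is the second derivative of the defining function at y in the
  directions v and a. What matters is a constant uniform over charts and points, and the factor
  \<open>norm v\<close>: it makes the curvature part of a subgradient proportional to the
  step.\<close>

definition second_order_bound ::
  "'a::euclidean_space set \<Rightarrow> 'i set \<Rightarrow> ('i \<Rightarrow> 'a set) \<Rightarrow> ('i \<Rightarrow> 'a \<Rightarrow> 'b::euclidean_space) \<Rightarrow> real \<Rightarrow> bool" where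
  "second_order_bound M I V \<psi> C \<longleftrightarrow> C \<ge> 0 \<and> (\<forall>i\<in>I. \<forall>y\<in>M \<inter> closure (V i). \<forall>v.
      \<exists>L. (\<forall>a. norm (L a) \<le> C * norm v * norm a) \<and>
        ((\<lambda>z. frechet_derivative (\<psi> i) (at (fst z)) (snd z)) has_derivative
          (\<lambda>h. L (fst h) + frechet_derivative (\<psi> i) (at y) (snd h))) (at (y, v)))"

text \<open>The second partial derivatives are continuous on \<open>W i\<close>, hence bounded on
  the compact set M \<inter> closure (V i), which lies inside \<open>W i\<close>. As
  \<open>I\<close> and the basis are finite, the sum of all these bounds serves every chart.\<close>

lemma second_order_bound_exists:
  fixes \<psi> :: "'i \<Rightarrow> 'a::euclidean_space \<Rightarrow> 'b::euclidean_space"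
  assumes "compact M" "defining_cover M I V W \<psi>"
  obtains C where "second_order_bound M I V \<psi> C"
proof -
  have I: "finite I" "\<And>i. i \<in> I \<Longrightarrow> open (W i)" "\<And>i. i \<in> I \<Longrightarrow> smooth_on (\<psi> i) (W i)"
    "\<And>i. i \<in> I \<Longrightarrow> closure (V i) \<subseteq> W i"
    using assms(2) unfolding defining_cover_def local_defining_function_def by auto
  define q where "q i b c y = frechet_derivative (\<lambda>z. frechet_derivative (\<psi> i) (at z) b) (at y) c" for i b c y
  have "\<exists>K. \<forall>y\<in>M \<inter> closure (V i). norm (q i b c y) \<le> K" if "i \<in> I" for i b c
  proof -
    have C2: "Ck_on (Suc (Suc 0)) (\<psi> i) (W i)" using I(3)[OF that] unfolding smooth_on_def by blast
    have "continuous_on (M \<inter> closure (V i)) (q i b c)"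
    proof (cases "W i = {}")
      case True then show ?thesis using I(4)[OF that] by auto
    next
      case False
      then obtain y where "y \<in> W i" by auto
      have "Ck_on (Suc 0) (\<lambda>z. frechet_derivative (\<psi> i) (at z) b) (W i)" using C2 by auto
      then have "continuous_on (W i) (q i b c)"
        unfolding q_def by (rule Ck_on_1_D(2)[OF _ \<open>y \<in> W i\<close>])
      then show ?thesis by (rule continuous_on_subset) (use I(4)[OF that] in blast)
    qed
    moreover have "compact (M \<inter> closure (V i))" using assms(1) by (simp add: compact_Int_closed)
    ultimately have "bounded (q i b c ` (M \<inter> closure (V i)))"
      using compact_continuous_image compact_imp_bounded by blast
    then show ?thesis unfolding bounded_iff by auto
  qed
  then obtain K where K: "\<And>i b c y. i \<in> I \<Longrightarrow> y \<in> M \<inter> closure (V i) \<Longrightarrow> norm (q i b c y) \<le> K i b c"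
    by metis
  define C where "C = (\<Sum>i\<in>I. \<Sum>b\<in>(Basis::'a set). \<Sum>c\<in>(Basis::'a set). \<bar>K i b c\<bar>)"
  show thesis
  proof (rule that[of C], unfold second_order_bound_def, intro conjI ballI allI)
    show "C \<ge> 0" unfolding C_def by (intro sum_nonneg) auto
    fix i y and v :: 'a assume i: "i \<in> I" and y: "y \<in> M \<inter> closure (V i)"
    define L where "L a = (\<Sum>b\<in>Basis. \<Sum>c\<in>Basis. ((v \<bullet> b) * (a \<bullet> c)) *\<^sub>R q i b c y)" for a
    have "norm (L a) \<le> C * norm v * norm a" for a
    proof -
      have "norm (L a) \<le> (\<Sum>b\<in>Basis. \<Sum>c\<in>Basis. norm v * norm a * \<bar>K i b c\<bar>)"
        unfolding L_def
      proof (intro order_trans[OF norm_sum] sum_mono)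
        fix b c :: 'a assume "b \<in> Basis" "c \<in> Basis"
        have "norm (((v \<bullet> b) * (a \<bullet> c)) *\<^sub>R q i b c y) = \<bar>v \<bullet> b\<bar> * \<bar>a \<bullet> c\<bar> * norm (q i b c y)"
          by (simp add: abs_mult)
        also have "\<dots> \<le> norm v * norm a * \<bar>K i b c\<bar>"
          using K[OF i y, of b c] \<open>b \<in> Basis\<close> \<open>c \<in> Basis\<close>
          by (intro mult_mono Basis_le_norm) auto
        finally show "norm (((v \<bullet> b) * (a \<bullet> c)) *\<^sub>R q i b c y) \<le> norm v * norm a * \<bar>K i b c\<bar>" .
      qed
      also have "\<dots> = norm v * norm a * (\<Sum>b\<in>(Basis::'a set). \<Sum>c\<in>(Basis::'a set). \<bar>K i b c\<bar>)"
        by (simp add: sum_distrib_left)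
      also have "\<dots> \<le> norm v * norm a * C"
        unfolding C_def using i I(1)
        by (intro mult_left_mono member_le_sum[of i I "\<lambda>i. \<Sum>b\<in>Basis. \<Sum>c\<in>Basis. \<bar>K i b c\<bar>"] sum_nonneg) auto
      finally show ?thesis by (simp add: ac_simps)
    qed
    moreover have "((\<lambda>z. frechet_derivative (\<psi> i) (at (fst z)) (snd z)) has_derivative
          (\<lambda>h. L (fst h) + frechet_derivative (\<psi> i) (at y) (snd h))) (at (y, v))"
      unfolding L_def q_def using joint_derivative[OF I(2)[OF i] I(3)[OF i]] y I(4)[OF i] by blast
    ultimately show "\<exists>L. (\<forall>a. norm (L a) \<le> C * norm v * norm a) \<and>
        ((\<lambda>z. frechet_derivative (\<psi> i) (at (fst z)) (snd z)) has_derivative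
          (\<lambda>h. L (fst h) + frechet_derivative (\<psi> i) (at y) (snd h))) (at (y, v))" by blast
  qed
qed

section \<open>Normal vectors and subgradients on the tangent bundle\<close>

locale covered_manifold =
  fixes M :: "'a::euclidean_space set" and I :: "'i set" and V W :: "'i \<Rightarrow> 'a set"
    and \<psi> :: "'i \<Rightarrow> 'a \<Rightarrow> 'b::euclidean_space" and sel :: "'a \<Rightarrow> 'i" and C0 :: real
  assumes compact_M: "compact M" and cover: "defining_cover M I V W \<psi>"
    and sel: "\<forall>y\<in>M. sel y \<in> I \<and> y \<in> V (sel y)"
    and C0_pos: "C0 > 0"
    and C0: "\<forall>y\<in>M. \<forall>v. infdist v (tangent_space M y) \<le> C0 * norm (frechet_derivative (\<psi> (sel y)) (at y) v)"
begin

abbreviation B where "B y \<equiv> frechet_derivative (\<psi> (sel y)) (at y)"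

lemma chart:
  assumes "i \<in> I"
  shows "local_defining_function M (W i) (\<psi> i)" "closure (V i) \<subseteq> W i"
  using assms cover unfolding defining_cover_def by auto

lemma sel_in: assumes "y \<in> M" shows "sel y \<in> I" "y \<in> M \<inter> closure (V (sel y))" "y \<in> M \<inter> W (sel y)"
  using assms sel chart(2) closure_subset by blast+

lemma linear_B: "y \<in> M \<Longrightarrow> linear (B y)" and surj_B: "y \<in> M \<Longrightarrow> surj (B y)"
proof -
  assume y: "y \<in> M"
  have W: "local_defining_function M (W (sel y)) (\<psi> (sel y))" using chart sel_in y by blast
  then have "Ck_on (Suc 0) (\<psi> (sel y)) (W (sel y))"
    unfolding local_defining_function_def smooth_on_def by blast
  then show "linear (B y)" using Ck_on_1_D(1) sel_in(3)[OF y] has_derivative_linear by blast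
  show "surj (B y)" using W sel_in(3)[OF y] unfolding local_defining_function_def by blast
qed

lemma tangent_eq: "y \<in> M \<Longrightarrow> tangent_space M y = {v. B y v = 0}"
  using tangent_space_eq_kernel chart(1) sel_in by blast

lemma subspace_tangent: "y \<in> M \<Longrightarrow> subspace (tangent_space M y)"
  unfolding tangent_eq by (rule linear_subspace_kernel[OF linear_B])

lemma normal_eq: "y \<in> M \<Longrightarrow> n \<in> normal_space M y \<longleftrightarrow> (\<forall>v\<in>tangent_space M y. inner n v = 0)"
  unfolding normal_space_def orthogonal_comp_def orthogonal_def by (auto simp: inner_commute)

text \<open>Lagrange multipliers: the tangent space is the orthogonal complement of the range of the
  adjoint, so the normal space is that range. For the bound, \<zeta> is the image of some u
  orthogonal to the tangent space, with norm at most C0 * norm \<zeta>; pairing n with u yields the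
  square of norm \<zeta>.\<close>

lemma normal_multiplier:
  assumes y: "y \<in> M" and n: "n \<in> normal_space M y"
  obtains \<zeta> where "\<And>v. inner n v = inner \<zeta> (B y v)" "norm \<zeta> \<le> C0 * norm n"
proof -
  have "tangent_space M y = (range (adjoint (B y)))\<^sup>\<bottom>"
    using ker_orthogonal_comp_adjoint[OF linear_B[OF y]] unfolding tangent_eq[OF y] by auto
  then have "normal_space M y = range (adjoint (B y))"
    unfolding normal_space_def
    using orthogonal_comp_self linear_subspace_image[OF adjoint_linear[OF linear_B[OF y]] subspace_UNIV] by metis
  then obtain \<zeta> where \<zeta>: "n = adjoint (B y) \<zeta>" using n by auto
  have 1: "inner n v = inner \<zeta> (B y v)" for v
    unfolding \<zeta> using adjoint_works[OF linear_B[OF y], of v \<zeta>] by (simp add: inner_commute)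
  obtain v where v: "\<zeta> = B y v" using surj_B[OF y] by (metis surjD)
  define u where "u = v - closest_point (tangent_space M y) v"
  note cp = closest_point_subspace[OF subspace_tangent[OF y]]
  have "B y u = \<zeta>"
    using cp(1)[of v] unfolding u_def linear_diff[OF linear_B[OF y]] tangent_eq[OF y] v by auto
  moreover have "norm u \<le> C0 * norm \<zeta>" unfolding u_def cp(4) v using C0 y by blast
  ultimately have "norm \<zeta> * norm \<zeta> \<le> norm n * (C0 * norm \<zeta>)"
    using 1[of u] norm_cauchy_schwarz[of n u] mult_left_mono[of "norm u" "C0 * norm \<zeta>" "norm n"]
    by (simp add: power2_norm_eq_inner[symmetric] power2_eq_square)
  then have "norm \<zeta> \<le> C0 * norm n"
    by (cases "\<zeta> = 0") (auto simp: algebra_simps C0_pos less_imp_le)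
  with 1 show thesis by (rule that)
qed

text \<open>A Lagrangian argument: F is modified by terms that vanish on the tangent bundle, so that
  the gradient of the modified function already contains the normal directions of the bundle. Adding
  the subgradient inequality of R then gives a regular subgradient with components p + q and p,
  where p is the stationarity residual and q the curvature term.\<close>

lemma regular_subgradient_shifted:
  assumes C: "second_order_bound M I V \<psi> C"
    and y: "y \<in> M" and v: "v \<in> tangent_space M y" and n: "n \<in> normal_space M y"
    and gF: "GDERIV F (y + v) :> gF" and g: "g \<in> convex_subdifferential R (y + v)"
  shows "\<exists>w\<in>regular_subdifferential (shifted_objective M (\<lambda>z. F z + R z)) (y, v).
     norm w \<le> 2 * norm (gF + g + n) + C * C0 * norm v * norm n"
proof -
  let ?i = "sel y" and ?\<Phi> = "\<lambda>z. F z + R z"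
  obtain L where L: "\<And>a. norm (L a) \<le> C * norm v * norm a"
    and dL: "((\<lambda>z. frechet_derivative (\<psi> ?i) (at (fst z)) (snd z)) has_derivative
          (\<lambda>h. L (fst h) + B y (snd h))) (at (y, v))"
    using C sel_in(1)[OF y] sel_in(2)[OF y] unfolding second_order_bound_def by blast
  have C_nonneg: "C \<ge> 0" using C unfolding second_order_bound_def by blast
  obtain \<zeta> where \<zeta>: "\<And>v. inner n v = inner \<zeta> (B y v)" "norm \<zeta> \<le> C0 * norm n"
    using normal_multiplier[OF y n] by blast
  have "linear (\<lambda>h. L (fst h) + B y (snd h))" using dL has_derivative_linear by blast
  then have linL: "linear L"
  proof -
    have "linear (\<lambda>a. (\<lambda>h. L (fst h) + B y (snd h)) (a, 0))"
      using linear_compose[of "\<lambda>a. (a, 0)" "\<lambda>h. L (fst h) + B y (snd h)"]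
        \<open>linear (\<lambda>h. L (fst h) + B y (snd h))\<close>
      by (simp add: o_def linear_iff)
    then show ?thesis using linear_0[OF linear_B[OF y]] by simp
  qed
  \<comment> \<open>The second derivative tested with the multiplier; its norm inherits the factor
    \<open>norm v\<close> of \<open>L\<close> and the bound on \<zeta> by n.\<close>
  define q where "q = adjoint L \<zeta>"
  have q: "inner q a = inner \<zeta> (L a)" for a
    unfolding q_def using adjoint_works[OF linL, of a \<zeta>] by (simp add: inner_commute)
  have nq: "norm q \<le> C * C0 * norm v * norm n"
  proof (cases "q = 0")
    case False
    have "norm q * norm q \<le> norm \<zeta> * norm (L q)"
      using q[of q] norm_cauchy_schwarz[of \<zeta> "L q"] by (simp add: power2_norm_eq_inner[symmetric] power2_eq_square)
    also have "\<dots> \<le> (C0 * norm n) * (C * norm v * norm q)"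
      using \<zeta>(2) L[of q] C0_pos by (intro mult_mono) auto
    finally show ?thesis using False by (simp add: algebra_simps)
  qed (use C_nonneg C0_pos in auto)
  define p where "p = gF + g + n"
  define w where "w = (p + q, p)"
  have "norm w \<le> norm (p + q) + norm p" unfolding w_def norm_Pair by (rule sqrt_sum_squares_le_sum) auto
  also have "\<dots> \<le> 2 * norm p + C * C0 * norm v * norm n" using norm_triangle_ineq[of p q] nq by simp
  finally have nw: "norm w \<le> 2 * norm (gF + g + n) + C * C0 * norm v * norm n" unfolding p_def .
  have W: "local_defining_function M (W ?i) (\<psi> ?i)" using chart sel_in y by blast
  have d\<psi>: "(\<psi> ?i has_derivative B y) (at y)"
    using W sel_in(3)[OF y] Ck_on_1_D(1) unfolding local_defining_function_def smooth_on_def by blast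
  \<comment> \<open>Both pairings with \<zeta> vanish for z in the tangent bundle over
    \<open>W ?i\<close>. Their derivatives at (y, v) contribute n + q to the first component and n
    to the second.\<close>
  define G where "G z = F (fst z + snd z) + inner \<zeta> (\<psi> ?i (fst z)) +
    inner \<zeta> (frechet_derivative (\<psi> ?i) (at (fst z)) (snd z))" for z
  have dG: "(G has_derivative (\<lambda>h. inner (fst h + snd h) gF + inner \<zeta> (B y (fst h))
     + inner \<zeta> (L (fst h) + B y (snd h)))) (at (y, v))"
  proof -
    have fst': "(fst has_derivative fst) (at (y, v))" and snd': "(snd has_derivative snd) (at (y, v))"
      by (auto intro: bounded_linear_imp_has_derivative bounded_linear_fst bounded_linear_snd)
    have s: "((\<lambda>z. fst z + snd z) has_derivative (\<lambda>h. fst h + snd h)) (at (y, v))"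
      by (rule has_derivative_add[OF fst' snd'])
    have 1: "((\<lambda>z. F (fst z + snd z)) has_derivative (\<lambda>h. inner (fst h + snd h) gF)) (at (y, v))"
      using has_derivative_compose[OF s, of F "\<lambda>h. inner h gF"] gF unfolding gderiv_def by simp
    have 2: "((\<lambda>z. \<psi> ?i (fst z)) has_derivative (\<lambda>h. B y (fst h))) (at (y, v))"
      using has_derivative_compose[OF fst', of "\<psi> ?i" "B y"] d\<psi> by simp
    show ?thesis unfolding G_def
      by (rule has_derivative_add[OF has_derivative_add[OF 1 has_derivative_inner_right[OF 2]]
          has_derivative_inner_right[OF dL]])
  qed
  have yvT: "(y, v) \<in> tangent_bundle M" using y v unfolding tangent_bundle_def by simp
  have zero: "\<psi> ?i (fst z) = 0 \<and> frechet_derivative (\<psi> ?i) (at (fst z)) (snd z) = 0"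
    if z: "z \<in> tangent_bundle M" "fst z \<in> W ?i" for z
  proof -
    have z': "fst z \<in> M \<inter> W ?i" "snd z \<in> tangent_space M (fst z)"
      using z unfolding tangent_bundle_def by auto
    then have "frechet_derivative (\<psi> ?i) (at (fst z)) (snd z) = 0"
      using tangent_space_subset_kernel[OF W] by blast
    moreover have "\<psi> ?i (fst z) = 0" using W z'(1) unfolding local_defining_function_def by blast
    ultimately show ?thesis by blast
  qed
  have "w \<in> regular_subdifferential (shifted_objective M ?\<Phi>) (y, v)"
    unfolding regular_subdifferential_def
  proof (intro CollectI conjI allI impI)
    show "\<bar>shifted_objective M ?\<Phi> (y, v)\<bar> \<noteq> \<infinity>"
      using yvT by (simp add: shifted_objective_def)
    fix \<epsilon> :: real assume "\<epsilon> > 0"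
    then obtain d where d: "d > 0" "\<And>z. norm (z - (y, v)) < d \<Longrightarrow>
        norm (G z - G (y, v) - (inner (fst (z - (y, v)) + snd (z - (y, v))) gF + inner \<zeta> (B y (fst (z - (y, v))))
     + inner \<zeta> (L (fst (z - (y, v))) + B y (snd (z - (y, v)))))) \<le> \<epsilon> * norm (z - (y, v))"
      using dG unfolding has_derivative_at_alt by blast
    have "\<forall>\<^sub>F z in at (y, v). z \<in> W ?i \<times> UNIV"
      using W sel_in(3)[OF y] unfolding local_defining_function_def
      by (intro eventually_at_in_open') (auto simp: open_Times)
    moreover have "\<forall>\<^sub>F z in at (y, v). norm (z - (y, v)) < d"
      using d(1) unfolding eventually_at dist_norm by blast
    ultimately show "\<forall>\<^sub>F z in at (y, v). shifted_objective M ?\<Phi> (y, v) +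
        ereal (inner w (z - (y, v)) - \<epsilon> * norm (z - (y, v))) \<le> shifted_objective M ?\<Phi> z"
    proof eventually_elim
      case (elim z)
      show ?case
      proof (cases "z \<in> tangent_bundle M")
        case False then show ?thesis by (simp add: shifted_objective_def)
      next
        case True
        define h1 h2 where "h1 = fst z - y" and "h2 = snd z - v"
        have zG: "G z = F (fst z + snd z)" using zero[OF True] elim(1) unfolding G_def by auto
        have z0: "G (y, v) = F (y + v)" using zero[OF yvT] sel_in(3)[OF y] unfolding G_def by auto
        have fs: "fst (z - (y, v)) = h1" "snd (z - (y, v)) = h2" unfolding h1_def h2_def by auto
        have "F (fst z + snd z) - F (y + v) - (inner (h1 + h2) gF + inner \<zeta> (B y h1) + inner \<zeta> (L h1 + B y h2))
           \<ge> - (\<epsilon> * norm (z - (y, v)))"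
          using d(2)[OF elim(2)] unfolding zG z0 fs by simp
        moreover have "R (fst z + snd z) \<ge> R (y + v) + inner g (h1 + h2)"
        proof -
          have "fst z + snd z - (y + v) = h1 + h2" unfolding h1_def h2_def by simp
          then show ?thesis using g unfolding convex_subdifferential_def by (auto dest: spec[of _ "fst z + snd z"])
        qed
        moreover have "inner w (z - (y, v)) = inner (p + q) h1 + inner p h2"
          unfolding w_def inner_prod_def fs by simp
        ultimately have "F (fst z + snd z) + R (fst z + snd z) \<ge>
           F (y + v) + R (y + v) + (inner w (z - (y, v)) - \<epsilon> * norm (z - (y, v)))"
          by (simp add: p_def inner_add_left inner_add_right q \<zeta>(1) inner_commute[of gF])
        then show ?thesis using True yvT by (simp add: shifted_objective_def)
      qed
    qed
  qed
  with nw show ?thesis by blast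
qed

text \<open>The normal bundle has a closed graph. A fixed tangent vector v at the limit is almost
  tangent at x k, with an error measured by the differential at x k applied to v, and this tends to
  0.\<close>

lemma normal_space_limit:
  assumes x: "\<And>k. x k \<in> M" "x \<longlonglongrightarrow> xs" and n: "\<And>k. n k \<in> normal_space M (x k)" "n \<longlonglongrightarrow> ns"
  shows "ns \<in> normal_space M xs"
proof -
  have xs: "xs \<in> M" using closed_sequentially[OF compact_imp_closed[OF compact_M]] x by blast
  have finI: "finite I" using cover unfolding defining_cover_def by blast
  \<comment> \<open>The selected chart may jump along the sequence; since \<open>I\<close> is
    finite, some subsequence uses a single chart.\<close>
  have "range (\<lambda>k. sel (x k)) \<subseteq> I" using sel_in(1)[OF x(1)] by auto
  then have "finite (range (\<lambda>k. sel (x k)))" using finI by (rule finite_subset)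
  then obtain k0 where inf: "infinite {k. sel (x k) = sel (x k0)}"
    using pigeonhole_infinite[of UNIV "\<lambda>k. sel (x k)"] by auto
  define i where "i = sel (x k0)"
  obtain \<sigma> :: "nat \<Rightarrow> nat" where \<sigma>: "strict_mono \<sigma>" "\<And>k. sel (x (\<sigma> k)) = i"
    using infinite_enumerate[OF inf] unfolding i_def by auto
  have iI: "i \<in> I" using sel_in x(1) unfolding i_def by blast
  have lim: "(\<lambda>k. x (\<sigma> k)) \<longlonglongrightarrow> xs" using LIMSEQ_subseq_LIMSEQ[OF x(2) \<sigma>(1)] by (simp add: o_def)
  have "x (\<sigma> k) \<in> closure (V i)" for k using sel_in(2)[OF x(1)[of "\<sigma> k"]] \<sigma>(2) by simp
  then have xsV: "xs \<in> closure (V i)" using closed_sequentially[OF closed_closure _ lim] by blast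
  then have xsW: "xs \<in> M \<inter> W i" using chart(2)[OF iI] xs by blast
  have W: "local_defining_function M (W i) (\<psi> i)" using chart iI by blast
  show ?thesis unfolding normal_eq[OF xs]
  proof
    fix v assume v: "v \<in> tangent_space M xs"
    have "continuous_on (W i) (\<lambda>z. frechet_derivative (\<psi> i) (at z) v)"
      using W xsW Ck_on_1_D(2)[of "\<psi> i" "W i" xs v] unfolding local_defining_function_def smooth_on_def by blast
    moreover have "open (W i)" using W unfolding local_defining_function_def by blast
    ultimately have "isCont (\<lambda>z. frechet_derivative (\<psi> i) (at z) v) xs"
      using xsW continuous_on_eq_continuous_at by blast
    then have B0: "(\<lambda>k. frechet_derivative (\<psi> i) (at (x (\<sigma> k))) v) \<longlonglongrightarrow> 0"
      using isCont_tendsto_compose[OF _ lim] tangent_space_subset_kernel[OF W xsW v] by fastforce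
    have nlim: "(\<lambda>k. n (\<sigma> k)) \<longlonglongrightarrow> ns" using LIMSEQ_subseq_LIMSEQ[OF n(2) \<sigma>(1)] by (simp add: o_def)
    have bd: "norm (inner (n (\<sigma> k)) v) \<le> norm (n (\<sigma> k)) * (C0 * norm (frechet_derivative (\<psi> i) (at (x (\<sigma> k))) v))" for k
    proof -
      let ?y = "x (\<sigma> k)"
      note cp = closest_point_subspace[OF subspace_tangent[OF x(1)[of "\<sigma> k"]]]
      have "inner (n (\<sigma> k)) v = inner (n (\<sigma> k)) (v - closest_point (tangent_space M ?y) v)"
        using n(1)[of "\<sigma> k"] cp(1)[of v] unfolding normal_eq[OF x(1)] by (simp add: inner_diff_right)
      then have "norm (inner (n (\<sigma> k)) v) \<le> norm (n (\<sigma> k)) * norm (v - closest_point (tangent_space M ?y) v)"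
        using Cauchy_Schwarz_ineq2 by simp
      also have "\<dots> \<le> norm (n (\<sigma> k)) * (C0 * norm (frechet_derivative (\<psi> i) (at ?y) v))"
        unfolding cp(4) using C0 x(1)[of "\<sigma> k"] \<sigma>(2)[of k] by (intro mult_left_mono) auto
      finally show ?thesis .
    qed
    have "(\<lambda>k. norm (n (\<sigma> k)) * (C0 * norm (frechet_derivative (\<psi> i) (at (x (\<sigma> k))) v))) \<longlonglongrightarrow> norm ns * (C0 * norm (0::'b))"
      by (intro tendsto_intros nlim B0)
    then have "(\<lambda>k. inner (n (\<sigma> k)) v) \<longlonglongrightarrow> 0"
      by (intro Lim_null_comparison[OF always_eventually[OF allI[OF bd]]]) simp
    moreover have "(\<lambda>k. inner (n (\<sigma> k)) v) \<longlonglongrightarrow> inner ns v" by (intro tendsto_intros nlim)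
    ultimately show "inner ns v = 0" using LIMSEQ_unique by blast
  qed
qed

end

section \<open>The proximal subproblem\<close>

lemma nabla_eq: "GDERIV h x :> D \<Longrightarrow> nabla h x = D"
proof -
  assume D: "GDERIV h x :> D"
  have "D' = D" if "GDERIV h x :> D'" for D'
  proof -
    have "(\<lambda>v. inner v D') = (\<lambda>v. inner v D)"
      using that D unfolding gderiv_def by (rule has_derivative_unique)
    then have "\<forall>v. inner v D' = inner v D" by meson
    then show ?thesis using vector_eq_ldot by blast
  qed
  then show ?thesis unfolding nabla_def by (rule the_equality[where P = "\<lambda>D. GDERIV h x :> D", OF D])
qed

lemma GDERIV_nabla:
  fixes h :: "'a::euclidean_space \<Rightarrow> real"
  assumes "h differentiable (at x)"
  shows "GDERIV h x :> nabla h x"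
proof -
  obtain D where D: "(h has_derivative D) (at x)" using assms unfolding differentiable_def by blast
  have "D = (\<lambda>v. inner v (adjoint D 1))"
    using adjoint_works[OF has_derivative_linear[OF D], of _ 1] by auto
  then have "GDERIV h x :> adjoint D 1" using D unfolding gderiv_def by simp
  then show ?thesis using nabla_eq by metis
qed

text \<open>\<open>U\<close> need not be convex, so the segment itself is required to lie in it. The
  function \<open>\<phi>\<close> is F along the segment minus its linear part and the quadratic
  bound; the Lipschitz condition makes it nonincreasing.\<close>

lemma descent_lemma:
  fixes F :: "'a::euclidean_space \<Rightarrow> real"
  assumes dF: "\<And>z. GDERIV F z :> G z" and L: "L-lipschitz_on U G"
    and U: "closed_segment p q \<subseteq> U"
  shows "F q \<le> F p + inner (G p) (q - p) + L / 2 * (norm (q - p))\<^sup>2"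
proof -
  define d where "d = q - p"
  define \<phi> where "\<phi> t = F (p + t *\<^sub>R d) - t * inner (G p) d - L / 2 * t\<^sup>2 * (norm d)\<^sup>2" for t
  have "\<exists>y. DERIV \<phi> t :> y \<and> y \<le> 0" if t: "0 \<le> t" "t \<le> 1" for t
  proof -
    have 1: "((\<lambda>t. p + t *\<^sub>R d) has_derivative (\<lambda>s. s *\<^sub>R d)) (at t)" by (auto intro!: derivative_eq_intros)
    have "((\<lambda>t. F (p + t *\<^sub>R d)) has_derivative (\<lambda>s. inner (s *\<^sub>R d) (G (p + t *\<^sub>R d)))) (at t)"
      using has_derivative_compose[OF 1] dF unfolding gderiv_def by blast
    then have "((\<lambda>t. F (p + t *\<^sub>R d)) has_field_derivative inner d (G (p + t *\<^sub>R d))) (at t)"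
      unfolding has_field_derivative_def by (simp add: mult_commute_abs)
    then have "(\<phi> has_field_derivative inner d (G (p + t *\<^sub>R d)) - inner (G p) d - L / 2 * (2 * t) * (norm d)\<^sup>2) (at t)"
      unfolding \<phi>_def by (auto intro!: derivative_eq_intros)
    moreover have "p + t *\<^sub>R d \<in> closed_segment p q"
      unfolding closed_segment_def d_def using t by (auto intro!: exI[of _ t] simp: algebra_simps)
    have "norm (G (p + t *\<^sub>R d) - G p) \<le> L * (t * norm d)"
    proof -
      have "dist (G (p + t *\<^sub>R d)) (G p) \<le> L * dist (p + t *\<^sub>R d) p"
        using \<open>p + t *\<^sub>R d \<in> closed_segment p q\<close> U by (intro lipschitz_onD[OF L]) auto
      then show ?thesis using t by (simp add: dist_norm)
    qed
    then have "inner (G (p + t *\<^sub>R d) - G p) d \<le> L * (t * norm d) * norm d"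
      by (intro order_trans[OF norm_cauchy_schwarz] mult_right_mono) auto
    then have "inner d (G (p + t *\<^sub>R d)) - inner (G p) d - L / 2 * (2 * t) * (norm d)\<^sup>2 \<le> 0"
      by (simp add: inner_diff_left inner_commute power2_eq_square algebra_simps)
    ultimately show ?thesis by blast
  qed
  from DERIV_nonpos_imp_nonincreasing[OF _ this, of 0 1] have "\<phi> 1 \<le> \<phi> 0" by simp
  then show ?thesis unfolding \<phi>_def d_def by simp
qed

text \<open>The quadratic term makes the model strongly convex with modulus 1 / \<alpha>. The
  minimiser p is compared with z p + (1 - z) q, and z tends to 1.\<close>

lemma step_model_strong_min:
  assumes R: "convex_on UNIV R" and "\<alpha> > 0" and "convex S" and p: "p \<in> S"
    and min: "\<And>v. v \<in> S \<Longrightarrow> step_model R \<alpha> x m p \<le> step_model R \<alpha> x m v" and q: "q \<in> S"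
  shows "step_model R \<alpha> x m p + (norm (q - p))\<^sup>2 / (2 * \<alpha>) \<le> step_model R \<alpha> x m q"
proof -
  let ?h = "step_model R \<alpha> x m"
  have "(norm (q - p))\<^sup>2 / (2 * \<alpha>) \<le> ?h q - ?h p"
  proof (rule field_le_mult_one_interval)
    fix z :: real assume z: "0 < z" "z < 1"
    let ?v = "z *\<^sub>R p + (1 - z) *\<^sub>R q"
    have "?v \<in> S" using assms(3) p q z by (auto simp: convex_def)
    then have "?h p \<le> ?h ?v" by (rule min)
    also have "\<dots> \<le> z * ?h p + (1 - z) * ?h q - z * (1 - z) * ((norm (q - p))\<^sup>2 / (2 * \<alpha>))"
    proof -
      have "x + ?v = z *\<^sub>R (x + p) + (1 - z) *\<^sub>R (x + q)" by (simp add: algebra_simps)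
      then have 1: "R (x + ?v) \<le> z * R (x + p) + (1 - z) * R (x + q)"
        using R z unfolding convex_on_def by auto
      have "(norm ?v)\<^sup>2 = z * (norm p)\<^sup>2 + (1 - z) * (norm q)\<^sup>2 - z * (1 - z) * (norm (q - p))\<^sup>2"
        by (simp add: power2_norm_eq_inner inner_add_left inner_add_right inner_diff_left inner_diff_right inner_commute)
          (simp add: algebra_simps)
      then have 2: "(norm ?v)\<^sup>2 / (2 * \<alpha>) = z * ((norm p)\<^sup>2 / (2 * \<alpha>)) + (1 - z) * ((norm q)\<^sup>2 / (2 * \<alpha>))
          - z * (1 - z) * ((norm (q - p))\<^sup>2 / (2 * \<alpha>))"
        by (simp add: add_divide_distrib diff_divide_distrib)
      have 3: "inner m ?v = z * inner m p + (1 - z) * inner m q"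
        by (simp add: inner_add_right)
      show ?thesis unfolding step_model_def 2 3 using 1 by (simp add: algebra_simps)
    qed
    finally have "(1 - z) * (z * ((norm (q - p))\<^sup>2 / (2 * \<alpha>))) \<le> (1 - z) * (?h q - ?h p)"
      by (simp add: algebra_simps)
    then show "z * ((norm (q - p))\<^sup>2 / (2 * \<alpha>)) \<le> ?h q - ?h p"
      using z by (subst (asm) mult_le_cancel_left_pos) auto
  qed
  then show ?thesis by simp
qed

lemma lipschitz_diff_le:
  fixes R :: "'a::real_normed_vector \<Rightarrow> real"
  assumes "L-lipschitz_on UNIV R"
  shows "R a - R b \<le> L * norm (a - b)"
  using lipschitz_onD[OF assms, of a b] by (simp add: dist_norm)

text \<open>Coercivity: outside the ball of radius \<open>r\<close> the quadratic term outweighs the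
  linear term and the Lipschitz variation of R, so 0 is no worse than any such point.\<close>

lemma step_model_minimiser:
  fixes R :: "'a::euclidean_space \<Rightarrow> real"
  assumes R: "L-lipschitz_on UNIV R" and \<alpha>: "\<alpha> > 0"
  obtains p where "\<And>v. step_model R \<alpha> x m p \<le> step_model R \<alpha> x m v"
proof -
  let ?h = "step_model R \<alpha> x m"
  define r where "r = 2 * \<alpha> * (norm m + L)"
  have L: "L \<ge> 0" using R by (rule lipschitz_on_nonneg)
  have r: "r \<ge> 0" unfolding r_def using \<alpha> L by simp
  have cont: "continuous_on UNIV ?h"
  proof -
    have "continuous_on UNIV (\<lambda>v. R (x + v))"
      by (rule continuous_on_compose2[OF lipschitz_on_continuous_on[OF R]]) (auto intro: continuous_intros)
    then show ?thesis unfolding step_model_def using \<alpha> by (intro continuous_intros) auto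
  qed
  obtain p where p: "p \<in> cball 0 r" "\<And>v. v \<in> cball 0 r \<Longrightarrow> ?h p \<le> ?h v"
    using continuous_attains_inf[of "cball 0 r" ?h] continuous_on_subset[OF cont] r by auto
  have "?h p \<le> ?h v" for v
  proof (cases "norm v \<le> r")
    case True then show ?thesis using p(2) by simp
  next
    case False
    then have "norm v * (norm m + L) \<le> norm v * (norm v / (2 * \<alpha>))"
      using \<alpha> unfolding r_def by (intro mult_left_mono) (auto simp: field_simps)
    then have "norm m * norm v + L * norm v \<le> (norm v)\<^sup>2 / (2 * \<alpha>)"
      by (simp add: algebra_simps power2_eq_square)
    moreover have "- (norm m * norm v) \<le> inner m v"
      using norm_cauchy_schwarz[of "- m" v] by simp
    moreover have "R x - R (x + v) \<le> L * norm v" using lipschitz_diff_le[OF R, of x "x + v"] by simp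
    ultimately have "?h 0 \<le> ?h v" unfolding step_model_def by simp
    moreover have "?h p \<le> ?h 0" using p(2) r by simp
    ultimately show ?thesis by simp
  qed
  then show thesis by (rule that)
qed

text \<open>Completing the square shows that the objective of the proximal map at x + v is \<alpha>
  times the model at v plus a constant.\<close>

lemma prox_minimises:
  fixes R :: "'a::euclidean_space \<Rightarrow> real"
  assumes R: "L-lipschitz_on UNIV R" and \<alpha>: "\<alpha> > 0"
  shows "step_model R \<alpha> x c (prox (\<lambda>z. \<alpha> * R z) (x - \<alpha> *\<^sub>R c) - x) \<le> step_model R \<alpha> x c v"
proof -
  let ?f = "\<lambda>z. \<alpha> * R z + (norm (z - (x - \<alpha> *\<^sub>R c)))\<^sup>2 / 2"
  have f: "?f (x + v) = \<alpha> * step_model R \<alpha> x c v + \<alpha>\<^sup>2 * (norm c)\<^sup>2 / 2" for v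
  proof -
    have "(norm (v + \<alpha> *\<^sub>R c))\<^sup>2 = (norm v)\<^sup>2 + 2 * \<alpha> * inner c v + \<alpha>\<^sup>2 * (norm c)\<^sup>2"
      unfolding power2_norm_eq_inner
      by (simp add: inner_add_left inner_add_right inner_commute power2_eq_square)
    then show ?thesis using \<alpha> by (simp add: step_model_def field_simps power2_eq_square)
  qed
  obtain p where p: "\<And>v. step_model R \<alpha> x c p \<le> step_model R \<alpha> x c v"
    using step_model_minimiser[OF R \<alpha>] by blast
  have "is_arg_min ?f (\<lambda>_. True) (x + p)"
    unfolding is_arg_min_def
  proof (intro conjI notI TrueI)
    assume "\<exists>y. True \<and> ?f y < ?f (x + p)"
    then obtain y where "?f (x + (y - x)) < ?f (x + p)" by auto
    then show False unfolding f using p[of "y - x"] \<alpha> by simp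
  qed
  \<comment> \<open>\<open>arg_min\<close> is a choice operator, so the existing minimiser is what
    makes its value a minimiser.\<close>
  then have "is_arg_min ?f (\<lambda>_. True) (prox (\<lambda>z. \<alpha> * R z) (x - \<alpha> *\<^sub>R c))"
    unfolding prox_def arg_min_def by (rule someI[where P = "is_arg_min ?f (\<lambda>_. True)"])
  then have "?f (x + (prox (\<lambda>z. \<alpha> * R z) (x - \<alpha> *\<^sub>R c) - x)) \<le> ?f (x + v)"
    unfolding is_arg_min_def by (metis add_diff_cancel_left' diff_add_cancel add.commute not_less)
  then show ?thesis unfolding f using \<alpha> by simp
qed

lemma step_model_shift: "step_model R \<alpha> x (m + c) v = step_model R \<alpha> x m v + inner c v"
  by (simp add: step_model_def inner_add_left)

text \<open>An envelope argument that turns the dual residual into the size of \<open>Bx w\<close>.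
  Inserting w into the supremum for l' bounds the linearisation error of the dual function from
  below by 0; inserting the minimiser for l' into the supremum for l bounds it from above. Strong
  convexity makes the two minimisers differ by at most \<alpha> times the norm of the adjoint
  applied to l' - l, so the error is quadratic.\<close>

lemma nabla_dual_model:
  fixes Bx :: "'a::euclidean_space \<Rightarrow> 'b::euclidean_space"
  assumes R: "L-lipschitz_on UNIV R" "convex_on UNIV R" and \<alpha>: "\<alpha> > 0" and B: "linear Bx"
    and w: "\<And>v. step_model R \<alpha> x (m + adjoint Bx l) w \<le> step_model R \<alpha> x (m + adjoint Bx l) v"
  shows "nabla (dual_model R \<alpha> Bx x m) l = - Bx w"
proof -
  let ?h = "step_model R \<alpha> x m" and ?G = "dual_model R \<alpha> Bx x m"
  obtain p where p: "\<And>l v. step_model R \<alpha> x (m + adjoint Bx l) (p l) \<le> step_model R \<alpha> x (m + adjoint Bx l) v"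
  proof -
    have "\<forall>l. \<exists>p. \<forall>v. step_model R \<alpha> x (m + adjoint Bx l) p \<le> step_model R \<alpha> x (m + adjoint Bx l) v"
      using step_model_minimiser[OF R(1) \<alpha>] by blast
    then show ?thesis using that by metis
  qed
  note shift = step_model_shift[of R \<alpha> x m]
  have adj: "inner (adjoint Bx l) v = inner l (Bx v)" for l v
    using adjoint_works[OF B, of v l] by (simp add: inner_commute)
  have Gval: "?G l = - inner l (Bx q) - ?h q"
    if "\<And>v. step_model R \<alpha> x (m + adjoint Bx l) q \<le> step_model R \<alpha> x (m + adjoint Bx l) v" for l q
  proof -
    have "(SUP v. inner (- adjoint Bx l) v - ?h v) = inner (- adjoint Bx l) q - ?h q"
    proof (rule cSup_eq_maximum)
      fix z assume "z \<in> range (\<lambda>v. inner (- adjoint Bx l) v - ?h v)"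
      then obtain v where "z = inner (- adjoint Bx l) v - ?h v" by blast
      then show "z \<le> inner (- adjoint Bx l) q - ?h q" using that[of v] by (simp add: shift)
    qed simp
    then show ?thesis unfolding dual_model_def fenchel_conjugate_def by (simp add: adj)
  qed
  have Gge: "?G l' \<ge> - inner l' (Bx v) - ?h v" for l' v
    using Gval[OF p, of l'] p[of l' v] by (simp add: shift adj)
  obtain K where K: "K > 0" "\<And>d. norm (adjoint Bx d) \<le> norm d * K"
    using bounded_linear.pos_bounded adjoint_linear[OF B] by (metis linear_conv_bounded_linear)
  have est: "\<bar>?G l' - ?G l + inner (l' - l) (Bx w)\<bar> \<le> \<alpha> * K\<^sup>2 * (norm (l' - l))\<^sup>2" for l'
  proof -
    let ?d = "l' - l" and ?p = "p l'"
    have 0: "0 \<le> ?G l' - ?G l + inner ?d (Bx w)"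
      using Gge[of l' w] Gval[OF w] by (simp add: inner_diff_left)
    have 1: "?G l' - ?G l + inner ?d (Bx w) \<le> inner (adjoint Bx ?d) (w - ?p)"
      using Gge[of l ?p] Gval[OF p, of l']
      by (simp add: adj inner_diff_left linear_diff[OF B] inner_diff_right)
    have "step_model R \<alpha> x (m + adjoint Bx l) w + (norm (?p - w))\<^sup>2 / (2 * \<alpha>) \<le> step_model R \<alpha> x (m + adjoint Bx l) ?p"
      by (rule step_model_strong_min[OF R(2) \<alpha> convex_UNIV]) (auto simp: w)
    moreover have "step_model R \<alpha> x (m + adjoint Bx l') ?p + (norm (w - ?p))\<^sup>2 / (2 * \<alpha>) \<le> step_model R \<alpha> x (m + adjoint Bx l') w"
      by (rule step_model_strong_min[OF R(2) \<alpha> convex_UNIV]) (auto simp: p)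
    ultimately have "(norm (w - ?p))\<^sup>2 / \<alpha> \<le> inner (adjoint Bx ?d) (w - ?p)"
      unfolding shift adj by (simp add: inner_diff_left inner_diff_right linear_diff[OF B] norm_minus_commute)
    also have "\<dots> \<le> norm (adjoint Bx ?d) * norm (w - ?p)" by (rule norm_cauchy_schwarz)
    finally have "norm (w - ?p) * norm (w - ?p) \<le> (\<alpha> * norm (adjoint Bx ?d)) * norm (w - ?p)"
      using \<alpha> by (simp add: field_simps power2_eq_square)
    then have "norm (w - ?p) \<le> \<alpha> * norm (adjoint Bx ?d)"
      using \<alpha> by (cases "w = ?p") auto
    then have "inner (adjoint Bx ?d) (w - ?p) \<le> norm (adjoint Bx ?d) * (\<alpha> * norm (adjoint Bx ?d))"
      using norm_cauchy_schwarz[of "adjoint Bx ?d" "w - ?p"] by (meson mult_left_mono norm_ge_zero order_trans)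
    also have "\<dots> \<le> (norm ?d * K) * (\<alpha> * (norm ?d * K))"
      using \<alpha> K by (intro mult_mono) auto
    finally have "inner (adjoint Bx ?d) (w - ?p) \<le> \<alpha> * K\<^sup>2 * (norm ?d)\<^sup>2"
      by (simp add: power2_eq_square ac_simps)
    then show ?thesis using 0 1 by linarith
  qed
  have "GDERIV ?G l :> - Bx w"
    unfolding gderiv_def has_derivative_at_alt
  proof (intro conjI allI impI)
    show "bounded_linear (\<lambda>h. inner h (- Bx w))" by (rule bounded_linear_inner_left)
    fix e :: real assume e: "e > 0"
    have aK: "\<alpha> * K\<^sup>2 > 0" using \<alpha> K by simp
    show "\<exists>d>0. \<forall>y. norm (y - l) < d \<longrightarrow> norm (?G y - ?G l - inner (y - l) (- Bx w)) \<le> e * norm (y - l)"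
    proof (intro exI[of _ "e / (\<alpha> * K\<^sup>2)"] conjI allI impI)
      show "e / (\<alpha> * K\<^sup>2) > 0" using e aK by simp
      fix y assume "norm (y - l) < e / (\<alpha> * K\<^sup>2)"
      then have "\<alpha> * K\<^sup>2 * norm (y - l) \<le> e" using aK by (simp add: field_simps)
      then have "\<alpha> * K\<^sup>2 * norm (y - l) * norm (y - l) \<le> e * norm (y - l)" by (intro mult_right_mono) auto
      then show "norm (?G y - ?G l - inner (y - l) (- Bx w)) \<le> e * norm (y - l)"
        using est[of y] by (simp add: power2_eq_square ac_simps)
    qed
  qed
  then show ?thesis by (rule nabla_eq)
qed

text \<open>With q = w - \<eta> orthogonal to \<open>T\<close>, passing from \<eta> to w and from
  \<eta>h to \<eta>h + q changes the linear and quadratic parts of the model equally; only R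
  distinguishes them, by at most L * norm q each. The multiplier c does not separate w from \<eta>h
  + q either. Strong minimality of w against \<eta>h + q and of \<eta>h against \<eta> then gives
  both estimates.\<close>

lemma inexact_step:
  fixes T :: "'a::euclidean_space set"
  assumes R: "L-lipschitz_on UNIV R" "convex_on UNIV R" and \<alpha>: "\<alpha> > 0" and T: "subspace T"
    and c: "\<And>v. v \<in> T \<Longrightarrow> inner c v = 0"
    and w: "\<And>v. step_model R \<alpha> x (m + c) w \<le> step_model R \<alpha> x (m + c) v"
    and \<eta>: "\<eta> \<in> T" "\<And>v. v \<in> T \<Longrightarrow> inner (w - \<eta>) v = 0"
    and m: "\<And>v. v \<in> T \<Longrightarrow> step_model R \<alpha> x m \<eta>h \<le> step_model R \<alpha> x m v" and \<eta>h: "\<eta>h \<in> T"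
  shows "(norm (\<eta> - \<eta>h))\<^sup>2 \<le> 2 * \<alpha> * L * norm (w - \<eta>)"
    and "step_model R \<alpha> x m \<eta> \<le> step_model R \<alpha> x m \<eta>h + 2 * L * norm (w - \<eta>)"
proof -
  let ?h = "step_model R \<alpha> x m"
  define q where "q = w - \<eta>"
  have wq: "w = \<eta> + q" unfolding q_def by simp
  let ?p = "\<eta>h + q"
  have "step_model R \<alpha> x (m + c) w + (norm (?p - w))\<^sup>2 / (2 * \<alpha>) \<le> step_model R \<alpha> x (m + c) ?p"
    by (rule step_model_strong_min[OF R(2) \<alpha> convex_UNIV]) (auto simp: w)
  moreover have "inner c w = inner c ?p"
    using c[OF \<eta>(1)] c[OF \<eta>h] by (simp add: wq inner_add_right)
  moreover have "norm (?p - w) = norm (\<eta> - \<eta>h)" by (simp add: wq norm_minus_commute)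
  ultimately have 1: "?h w + (norm (\<eta> - \<eta>h))\<^sup>2 / (2 * \<alpha>) \<le> ?h ?p" by (simp add: step_model_shift)
  have 2: "?h \<eta>h + (norm (\<eta> - \<eta>h))\<^sup>2 / (2 * \<alpha>) \<le> ?h \<eta>"
    by (rule step_model_strong_min[OF R(2) \<alpha> subspace_imp_convex[OF T] \<eta>h m \<eta>(1)])
  have split: "?h (v + q) = ?h v + inner m q + (norm q)\<^sup>2 / (2 * \<alpha>) + (R (x + v + q) - R (x + v))" if "v \<in> T" for v
  proof -
    have "(norm (v + q))\<^sup>2 = (norm v)\<^sup>2 + (norm q)\<^sup>2"
      unfolding power2_norm_eq_inner using \<eta>(2)[OF that] by (simp add: q_def inner_add_left inner_add_right inner_commute)
    then show ?thesis by (simp add: step_model_def inner_add_right add_divide_distrib algebra_simps)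
  qed
  have "R (x + \<eta>) - R (x + \<eta> + q) \<le> L * norm q" "R (x + \<eta>h + q) - R (x + \<eta>h) \<le> L * norm q"
    using lipschitz_diff_le[OF R(1), of "x + \<eta>" "x + \<eta> + q"] lipschitz_diff_le[OF R(1), of "x + \<eta>h + q" "x + \<eta>h"]
    by simp_all
  then have 3: "?h \<eta> + (norm (\<eta> - \<eta>h))\<^sup>2 / (2 * \<alpha>) \<le> ?h \<eta>h + 2 * L * norm q"
    using 1 split[OF \<eta>(1)] split[OF \<eta>h] by (simp add: wq)
  then show "?h \<eta> \<le> ?h \<eta>h + 2 * L * norm (w - \<eta>)"
    using \<alpha> zero_le_power2[of "norm (\<eta> - \<eta>h)"] divide_nonneg_pos[of "(norm (\<eta> - \<eta>h))\<^sup>2" "2 * \<alpha>"]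
    unfolding q_def by linarith
  have "(norm (\<eta> - \<eta>h))\<^sup>2 / \<alpha> \<le> 2 * L * norm q" using 2 3 by (simp add: field_simps)
  then show "(norm (\<eta> - \<eta>h))\<^sup>2 \<le> 2 * \<alpha> * L * norm (w - \<eta>)"
    using \<alpha> by (simp add: field_simps q_def)
qed

lemma step_model_bound:
  assumes R: "L-lipschitz_on UNIV R" "convex_on UNIV R" and \<alpha>: "\<alpha> > 0" and T: "subspace T"
    and m: "\<And>v. v \<in> T \<Longrightarrow> step_model R \<alpha> x m p \<le> step_model R \<alpha> x m v" and p: "p \<in> T"
  shows "norm p \<le> \<alpha> * (norm m + L)"
proof -
  have "step_model R \<alpha> x m p + (norm (0 - p))\<^sup>2 / (2 * \<alpha>) \<le> step_model R \<alpha> x m 0"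
    by (rule step_model_strong_min[OF R(2) \<alpha> subspace_imp_convex[OF T] p m subspace_0[OF T]])
  then have "(norm p)\<^sup>2 / \<alpha> \<le> R x - R (x + p) - inner m p" by (simp add: step_model_def field_simps)
  also have "\<dots> \<le> L * norm p + norm m * norm p"
    using lipschitz_diff_le[OF R(1), of x "x + p"] norm_cauchy_schwarz[of "- m" p] by simp
  finally have "norm p * norm p \<le> (\<alpha> * (norm m + L)) * norm p"
    using \<alpha> by (simp add: field_simps power2_eq_square)
  then show ?thesis
    using \<alpha> lipschitz_on_nonneg[OF R(1)] by (cases "p = 0") auto
qed

text \<open>Fermat's rule on a subspace. The subgradient is found by separating the strict epigraph
  of the increment of R from the graph of a linear functional on \<open>T\<close>; this extends the
  functional from \<open>T\<close> to the whole space below the increment.\<close>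

lemma step_model_optimality:
  fixes R :: "'a::euclidean_space \<Rightarrow> real"
  assumes R: "convex_on UNIV R" and \<alpha>: "\<alpha> > 0" and T: "subspace T" and p: "p \<in> T"
    and min: "\<And>v. v \<in> T \<Longrightarrow> step_model R \<alpha> x m p \<le> step_model R \<alpha> x m v"
  obtains g where "g \<in> convex_subdifferential R (x + p)"
    "\<And>v. v \<in> T \<Longrightarrow> inner (m + (1 / \<alpha>) *\<^sub>R p + g) v = 0"
proof -
  define c where "c = m + (1 / \<alpha>) *\<^sub>R p"
  define \<Delta> where "\<Delta> v = R (x + p + v) - R (x + p)" for v
  have conv: "\<Delta> (t *\<^sub>R v + (1 - t) *\<^sub>R u) \<le> t * \<Delta> v + (1 - t) * \<Delta> u" if "0 \<le> t" "t \<le> 1" for t u v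
  proof -
    have "x + p + (t *\<^sub>R v + (1 - t) *\<^sub>R u) = t *\<^sub>R (x + p + v) + (1 - t) *\<^sub>R (x + p + u)"
      by (simp add: algebra_simps)
    then have "R (x + p + (t *\<^sub>R v + (1 - t) *\<^sub>R u)) \<le> t * R (x + p + v) + (1 - t) * R (x + p + u)"
      using R that unfolding convex_on_def by auto
    then show ?thesis unfolding \<Delta>_def by (simp add: algebra_simps)
  qed
  \<comment> \<open>First-order condition in tangent directions: minimality at p + t v is divided by
    t, and t tends to 0. In the contradiction below, t = A / (2 * (K + A)) makes the remainder t * K
    at most A / 2.\<close>
  have first: "- inner c v \<le> \<Delta> v" if v: "v \<in> T" for v
  proof -
    define A where "A = - inner c v - \<Delta> v"
    define K where "K = (norm v)\<^sup>2 / (2 * \<alpha>)"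
    have K: "K \<ge> 0" unfolding K_def using \<alpha> by simp
    have small: "A \<le> t * K" if t: "0 < t" "t < 1" for t
    proof -
      have "p + t *\<^sub>R v \<in> T" using T p v by (intro subspace_add subspace_scale)
      then have "step_model R \<alpha> x m p \<le> step_model R \<alpha> x m (p + t *\<^sub>R v)" by (rule min)
      moreover have "R (x + (p + t *\<^sub>R v)) - R (x + p) \<le> t * \<Delta> v"
        using conv[of t v 0] t by (simp add: \<Delta>_def add.assoc)
      moreover have "(norm (p + t *\<^sub>R v))\<^sup>2 = (norm p)\<^sup>2 + 2 * t * inner p v + t\<^sup>2 * (norm v)\<^sup>2"
        unfolding power2_norm_eq_inner by (simp add: inner_add_left inner_add_right inner_commute power2_eq_square)
      ultimately have "0 \<le> t * inner m v + (2 * t * inner p v + t\<^sup>2 * (norm v)\<^sup>2) / (2 * \<alpha>) + t * \<Delta> v"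
        by (simp add: step_model_def inner_add_right add_divide_distrib)
      also have "\<dots> = t * (- A + t * K)"
        using \<alpha> unfolding A_def K_def c_def by (simp add: field_simps inner_add_left power2_eq_square)
      finally show ?thesis using t by (simp add: zero_le_mult_iff)
    qed
    have "\<not> A > 0"
    proof
      assume A: "A > 0"
      have "A \<le> A / (2 * (K + A)) * K" using A K by (intro small) (auto simp: field_simps)
      also have "\<dots> \<le> A / 2" using A K by (simp add: field_simps)
      finally show False using A by simp
    qed
    then show ?thesis unfolding A_def by simp
  qed
  define S1 where "S1 = {(v, s). \<Delta> v < s}"
  define S2 where "S2 = {(v, s). v \<in> T \<and> s = - inner c v}"
  have "convex S1" unfolding convex_alt S1_def
  proof (clarsimp)
    fix v s u s' and t :: real assume a: "\<Delta> v < s" "\<Delta> u < s'" "0 \<le> t" "t \<le> 1"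
    have "\<Delta> ((1 - t) *\<^sub>R v + t *\<^sub>R u) \<le> (1 - t) * \<Delta> v + t * \<Delta> u" using conv[of "1 - t" v u] a by simp
    also have "\<dots> < (1 - t) * s + t * s'"
    proof (cases "t = 0")
      case False
      then show ?thesis using a by (intro add_le_less_mono mult_left_mono mult_strict_left_mono) auto
    qed (use a in auto)
    finally show "\<Delta> ((1 - t) *\<^sub>R v + t *\<^sub>R u) < (1 - t) * s + t * s'" .
  qed
  moreover have "convex S2" unfolding convex_alt S2_def
    using T by (auto simp: inner_add_right algebra_simps intro!: subspace_add subspace_diff subspace_scale)
  moreover have "(0, 1) \<in> S1" "(0, 0) \<in> S2" unfolding S1_def S2_def \<Delta>_def using subspace_0[OF T] by auto
  moreover have "S1 \<inter> S2 = {}" using first unfolding S1_def S2_def by force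
  ultimately obtain a b where a: "a \<noteq> 0" "\<forall>z\<in>S1. inner a z \<le> b" "\<forall>z\<in>S2. inner a z \<ge> b"
    using separating_hyperplane_sets[of S1 S2] by blast
  obtain u \<sigma> where us: "a = (u, \<sigma>)" by (cases a)
  have S1: "inner u v + \<sigma> * s \<le> b" if "\<Delta> v < s" for v s
    using a(2) that unfolding us S1_def by auto
  have S2: "inner u v - \<sigma> * inner c v \<ge> b" if "v \<in> T" for v
    using a(3) that unfolding us S2_def by auto
  have \<Delta>0: "\<Delta> 0 = 0" unfolding \<Delta>_def by simp
  have b0: "b \<le> 0" using S2[OF subspace_0[OF T]] by simp
  have "\<sigma> \<le> 0" using S1[of 0 1] \<Delta>0 b0 by simp
  \<comment> \<open>The separating hyperplane is not vertical: the increment is finite everywhere,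
    so S1 projects onto the whole space and \<sigma> = 0 would force u = 0.\<close>
  moreover have "\<sigma> \<noteq> 0"
  proof
    assume 0: "\<sigma> = 0"
    have "inner u u \<le> 0" using S1[of u "\<Delta> u + 1"] 0 b0 by simp
    then have "u = 0" by (metis inner_eq_zero_iff inner_ge_zero order_antisym)
    then show False using a(1) us 0 by (simp add: zero_prod_def)
  qed
  ultimately have \<sigma>: "\<sigma> < 0" by simp
  \<comment> \<open>The points (0, s) with small s > 0 lie in S1, so a negative b is
    impossible.\<close>
  have b: "b = 0"
  proof (rule antisym[OF b0], rule ccontr)
    assume "\<not> 0 \<le> b"
    then have "\<sigma> * (b / (2 * \<sigma>)) \<le> b" using S1[of 0 "b / (2 * \<sigma>)"] \<Delta>0 \<sigma> by (simp add: divide_neg_neg)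
    then show False using \<sigma> \<open>\<not> 0 \<le> b\<close> by simp
  qed
  define g where "g = (1 / - \<sigma>) *\<^sub>R u"
  have ug: "u = (- \<sigma>) *\<^sub>R g" unfolding g_def using \<sigma> by simp
  have "inner g v \<le> \<Delta> v" for v
  proof (rule dense_ge)
    fix s assume "\<Delta> v < s"
    then have "(- \<sigma>) * (inner g v - s) \<le> 0" using S1[of v s] b unfolding ug by (simp add: algebra_simps)
    then show "inner g v \<le> s" using \<sigma> by (simp add: zero_le_mult_iff)
  qed
  then have "R (x + p) + inner g (z - (x + p)) \<le> R z" for z
    using \<Delta>_def[of "z - (x + p)"] by (metis add.commute add_diff_cancel_left' diff_add_cancel le_diff_eq)
  then have "g \<in> convex_subdifferential R (x + p)" unfolding convex_subdifferential_def by simp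
  moreover have "inner (m + (1 / \<alpha>) *\<^sub>R p + g) v = 0" if v: "v \<in> T" for v
  proof -
    have *: "inner (c + g) v \<ge> 0" if "v \<in> T" for v
    proof -
      have "(- \<sigma>) * inner (c + g) v \<ge> 0" using S2[OF that] b unfolding ug by (simp add: inner_add_left algebra_simps)
      then show ?thesis using \<sigma> by (simp add: zero_le_mult_iff mult_le_0_iff)
    qed
    have "inner (c + g) v = 0" using *[OF v] *[OF subspace_neg[OF T v]] by simp
    then show ?thesis unfolding c_def .
  qed
  ultimately show thesis by (rule that)
qed

section \<open>Descent sequences under a KL inequality\<close>

text \<open>For b > 0 this is Young's inequality with weights p and 1 - p, multiplied by a powr (p -
  1). The endpoint b = 0 is included because gaps may reach zero.\<close>

lemma powr_le_tangent:
  fixes a b p :: real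
  assumes "0 < a" "0 \<le> b" "0 < p" "p \<le> 1"
  shows "b powr p \<le> a powr p + p * a powr (p - 1) * (b - a)"
proof (cases "b = 0")
  case True
  have "p * a powr (p - 1) * a = p * a powr p" using assms by (simp add: powr_diff)
  also have "\<dots> \<le> a powr p" using assms by (simp add: mult_left_le_one_le)
  finally show ?thesis using True by simp
next
  case False
  then have "b powr p * a powr (1 - p) \<le> p * b + (1 - p) * a"
    using assms by (intro Youngs_inequality_0) auto
  then have "b powr p * a powr (1 - p) * a powr (p - 1) \<le> (p * b + (1 - p) * a) * a powr (p - 1)"
    by (intro mult_right_mono) auto
  moreover have "b powr p * a powr (1 - p) * a powr (p - 1) = b powr p"
    using assms by (simp add: mult.assoc flip: powr_add)
  moreover have "(p * b + (1 - p) * a) * a powr (p - 1) = a powr (p - 1) * a + p * a powr (p - 1) * (b - a)"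
    by (simp add: algebra_simps)
  moreover have "a powr (p - 1) * a = a powr p" using assms by (simp add: powr_diff)
  ultimately show ?thesis by simp
qed

text \<open>Here h stands for the derivative of a desingularising function at D1 and f1, f2 for its
  values. KL and the tangent inequality bound the square of s' by the product of s + t and K / q *
  (f1 - f2); the arithmetic-geometric mean inequality then leaves only half of s, which makes the
  steps summable. When the gap D1 is already zero, the descent forces s' = 0.\<close>

lemma one_step_bound:
  fixes s s' t :: real
  assumes "q > 0" "K > 0" "s \<ge> 0" "t \<ge> 0" "s' \<ge> 0"
    and kl: "D1 > 0 \<Longrightarrow> h * (K * (s + t)) \<ge> 1" and h: "D1 > 0 \<Longrightarrow> h \<ge> 0"
    and f: "D1 > 0 \<Longrightarrow> h * (D1 - D2) \<le> f1 - f2" and f0: "D1 = 0 \<Longrightarrow> f1 = f2"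
    and D: "q * s'\<^sup>2 \<le> D1 - D2" "D1 \<ge> 0" "D2 \<ge> 0"
  shows "s' \<le> (s + t) / 2 + K / (2 * q) * (f1 - f2)"
proof (cases "D1 = 0")
  case True
  then have "q * s'\<^sup>2 \<le> 0" using D by simp
  then have "s' = 0" using assms(1) by (simp add: mult_le_0_iff)
  then show ?thesis using True f0 assms by simp
next
  case False
  then have D1: "D1 > 0" using D by simp
  define X where "X = s + t"
  define Y where "Y = K / q * (f1 - f2)"
  have X: "X \<ge> 0" unfolding X_def using assms by simp
  have "D1 - D2 \<ge> 0" using D(1) assms(1) by (meson mult_nonneg_nonneg less_imp_le order_trans zero_le_power2)
  then have ff: "f1 - f2 \<ge> 0" using f[OF D1] h[OF D1] by (meson mult_nonneg_nonneg order_trans)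
  have "q * s'\<^sup>2 \<le> 1 * (D1 - D2)" using D(1) by simp
  also have "\<dots> \<le> h * (K * X) * (D1 - D2)"
    using kl[OF D1] \<open>D1 - D2 \<ge> 0\<close> unfolding X_def by (intro mult_right_mono) auto
  also have "\<dots> = K * X * (h * (D1 - D2))" by simp
  also have "\<dots> \<le> K * X * (f1 - f2)" using f[OF D1] X assms by (intro mult_left_mono) auto
  finally have "s'\<^sup>2 \<le> X * Y" using assms(1) unfolding Y_def by (simp add: field_simps)
  also have "\<dots> \<le> ((X + Y) / 2)\<^sup>2"
    using zero_le_power2[of "X - Y"] by (simp add: power2_eq_square algebra_simps)
  finally have "s' \<le> (X + Y) / 2"
    using X ff assms unfolding Y_def by (intro power2_le_imp_le[of s']) auto
  moreover have "Y / 2 = K / (2 * q) * (f1 - f2)" unfolding Y_def by simp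
  ultimately show ?thesis unfolding X_def by (simp add: add_divide_distrib)
qed

text \<open>The extra summand s n on the left makes the induction close: twice the next step costs
  one s n, and this is already accounted for.\<close>

lemma telescoped_sum_bound:
  fixes s \<tau> \<Theta> f :: "nat \<Rightarrow> real"
  assumes "\<And>k. K \<le> k \<Longrightarrow> k < n \<Longrightarrow> s (Suc k) \<le> (s k + \<tau> k) / 2 + A * (f (Suc k) - f (Suc (Suc k)))"
    and "\<And>k. K \<le> k \<Longrightarrow> \<tau> k \<le> \<Theta> k - \<Theta> (Suc k)" and "K \<le> n"
  shows "(\<Sum>j=K..n. s j) + s n \<le> 2 * s K + (\<Theta> K - \<Theta> n) + 2 * A * (f (Suc K) - f (Suc n))"
  using \<open>K \<le> n\<close> assms(1)
proof (induction n rule: dec_induct)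
  case base then show ?case by simp
next
  case (step n)
  have "s (Suc n) \<le> (s n + \<tau> n) / 2 + A * (f (Suc n) - f (Suc (Suc n)))" using step by simp
  moreover have "\<tau> n \<le> \<Theta> n - \<Theta> (Suc n)" using assms(2) step by simp
  moreover have "(\<Sum>j=K..n. s j) + s n \<le> 2 * s K + (\<Theta> K - \<Theta> n) + 2 * A * (f (Suc K) - f (Suc n))"
    using step by simp
  moreover have "(\<Sum>j=K..Suc n. s j) = (\<Sum>j=K..n. s j) + s (Suc n)" using step by simp
  ultimately show ?case by (simp add: field_simps)
qed

text \<open>The abstract setting of the convergence argument: D is the merit gap, g the surrogate
  gap, s the step measure and T the remaining perturbation budget. The sequence \<tau> controls the
  \<theta>0-th power of T and enters on the same footing as s; \<Theta> majorises its tail sums by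
  telescoping.\<close>

locale descent_sequence =
  fixes x :: "nat \<Rightarrow> 'a::euclidean_space" and s D g \<tau> \<Theta> T :: "nat \<Rightarrow> real" and q C \<theta>0 :: real and N :: nat
  assumes q: "q > 0" and C: "C > 0" and \<theta>0: "1 / 2 \<le> \<theta>0" "\<theta>0 < 1"
    and s: "\<And>k. s k \<ge> 0" and \<tau>: "\<And>k. \<tau> k \<ge> 0" and T: "\<And>k. T k \<ge> 0" and \<Theta>: "\<And>k. \<Theta> k \<ge> 0"
    and D: "\<And>k. N \<le> k \<Longrightarrow> D k \<ge> 0" and D_lim: "D \<longlonglongrightarrow> 0" and \<Theta>_lim: "\<Theta> \<longlonglongrightarrow> 0"
    and descent: "\<And>k. N \<le> k \<Longrightarrow> D (Suc k) + q * (s k)\<^sup>2 \<le> D k"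
    and upper: "\<And>k. N \<le> k \<Longrightarrow> D (Suc k) \<le> g k + C * (s k)\<^sup>2 + T k"
    and T_\<tau>: "\<And>k. N \<le> k \<Longrightarrow> T k powr \<theta>0 \<le> C * \<tau> k"
    and \<tau>_\<Theta>: "\<And>k. N \<le> k \<Longrightarrow> \<tau> k \<le> \<Theta> k - \<Theta> (Suc k)"
    and steps: "\<And>k. N \<le> k \<Longrightarrow> norm (x (Suc k) - x k) \<le> C * s k"
begin

lemma s_le: "N \<le> k \<Longrightarrow> s k \<le> sqrt (D k / q)"
proof -
  assume k: "N \<le> k"
  have "q * (s k)\<^sup>2 \<le> D k" using descent[OF k] D[of "Suc k"] k by simp
  then have "(s k)\<^sup>2 \<le> D k / q" using q by (simp add: field_simps)
  then show ?thesis by (rule real_le_rsqrt)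
qed

lemma s_lim: "s \<longlonglongrightarrow> 0"
proof (rule tendsto_sandwich[of "\<lambda>_. 0" s sequentially "\<lambda>k. sqrt (D k / q)"])
  have "(\<lambda>k. sqrt (D k / q)) \<longlonglongrightarrow> sqrt (0 / q)" using q by (intro tendsto_intros D_lim) auto
  then show "(\<lambda>k. sqrt (D k / q)) \<longlonglongrightarrow> 0" by simp
qed (use s s_le in \<open>auto simp: eventually_sequentially\<close>)

definition K1 where "K1 = (4 * C) powr \<theta>0 + 4 powr \<theta>0 * C"

lemma K1: "K1 > 0" unfolding K1_def using C by (intro add_pos_pos) auto

text \<open>If g is small, \<open>upper\<close> leaves D (Suc k) below four times C times the square
  of s k, or below 4 * T k. In the first case 2 * \<theta>0 is at least 1 and s k is at most 1, so
  the \<theta>0-th power is linear in s k; in the second, \<open>T_\<tau>\<close> applies. No KL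
  inequality enters this branch.\<close>

lemma small_gap:
  assumes k: "N \<le> k" and pos: "D (Suc k) > 0" and "s k \<le> 1" and g: "g k < D (Suc k) / 2"
  shows "D (Suc k) powr \<theta>0 \<le> K1 * (s k + \<tau> k)"
proof -
  have "D (Suc k) \<le> 2 * (C * (s k)\<^sup>2) + 2 * T k" using upper[OF k] g by simp
  then consider "D (Suc k) \<le> 4 * C * (s k)\<^sup>2" | "D (Suc k) \<le> 4 * T k" by linarith
  then show ?thesis
  proof cases
    case 1
    have sk: "s k > 0" using 1 pos s[of k] by (cases "s k = 0") auto
    have "D (Suc k) powr \<theta>0 \<le> (4 * C * (s k)\<^sup>2) powr \<theta>0"
      using 1 pos \<theta>0 by (intro powr_mono2) auto
    also have "\<dots> = (4 * C) powr \<theta>0 * (s k powr (2 * \<theta>0))"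
      using C sk by (simp add: powr_mult powr_powr flip: powr_numeral)
    also have "s k powr (2 * \<theta>0) \<le> s k powr 1" using sk assms \<theta>0 by (intro powr_mono') auto
    finally have "D (Suc k) powr \<theta>0 \<le> (4 * C) powr \<theta>0 * s k" using sk by (simp add: mult_left_mono)
    also have "\<dots> \<le> K1 * (s k + \<tau> k)"
      unfolding K1_def using C s[of k] \<tau>[of k] by (intro mult_mono) auto
    finally show ?thesis .
  next
    case 2
    have "D (Suc k) powr \<theta>0 \<le> (4 * T k) powr \<theta>0"
      using 2 pos \<theta>0 by (intro powr_mono2) auto
    also have "\<dots> = 4 powr \<theta>0 * T k powr \<theta>0" using T by (simp add: powr_mult)
    also have "\<dots> \<le> 4 powr \<theta>0 * (C * \<tau> k)" using T_\<tau>[OF k] by (intro mult_left_mono) auto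
    also have "\<dots> = 4 powr \<theta>0 * C * \<tau> k" by simp
    also have "\<dots> \<le> K1 * (s k + \<tau> k)"
      unfolding K1_def using C s[of k] \<tau>[of k] by (intro mult_mono) auto
    finally show ?thesis .
  qed
qed

lemma dist_le_sum:
  assumes "N \<le> K" "K \<le> n"
  shows "norm (x (Suc n) - x K) \<le> C * (\<Sum>j=K..n. s j)"
  using assms(2)
proof (induction n rule: dec_induct)
  case base then show ?case using steps assms(1) by simp
next
  case (step n)
  have "norm (x (Suc (Suc n)) - x K) \<le> norm (x (Suc (Suc n)) - x (Suc n)) + norm (x (Suc n) - x K)"
    using norm_triangle_ineq[of "x (Suc (Suc n)) - x (Suc n)" "x (Suc n) - x K"] by simp
  also have "\<dots> \<le> C * s (Suc n) + C * (\<Sum>j=K..n. s j)"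
    using step steps[of "Suc n"] assms(1) by simp
  finally show ?case using step by (simp add: algebra_simps)
qed

text \<open>The term \<open>d powr (1 - \<theta>0)\<close> added to the desingularising function \<open>\<phi>\<close> absorbs the
  perturbations \<open>T\<close>; evaluating \<open>\<phi>\<close> at \<open>d / 2\<close> makes up for \<open>D (Suc k)\<close> being larger than \<open>g k\<close>.\<close>
lemma KL_convergence:
  fixes \<phi> h :: "real \<Rightarrow> real"
  assumes \<phi>: "continuous_on {0..<\<epsilon>} \<phi>" "\<phi> 0 = 0" "\<epsilon> > 0" "\<And>t. 0 \<le> t \<Longrightarrow> t < \<epsilon> \<Longrightarrow> \<phi> t \<ge> 0"
    and h: "\<And>a. 0 < a \<Longrightarrow> a < \<epsilon> \<Longrightarrow> h a > 0"
    and tangent: "\<And>a b. 0 < a \<Longrightarrow> a < \<epsilon> \<Longrightarrow> 0 \<le> b \<Longrightarrow> b < \<epsilon> \<Longrightarrow> \<phi> b \<le> \<phi> a + h a * (b - a)"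
    and \<rho>: "\<rho> > 0" and C': "C' > 0"
    and KL: "\<And>k. N \<le> k \<Longrightarrow> norm (x k - xb) < \<rho> \<Longrightarrow> s k < \<rho> \<Longrightarrow> 0 < g k \<Longrightarrow> g k < \<epsilon> \<Longrightarrow> h (g k) * (C' * s k) \<ge> 1"
    and g_lim: "g \<longlonglongrightarrow> 0"
    and cluster: "\<And>e n. e > 0 \<Longrightarrow> \<exists>k\<ge>n. norm (x k - xb) < e"
  shows "x \<longlonglongrightarrow> xb"
proof -
  \<comment> \<open>Adding the tangent inequalities at a and at b shows that h is antitone; KL at
    \<open>g k\<close> can thus be transferred to the smaller argument D (Suc k) / 2.\<close>
  have anti: "h b \<le> h a" if "0 < a" "a \<le> b" "b < \<epsilon>" for a b
  proof (cases "a = b")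
    case False
    then have "(h a - h b) * (b - a) \<ge> 0"
      using tangent[of a b] tangent[of b a] that by (simp add: algebra_simps)
    then show ?thesis using False that by (simp add: zero_le_mult_iff)
  qed simp
  define f where "f d = \<phi> (d / 2) + d powr (1 - \<theta>0)" for d
  \<comment> \<open>The derivative of \<open>f\<close> when h is that of \<open>\<phi>\<close>; the
    halves stem from the argument d / 2.\<close>
  define ht where "ht d = h (d / 2) / 2 + (1 - \<theta>0) * d powr (- \<theta>0)" for d
  \<comment> \<open>2 * C' compensates the factor 1/2 and K1 / (1 - \<theta>0) the factor 1 -
    \<theta>0 in \<open>ht\<close>, one for each branch of the dichotomy.\<close>
  define K where "K = 2 * C' + K1 / (1 - \<theta>0)"
  have K: "K > 0" unfolding K_def using C' K1 \<theta>0 by (intro add_pos_pos) auto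
  have f_diff: "ht a * (a - b) \<le> f a - f b" if "0 < a" "a < \<epsilon>" "0 \<le> b" "b \<le> a" for a b
  proof -
    have "h (a / 2) / 2 * (a - b) \<le> \<phi> (a / 2) - \<phi> (b / 2)"
      using tangent[of "a / 2" "b / 2"] that by (simp add: field_simps)
    moreover have "(1 - \<theta>0) * a powr (- \<theta>0) * (a - b) \<le> a powr (1 - \<theta>0) - b powr (1 - \<theta>0)"
      using powr_le_tangent[of a b "1 - \<theta>0"] that \<theta>0 by (simp add: algebra_simps)
    ultimately show ?thesis unfolding f_def ht_def by (simp add: algebra_simps)
  qed
  have f_nonneg: "f d \<ge> 0" if "0 \<le> d" "d < \<epsilon>" for d
    unfolding f_def using \<phi>(4)[of "d / 2"] that by simp
  have "\<forall>\<^sub>F k in sequentially. s k < min \<rho> 1"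
    using s_lim \<rho> by (intro order_tendstoD(2)) auto
  moreover have "\<forall>\<^sub>F k in sequentially. g k < \<epsilon>" using g_lim \<phi>(3) by (intro order_tendstoD(2))
  moreover have "\<forall>\<^sub>F k in sequentially. D k < \<epsilon>" using D_lim \<phi>(3) by (intro order_tendstoD(2))
  ultimately have "\<forall>\<^sub>F k in sequentially. N \<le> k \<and> s k < min \<rho> 1 \<and> g k < \<epsilon> \<and> D k < \<epsilon>"
    using eventually_ge_at_top[of N] by eventually_elim auto
  then obtain N1 where N1: "\<And>k. k \<ge> N1 \<Longrightarrow> N \<le> k \<and> s k < min \<rho> 1 \<and> g k < \<epsilon> \<and> D k < \<epsilon>"
    unfolding eventually_sequentially by blast
  have step: "s (Suc k) \<le> (s k + \<tau> k) / 2 + K / (2 * q) * (f (D (Suc k)) - f (D (Suc (Suc k))))"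
    if k: "k \<ge> N1" and near: "norm (x k - xb) < \<rho>" for k
  proof (rule one_step_bound[where h = "ht (D (Suc k))" and ?D1.0 = "D (Suc k)" and ?D2.0 = "D (Suc (Suc k))"])
    have kN: "N \<le> k" using N1[OF k] by simp
    show "q * (s (Suc k))\<^sup>2 \<le> D (Suc k) - D (Suc (Suc k))" using descent[of "Suc k"] kN by simp
    then have le: "D (Suc (Suc k)) \<le> D (Suc k)" using q by (smt (verit) mult_nonneg_nonneg zero_le_power2)
    show "D (Suc k) \<ge> 0" "D (Suc (Suc k)) \<ge> 0" using D kN by simp_all
    show "q > 0" "K > 0" "s k \<ge> 0" "\<tau> k \<ge> 0" "s (Suc k) \<ge> 0" using q K s \<tau> by auto
    show "f (D (Suc k)) = f (D (Suc (Suc k)))" if "D (Suc k) = 0"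
      using le that \<open>D (Suc (Suc k)) \<ge> 0\<close> by simp
    have D1: "D (Suc k) < \<epsilon>" using N1[of "Suc k"] k by simp
    assume pos: "D (Suc k) > 0"
    show "ht (D (Suc k)) * (D (Suc k) - D (Suc (Suc k))) \<le> f (D (Suc k)) - f (D (Suc (Suc k)))"
      using f_diff[OF pos D1 \<open>D (Suc (Suc k)) \<ge> 0\<close> le] .
    have h2: "h (D (Suc k) / 2) > 0" using h pos D1 by simp
    have p2: "(1 - \<theta>0) * D (Suc k) powr (- \<theta>0) > 0" using pos \<theta>0 by simp
    show "ht (D (Suc k)) \<ge> 0" unfolding ht_def using h2 p2 by simp
    show "1 \<le> ht (D (Suc k)) * (K * (s k + \<tau> k))"
    proof (cases "g k < D (Suc k) / 2")
      case False
      have "1 \<le> h (g k) * (C' * s k)" using KL[OF kN near] N1[OF k] pos False by simp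
      also have "\<dots> \<le> h (D (Suc k) / 2) * (C' * s k)"
        using anti[of "D (Suc k) / 2" "g k"] pos False N1[OF k] C' s[of k] by (intro mult_right_mono) auto
      also have "\<dots> = h (D (Suc k) / 2) / 2 * (2 * C' * s k)" by simp
      also have "\<dots> \<le> ht (D (Suc k)) * (K * (s k + \<tau> k))"
        unfolding ht_def K_def using h2 p2 C' s[of k] \<tau>[of k] K1 \<theta>0 by (intro mult_mono) auto
      finally show ?thesis .
    next
      case True
      have "D (Suc k) powr \<theta>0 \<le> K1 * (s k + \<tau> k)" using small_gap[OF kN pos _ True] N1[OF k] by simp
      then have "1 \<le> D (Suc k) powr (- \<theta>0) * (K1 * (s k + \<tau> k))"
        using pos by (simp add: powr_minus field_simps)
      also have "\<dots> = (1 - \<theta>0) * D (Suc k) powr (- \<theta>0) * (K1 / (1 - \<theta>0) * (s k + \<tau> k))"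
        using \<theta>0 by simp
      also have "\<dots> \<le> ht (D (Suc k)) * (K * (s k + \<tau> k))"
        unfolding ht_def K_def using h2 p2 C' s[of k] \<tau>[of k] K1 \<theta>0 by (intro mult_mono) auto
      finally show ?thesis .
    qed
  qed
  define A where "A = K / (2 * q)"
  have A: "A > 0" unfolding A_def using K q by simp
  have flim: "(\<lambda>k. f (D (Suc k))) \<longlonglongrightarrow> 0"
  proof -
    have D': "(\<lambda>k. D (Suc k)) \<longlonglongrightarrow> 0" using D_lim by (rule LIMSEQ_Suc)
    have "(\<lambda>k. \<phi> (D (Suc k) / 2)) \<longlonglongrightarrow> \<phi> 0"
    proof (rule continuous_on_tendsto_compose[OF \<phi>(1)])
      show "(\<lambda>k. D (Suc k) / 2) \<longlonglongrightarrow> 0" using tendsto_divide[OF D' tendsto_const[of 2]] by simp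
      show "0 \<in> {0..<\<epsilon>}" using \<phi>(3) by simp
      show "\<forall>\<^sub>F k in sequentially. D (Suc k) / 2 \<in> {0..<\<epsilon>}"
        using eventually_ge_at_top[of N1]
      proof eventually_elim
        case (elim k)
        then show ?case using N1[of "Suc k"] D[of "Suc k"] by auto
      qed
    qed
    moreover have "(\<lambda>k. D (Suc k) powr (1 - \<theta>0)) \<longlonglongrightarrow> 0"
    proof (rule tendsto_zero_powrI[OF D' tendsto_const])
      show "\<forall>\<^sub>F k in sequentially. 0 \<le> D (Suc k)"
        using eventually_ge_at_top[of N] by eventually_elim (use D in auto)
    qed (use \<theta>0 in auto)
    ultimately show ?thesis unfolding f_def using \<phi>(2) tendsto_add by fastforce
  qed
  have "(\<lambda>k. C * (2 * s k + \<Theta> k + 2 * A * f (D (Suc k)))) \<longlonglongrightarrow> C * (2 * 0 + 0 + 2 * A * 0)"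
    by (intro tendsto_intros s_lim \<Theta>_lim flim)
  then have "\<forall>\<^sub>F k in sequentially. C * (2 * s k + \<Theta> k + 2 * A * f (D (Suc k))) < \<rho> / 2"
    using \<rho> by (intro order_tendstoD(2)) auto
  then obtain N2 where N2: "\<And>k. k \<ge> N2 \<Longrightarrow> C * (2 * s k + \<Theta> k + 2 * A * f (D (Suc k))) < \<rho> / 2"
    unfolding eventually_sequentially by blast
  \<comment> \<open>At \<open>k0\<close> both the distance to the cluster point and the bound on the
    remaining length are below \<rho> / 2, so later iterates cannot leave the KL ball.\<close>
  obtain k0 where k0: "k0 \<ge> max N1 N2" "norm (x k0 - xb) < \<rho> / 2"
    using cluster[of "\<rho> / 2" "max N1 N2"] \<rho> by auto
  have kN: "N \<le> k0" using N1[of k0] k0 by simp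
  define E where "E = 2 * s k0 + \<Theta> k0 + 2 * A * f (D (Suc k0))"
  have sumE: "(\<Sum>j=k0..n. s j) \<le> E" if "k0 \<le> n" "\<And>k. k0 \<le> k \<Longrightarrow> k < n \<Longrightarrow> norm (x k - xb) < \<rho>" for n
  proof -
    have "(\<Sum>j=k0..n. s j) + s n \<le> 2 * s k0 + (\<Theta> k0 - \<Theta> n) + 2 * A * (f (D (Suc k0)) - f (D (Suc n)))"
      by (rule telescoped_sum_bound[where \<tau> = \<tau> and f = "\<lambda>k. f (D k)"])
        (use step that k0 \<tau>_\<Theta> kN in \<open>auto simp: A_def\<close>)
    moreover have "2 * A * f (D (Suc n)) \<ge> 0"
      using A f_nonneg[of "D (Suc n)"] D[of "Suc n"] N1[of "Suc n"] that k0 by simp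
    ultimately show ?thesis unfolding E_def using s[of n] \<Theta>[of n] by (simp add: algebra_simps)
  qed
  \<comment> \<open>Nearness is needed for the length bound and follows from it. There is no circle,
    as the sum up to n' requires nearness only at indices below n'.\<close>
  have near: "norm (x n - xb) < \<rho>" if "k0 \<le> n" for n
    using that
  proof (induction n rule: less_induct)
    case (less n)
    show ?case
    proof (cases "n = k0")
      case True then show ?thesis using k0 \<rho> by simp
    next
      case False
      then obtain n' where n': "n = Suc n'" "k0 \<le> n'" using less.prems by (cases n) auto
      have "norm (x n - x k0) \<le> C * (\<Sum>j=k0..n'. s j)" using dist_le_sum[OF kN n'(2)] n' by simp
      also have "\<dots> \<le> C * E" using sumE[OF n'(2)] less n' C by (intro mult_left_mono) auto
      also have "\<dots> < \<rho> / 2" using N2[of k0] k0 unfolding E_def by simp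
      finally show ?thesis using k0(2) norm_triangle_ineq[of "x n - x k0" "x k0 - xb"] by simp
    qed
  qed
  have "summable (\<lambda>j. s (j + k0))"
  proof (rule bounded_imp_summable[of _ E])
    show "0 \<le> s (j + k0)" for j using s by simp
    show "(\<Sum>j\<le>n. s (j + k0)) \<le> E" for n
    proof -
      have "(\<Sum>j\<le>n. s (j + k0)) = (\<Sum>j=k0..n + k0. s j)"
        using sum.shift_bounds_cl_nat_ivl[of s 0 k0 n] by (simp add: atLeast0AtMost)
      also have "\<dots> \<le> E" by (rule sumE) (use near in auto)
      finally show ?thesis .
    qed
  qed
  then have "summable s" using summable_iff_shift by blast
  have "summable (\<lambda>k. x (Suc k) - x k)"
    by (rule summable_comparison_test'[OF summable_mult[OF \<open>summable s\<close>, of C] steps])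
  then have "convergent (\<lambda>n. x 0 + (\<Sum>k<n. x (Suc k) - x k))"
    by (intro convergent_add convergent_const) (simp add: summable_iff_convergent)
  then have "convergent x" by (simp add: sum_lessThan_telescope)
  then obtain l where l: "x \<longlonglongrightarrow> l" unfolding convergent_def by blast
  have "l = xb"
  proof (rule ccontr)
    assume "l \<noteq> xb"
    then have e: "dist l xb / 2 > 0" by simp
    then obtain n where n: "\<And>k. k \<ge> n \<Longrightarrow> dist (x k) l < dist l xb / 2"
      using l unfolding lim_sequentially by blast
    obtain k where "k \<ge> n" "norm (x k - xb) < dist l xb / 2" using cluster[OF e] by blast
    then show False using n[of k] dist_triangle2[of l xb "x k"] by (simp add: dist_norm norm_minus_commute)
  qed
  then show ?thesis using l by simp
qed

text \<open>Once convergence is known, all late iterates lie in the KL neighbourhood. The two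
  branches bound powers of D (Suc k) with exponents \<theta> and \<theta>0; since the gap is below
  1, both bounds survive with the larger exponent. The summation argument then runs with d powr (1 -
  \<theta>b) alone, and the length of the tail bounds the distance to the limit.\<close>

lemma KL_rates:
  assumes lim: "x \<longlonglongrightarrow> xs" and c: "c > 0" and \<theta>: "0 \<le> \<theta>" "\<theta> < 1" and \<rho>: "\<rho> > 0" "\<epsilon> > 0" and C': "C' > 0"
    and KL: "\<And>k. N \<le> k \<Longrightarrow> norm (x k - xs) < \<rho> \<Longrightarrow> s k < \<rho> \<Longrightarrow> 0 < g k \<Longrightarrow> g k < \<epsilon> \<Longrightarrow>
      c * g k powr (- \<theta>) * (C' * s k) \<ge> 1"
    and g_lim: "g \<longlonglongrightarrow> 0"
  defines "\<theta>b \<equiv> max \<theta> \<theta>0"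
  obtains K N1 where "K > 0" "N \<le> N1"
    "\<And>k. N1 \<le> k \<Longrightarrow> D (Suc k) powr \<theta>b \<le> K * (s k + \<tau> k)"
    "\<And>k. N1 \<le> k \<Longrightarrow> norm (x k - xs) \<le> K * (s k + \<Theta> k + D (Suc k) powr (1 - \<theta>b))"
proof -
  have \<theta>b: "0 < \<theta>b" "\<theta>b < 1" unfolding \<theta>b_def using \<theta> \<theta>0 by auto
  have "\<forall>\<^sub>F k in sequentially. norm (x k - xs) < \<rho>"
    using lim \<rho>(1) unfolding tendsto_iff dist_norm by blast
  moreover have "\<forall>\<^sub>F k in sequentially. s k < min \<rho> 1"
    using s_lim \<rho> by (intro order_tendstoD(2)) auto
  moreover have "\<forall>\<^sub>F k in sequentially. g k < \<epsilon>" using g_lim \<rho>(2) by (intro order_tendstoD(2))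
  moreover have "\<forall>\<^sub>F k in sequentially. D k < 1" using D_lim by (intro order_tendstoD(2)) auto
  ultimately have "\<forall>\<^sub>F k in sequentially. N \<le> k \<and> norm (x k - xs) < \<rho> \<and> s k < min \<rho> 1 \<and> g k < \<epsilon> \<and> D k < 1"
    using eventually_ge_at_top[of N] by eventually_elim auto
  then obtain N1 where N1: "\<And>k. k \<ge> N1 \<Longrightarrow> N \<le> k \<and> norm (x k - xs) < \<rho> \<and> s k < min \<rho> 1 \<and> g k < \<epsilon> \<and> D k < 1"
    unfolding eventually_sequentially by blast
  \<comment> \<open>The factor 2 pays for KL being used at g k \<ge> D (Suc k) / 2, since 2 powr
    \<theta> is at most 2; K1 serves the other branch.\<close>
  define K where "K = 2 * c * C' + K1"
  have K: "K > 0" unfolding K_def using c C' K1 by (intro add_pos_pos) auto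
  have R1: "D (Suc k) powr \<theta>b \<le> K * (s k + \<tau> k)" if k: "k \<ge> N1" for k
  proof (cases "D (Suc k) > 0")
    case False
    then have "D (Suc k) = 0" using D[of "Suc k"] N1[OF k] by simp
    then show ?thesis using K s[of k] \<tau>[of k] by simp
  next
    case pos: True
    have D1: "D (Suc k) \<le> 1" using N1[of "Suc k"] k by simp
    have kN: "N \<le> k" using N1[OF k] by simp
    show ?thesis
    proof (cases "g k < D (Suc k) / 2")
      case False
      then have gp: "g k > 0" using pos by simp
      have "1 \<le> c * g k powr (- \<theta>) * (C' * s k)" using KL[OF kN] N1[OF k] gp by simp
      then have "g k powr \<theta> \<le> c * C' * s k" using gp by (simp add: powr_minus field_simps)
      moreover have "(D (Suc k) / 2) powr \<theta> \<le> g k powr \<theta>" using False pos \<theta> by (intro powr_mono2) auto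
      moreover have "D (Suc k) powr \<theta> \<le> 2 * (D (Suc k) / 2) powr \<theta>"
      proof -
        have "(2::real) powr \<theta> \<le> 2 powr 1" using \<theta> by (intro powr_mono) auto
        moreover have "D (Suc k) powr \<theta> = 2 powr \<theta> * (D (Suc k) / 2) powr \<theta>"
          using pos by (simp flip: powr_mult)
        ultimately show ?thesis by (simp add: mult_right_mono)
      qed
      moreover have "D (Suc k) powr \<theta>b \<le> D (Suc k) powr \<theta>"
        unfolding \<theta>b_def using pos D1 by (intro powr_mono') auto
      ultimately have "D (Suc k) powr \<theta>b \<le> 2 * c * C' * s k" by simp
      also have "\<dots> \<le> K * (s k + \<tau> k)" unfolding K_def
        using c C' K1 s[of k] \<tau>[of k] by (intro mult_mono) auto
      finally show ?thesis .
    next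
      case True
      have "D (Suc k) powr \<theta>b \<le> D (Suc k) powr \<theta>0"
        unfolding \<theta>b_def using pos D1 by (intro powr_mono') auto
      also have "\<dots> \<le> K1 * (s k + \<tau> k)" using small_gap[OF kN pos _ True] N1[OF k] by simp
      also have "\<dots> \<le> K * (s k + \<tau> k)" unfolding K_def
        using c C' s[of k] \<tau>[of k] by (intro mult_right_mono) auto
      finally show ?thesis .
    qed
  qed
  \<comment> \<open>Cancels the factor 1 - \<theta>b that differentiating d powr (1 - \<theta>b)
    produces.\<close>
  define K' where "K' = K / (1 - \<theta>b)"
  have K': "K' > 0" unfolding K'_def using K \<theta>b by simp
  have R2: "s (Suc k) \<le> (s k + \<tau> k) / 2 + K' / (2 * q) * (D (Suc k) powr (1 - \<theta>b) - D (Suc (Suc k)) powr (1 - \<theta>b))"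
    if k: "k \<ge> N1" for k
  proof (rule one_step_bound[where h = "(1 - \<theta>b) * D (Suc k) powr (- \<theta>b)" and ?D1.0 = "D (Suc k)" and ?D2.0 = "D (Suc (Suc k))"])
    have kN: "N \<le> k" using N1[OF k] by simp
    show "q * (s (Suc k))\<^sup>2 \<le> D (Suc k) - D (Suc (Suc k))" using descent[of "Suc k"] kN by simp
    then have le: "D (Suc (Suc k)) \<le> D (Suc k)" using q by (smt (verit) mult_nonneg_nonneg zero_le_power2)
    show "D (Suc k) \<ge> 0" "D (Suc (Suc k)) \<ge> 0" using D kN by simp_all
    show "q > 0" "K' > 0" "s k \<ge> 0" "\<tau> k \<ge> 0" "s (Suc k) \<ge> 0" using q K' s \<tau> by auto
    show "D (Suc k) powr (1 - \<theta>b) = D (Suc (Suc k)) powr (1 - \<theta>b)" if "D (Suc k) = 0"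
      using le that \<open>D (Suc (Suc k)) \<ge> 0\<close> by simp
    assume pos: "D (Suc k) > 0"
    show "(1 - \<theta>b) * D (Suc k) powr (- \<theta>b) * (D (Suc k) - D (Suc (Suc k))) \<le>
       D (Suc k) powr (1 - \<theta>b) - D (Suc (Suc k)) powr (1 - \<theta>b)"
      using powr_le_tangent[OF pos \<open>D (Suc (Suc k)) \<ge> 0\<close>, of "1 - \<theta>b"] \<theta>b by (simp add: algebra_simps)
    show "(1 - \<theta>b) * D (Suc k) powr (- \<theta>b) \<ge> 0" using \<theta>b by simp
    have "1 \<le> D (Suc k) powr (- \<theta>b) * (K * (s k + \<tau> k))"
      using R1[OF k] pos by (simp add: powr_minus field_simps)
    also have "\<dots> = (1 - \<theta>b) * D (Suc k) powr (- \<theta>b) * (K' * (s k + \<tau> k))"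
      unfolding K'_def using \<theta>b by simp
    finally show "1 \<le> (1 - \<theta>b) * D (Suc k) powr (- \<theta>b) * (K' * (s k + \<tau> k))" .
  qed
  define A where "A = K' / (2 * q)"
  have A: "A > 0" unfolding A_def using K' q by simp
  define E where "E k = 2 * s k + \<Theta> k + 2 * A * D (Suc k) powr (1 - \<theta>b)" for k
  have R3: "norm (x k - xs) \<le> C * E k" if k: "k \<ge> N1" for k
  proof -
    have kN: "N \<le> k" using N1[OF k] by simp
    have "norm (x k - x (Suc n)) \<le> C * E k" if n: "n \<ge> k" for n
    proof -
      have "(\<Sum>j=k..n. s j) + s n \<le> 2 * s k + (\<Theta> k - \<Theta> n) + 2 * A * (D (Suc k) powr (1 - \<theta>b) - D (Suc n) powr (1 - \<theta>b))"
        by (rule telescoped_sum_bound[where \<tau> = \<tau> and f = "\<lambda>k. D k powr (1 - \<theta>b)"])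
          (use R2 k \<tau>_\<Theta> kN n in \<open>auto simp: A_def\<close>)
      moreover have "2 * A * D (Suc n) powr (1 - \<theta>b) \<ge> 0" using A by simp
      ultimately have "(\<Sum>j=k..n. s j) \<le> E k"
        unfolding E_def using s[of n] \<Theta>[of n] by (simp add: algebra_simps)
      then have "C * (\<Sum>j=k..n. s j) \<le> C * E k" using C by simp
      then show ?thesis using dist_le_sum[OF kN n] by (simp add: norm_minus_commute)
    qed
    then have "\<forall>\<^sub>F n in sequentially. norm (x k - x (Suc n)) \<le> C * E k"
      unfolding eventually_sequentially by blast
    moreover have "(\<lambda>n. norm (x k - x (Suc n))) \<longlonglongrightarrow> norm (x k - xs)"
      by (intro tendsto_intros LIMSEQ_Suc[OF lim])
    ultimately show ?thesis using tendsto_upperbound trivial_limit_sequentially by blast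
  qed
  define K'' where "K'' = max K (C * (2 + 2 * A))"
  show thesis
  proof (rule that[of K'' N1])
    show "K'' > 0" "N \<le> N1" unfolding K''_def using K N1[of N1] by auto
    fix k assume k: "N1 \<le> k"
    have "K * (s k + \<tau> k) \<le> K'' * (s k + \<tau> k)"
      unfolding K''_def using s[of k] \<tau>[of k] by (intro mult_right_mono) auto
    with R1[OF k] show "D (Suc k) powr \<theta>b \<le> K'' * (s k + \<tau> k)" by simp
    have "E k \<le> (2 + 2 * A) * (s k + \<Theta> k + D (Suc k) powr (1 - \<theta>b))"
      unfolding E_def using s[of k] \<Theta>[of k] A by (simp add: algebra_simps)
    then have "C * E k \<le> C * (2 + 2 * A) * (s k + \<Theta> k + D (Suc k) powr (1 - \<theta>b))"
      using C by (simp add: mult.assoc)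
    also have "\<dots> \<le> K'' * (s k + \<Theta> k + D (Suc k) powr (1 - \<theta>b))"
      unfolding K''_def using s[of k] \<Theta>[of k] by (intro mult_right_mono add_nonneg_nonneg) auto
    finally show "norm (x k - xs) \<le> K'' * (s k + \<Theta> k + D (Suc k) powr (1 - \<theta>b))" using R3[OF k] by simp
  qed
qed

end

section \<open>Elementary decay rates\<close>

lemma powr_decrement_le:
  fixes k \<sigma> :: real
  assumes "k > 0" "\<sigma> \<ge> 0"
  shows "k powr (- \<sigma>) - (k + 1) powr (- \<sigma>) \<le> \<sigma> * k powr (- \<sigma> - 1)"
proof -
  have "k + 1 = k * (1 + 1 / k)" using assms by (simp add: field_simps)
  then have "(k + 1) powr (- \<sigma>) = k powr (- \<sigma>) * (1 + 1 / k) powr (- \<sigma>)"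
    by (simp only: powr_mult)
  moreover have "(1 + 1 / k) powr (- \<sigma>) \<ge> 1 - \<sigma> / k"
  proof -
    have "\<sigma> * ln (1 + 1 / k) \<le> \<sigma> * (1 / k)"
      using assms by (intro mult_left_mono ln_add_one_self_le_self) auto
    moreover have "(1 + 1 / k) powr (- \<sigma>) = exp (- (\<sigma> * ln (1 + 1 / k)))"
      using assms by (simp add: powr_def add_pos_pos add_nonneg_eq_0_iff)
    ultimately show ?thesis using exp_ge_add_one_self[of "- (\<sigma> * ln (1 + 1 / k))"] by simp
  qed
  ultimately have "(k + 1) powr (- \<sigma>) \<ge> k powr (- \<sigma>) * (1 - \<sigma> / k)" by (simp add: mult_left_mono)
  moreover have "k powr (- \<sigma> - 1) = k powr (- \<sigma>) / k" using assms by (simp add: powr_diff)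
  ultimately show ?thesis by (simp add: algebra_simps)
qed

lemma powr_decrement_ge:
  fixes k \<sigma> :: real
  assumes "k > 0" "\<sigma> \<ge> 0"
  shows "\<sigma> * (k + 1) powr (- \<sigma> - 1) \<le> k powr (- \<sigma>) - (k + 1) powr (- \<sigma>)"
proof -
  define m where "m = k + 1"
  have m: "m > 1" unfolding m_def using assms by simp
  have "k = m * (1 - 1 / m)" unfolding m_def using assms by (simp add: field_simps)
  then have "k powr (- \<sigma>) = m powr (- \<sigma>) * (1 - 1 / m) powr (- \<sigma>)"
    by (metis powr_mult)
  moreover have "(1 - 1 / m) powr (- \<sigma>) \<ge> 1 + \<sigma> / m"
  proof -
    have "ln (1 - 1 / m) \<le> - (1 / m)"
      using ln_le_minus_one[of "1 - 1 / m"] m by simp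
    then have "\<sigma> * ln (1 - 1 / m) \<le> \<sigma> * (- (1 / m))"
      using assms by (intro mult_left_mono) auto
    moreover have "(1 - 1 / m) powr (- \<sigma>) = exp (- (\<sigma> * ln (1 - 1 / m)))"
      using m by (simp add: powr_def)
    ultimately show ?thesis using exp_ge_add_one_self[of "- (\<sigma> * ln (1 - 1 / m))"] by simp
  qed
  ultimately have "k powr (- \<sigma>) \<ge> m powr (- \<sigma>) * (1 + \<sigma> / m)" by (simp add: mult_left_mono)
  moreover have "m powr (- \<sigma> - 1) = m powr (- \<sigma>) / m" using m by (simp add: powr_diff)
  ultimately show ?thesis unfolding m_def by (simp add: algebra_simps)
qed

lemma powr_Suc_ge:
  fixes k \<sigma> :: real
  assumes "k \<ge> 1" "\<sigma> \<ge> 0"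
  shows "k powr (- \<sigma>) \<le> 2 powr \<sigma> * (k + 1) powr (- \<sigma>)"
proof -
  have "(2 * k) powr (- \<sigma>) \<le> (k + 1) powr (- \<sigma>)"
    using assms by (intro powr_mono2') auto
  then show ?thesis using assms by (simp add: powr_mult powr_minus field_simps)
qed

lemma geometric_rate:
  fixes D :: "nat \<Rightarrow> real"
  assumes \<beta>: "\<beta> > 0" and D: "\<And>k. N \<le> k \<Longrightarrow> D k \<ge> 0"
    and rec: "\<And>k. N \<le> k \<Longrightarrow> D (Suc k) \<le> \<beta> * D k"
  shows "\<exists>A>0. \<forall>k\<ge>N. D k \<le> A * \<beta> ^ k"
proof -
  define A where "A = D N / \<beta> ^ N + 1"
  have "D k \<le> A * \<beta> ^ k" if "N \<le> k" for k
    using that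
  proof (induction k rule: dec_induct)
    case base
    show ?case unfolding A_def using \<beta> by (simp add: algebra_simps)
  next
    case (step k)
    have "D (Suc k) \<le> \<beta> * D k" using rec step by simp
    also have "\<dots> \<le> \<beta> * (A * \<beta> ^ k)" using step \<beta> by (intro mult_left_mono) auto
    finally show ?case by (simp add: ac_simps)
  qed
  moreover have "A > 0" unfolding A_def using D[of N] \<beta> by (simp add: add_nonneg_pos)
  ultimately show ?thesis by blast
qed

text \<open>A discrete comparison with the differential equation in which the derivative of D is a
  negative multiple of its p-th power. If the bound first failed at k + 1, the left side would be of
  order A powr p, but the right side only of order A, both times the same power of k; as p > 1, this
  is impossible for large A. The condition \<sigma> * (p - 1) \<le> 1 says that the decrement k powr
  (- \<sigma> - 1) is no larger than k powr (- (\<sigma> * p)).\<close>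

lemma powr_rate:
  fixes D :: "nat \<Rightarrow> real"
  assumes p: "p > 1" and K: "K > 0" and \<sigma>: "\<sigma> > 0" "\<sigma> * (p - 1) \<le> 1" and N: "N \<ge> 1"
    and D: "\<And>k. N \<le> k \<Longrightarrow> D k \<ge> 0"
    and rec: "\<And>k. N \<le> k \<Longrightarrow> D (Suc k) powr p \<le> K * (D k - D (Suc k) + real k powr (- (\<sigma> * p)))"
  shows "\<exists>A>0. \<forall>k\<ge>N. D k \<le> A * real k powr (- \<sigma>)"
proof -
  \<comment> \<open>\<sigma> + 1 collects the decrement and the perturbation, 2 powr (\<sigma> * p)
    the passage from k to k + 1.\<close>
  define X where "X = (\<sigma> + 1) * K * 2 powr (\<sigma> * p)"
  have X: "X > 0" unfolding X_def using \<sigma> K by simp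
  \<comment> \<open>A \<ge> 1 absorbs the perturbation, the power of X yields \<open>AX\<close>, and
    the last entry is the base case.\<close>
  define A where "A = max (max 1 (X powr (1 / (p - 1)))) (D N * real N powr \<sigma>)"
  have A: "A \<ge> 1" "A \<ge> X powr (1 / (p - 1))" "A \<ge> D N * real N powr \<sigma>"
    unfolding A_def by (simp_all add: le_max_iff_disj)
  have "X = (X powr (1 / (p - 1))) powr (p - 1)" using X p by (simp add: powr_powr)
  also have "\<dots> \<le> A powr (p - 1)" using A p by (intro powr_mono2) auto
  finally have AX: "A powr p \<ge> A * X"
  proof -
    assume "X \<le> A powr (p - 1)"
    then have "A * X \<le> A * A powr (p - 1)" using A by (intro mult_left_mono) auto
    also have "\<dots> = A powr p" using A by (simp add: powr_diff)
    finally show ?thesis .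
  qed
  have "D k \<le> A * real k powr (- \<sigma>)" if "N \<le> k" for k
    using that
  proof (induction k rule: dec_induct)
    case base
    have "D N = D N * real N powr \<sigma> * real N powr (- \<sigma>)" using N by (simp add: powr_minus)
    also have "\<dots> \<le> A * real N powr (- \<sigma>)" using A by (intro mult_right_mono) auto
    finally show ?case .
  next
    case (step k)
    have k: "real k \<ge> 1" "real k > 0" using step N by auto
    show ?case
    proof (rule ccontr)
      assume "\<not> D (Suc k) \<le> A * real (Suc k) powr (- \<sigma>)"
      then have gt: "D (Suc k) > A * (real k + 1) powr (- \<sigma>)" by (simp add: add.commute)
      have "A powr p * (real k + 1) powr (- (\<sigma> * p)) = (A * (real k + 1) powr (- \<sigma>)) powr p"
        using A by (simp add: powr_mult powr_powr)
      also have "\<dots> \<le> D (Suc k) powr p" using gt A p by (intro powr_mono2) auto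
      also have "\<dots> \<le> K * (D k - D (Suc k) + real k powr (- (\<sigma> * p)))" using rec step by simp
      also have "\<dots> < K * (A * real k powr (- \<sigma>) - A * (real k + 1) powr (- \<sigma>) + real k powr (- (\<sigma> * p)))"
        using gt step K by (intro mult_strict_left_mono) auto
      also have "\<dots> \<le> K * (A * (\<sigma> * real k powr (- \<sigma> - 1)) + real k powr (- (\<sigma> * p)))"
        using mult_left_mono[OF powr_decrement_le[OF k(2), of \<sigma>], of A] \<sigma> A K
        by (intro mult_left_mono) (auto simp: algebra_simps)
      also have "\<dots> \<le> K * (A * (\<sigma> * real k powr (- (\<sigma> * p))) + A * real k powr (- (\<sigma> * p)))"
      proof -
        have "real k powr (- \<sigma> - 1) \<le> real k powr (- (\<sigma> * p))"
          using k \<sigma> by (intro powr_mono) (auto simp: algebra_simps)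
        moreover have "1 * real k powr (- (\<sigma> * p)) \<le> A * real k powr (- (\<sigma> * p))"
          using A by (intro mult_right_mono) auto
        ultimately show ?thesis using A \<sigma> K by (intro mult_left_mono add_mono) auto
      qed
      also have "\<dots> = K * A * (\<sigma> + 1) * real k powr (- (\<sigma> * p))" by (simp add: algebra_simps)
      also have "\<dots> \<le> K * A * (\<sigma> + 1) * (2 powr (\<sigma> * p) * (real k + 1) powr (- (\<sigma> * p)))"
        using powr_Suc_ge[OF k(1), of "\<sigma> * p"] K A \<sigma> p by (intro mult_left_mono) auto
      also have "\<dots> = A * X * (real k + 1) powr (- (\<sigma> * p))" unfolding X_def by simp
      also have "\<dots> \<le> A powr p * (real k + 1) powr (- (\<sigma> * p))" using AX by (intro mult_right_mono) auto
      finally show False by simp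
    qed
  qed
  then show ?thesis using A(1) by (intro exI[of _ A]) auto
qed

section \<open>Descent of the algorithm\<close>

text \<open>Multiplied by \<open>ch\<close>, the dissipation inequality outweighs the error terms of
  \<open>up\<close> and \<open>down\<close> with surplus chie - \<rho>1. Its cost in
  \<open>tn\<close>, as well as that of the recursion for \<open>tol\<close>, is paid out of one
  half of the decrease d times the square of \<open>hn\<close>, converted by assumption
  \<open>tn\<close> into d / 4 times the square of \<open>tn\<close>. The condition on \<kappa>1
  says that this budget suffices.\<close>

lemma lyapunov:
  fixes \<phi> \<psi> en hn tn tol Er b :: "nat \<Rightarrow> real"
  assumes pos: "0 < ce" "0 < \<mu>" "0 < \<nu>" "0 < \<rho>1" "0 < \<rho>2" "\<rho>1 < chie" "0 \<le> \<kappa>1" "0 \<le> a" "0 \<le> Csh" "0 \<le> c\<eta>"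
    and nonneg: "\<And>k. Er k \<ge> 0" "\<And>k. tol k \<ge> 0"
    and d: "0 < a - c\<eta>"
    and \<kappa>1: "\<kappa>1 * ((a - c\<eta>) * C1 / 2 + Csh) < (a - c\<eta>) / 4 - \<nu> / (2 * \<rho>2) - chie * \<nu>"
    and S: "0 \<le> C1"
    and up: "\<And>k. \<psi> k \<le> \<phi> k - a * (hn k)\<^sup>2 + (en k)\<^sup>2 / (2 * \<rho>2)"
    and down: "\<And>k. \<phi> (Suc k) \<le> \<psi> k + c\<eta> * (hn k)\<^sup>2 + Csh * tol k + \<rho>1 * (en k)\<^sup>2"
    and tn: "\<And>k. (tn k)\<^sup>2 \<le> 2 * (hn k)\<^sup>2 + 2 * C1 * tol k"
    and diss: "\<And>k. (en k)\<^sup>2 + \<mu> * Er k \<le> ce * (Er k - Er (Suc k)) + \<nu> * (tn k)\<^sup>2"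
    and tol: "\<And>k. k0 \<le> k \<Longrightarrow> tol (Suc k) \<le> \<kappa>1 * (tn k)\<^sup>2 + b k"
  defines "P \<equiv> \<lambda>k. (en k)\<^sup>2 + Er k + (hn k)\<^sup>2 + (tn k)\<^sup>2 + tol k"
  obtains q C c S where "q > 0" "C > 0" "c > 0" "S > 0"
    "\<And>k. k0 \<le> k \<Longrightarrow> \<phi> (Suc k) + c * Er (Suc k) + S * tol (Suc k) + q * P k \<le> \<phi> k + c * Er k + S * tol k + S * b k"
    "\<And>k. \<psi> k \<le> \<phi> k + c * Er k + S * tol k + C * P k"
    "\<And>k. k0 \<le> k \<Longrightarrow> \<phi> (Suc k) + c * Er (Suc k) + S * tol (Suc k) \<le> \<psi> k + C * P k + S * b k"
proof -
  define d where "d = a - c\<eta>"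
  define S0 where "S0 = d * C1 / 2 + Csh"
  define Dd where "Dd = d / 4 - \<nu> / (2 * \<rho>2) - chie * \<nu>"
  \<comment> \<open>S' must exceed S0 to leave a surplus in front of \<open>tol k\<close>, while S'
    * \<kappa>1 must stay below Dd; this \<epsilon> spends at most half of the gap.\<close>
  define \<epsilon> where "\<epsilon> = (Dd - \<kappa>1 * S0) / (2 * (\<kappa>1 + 1))"
  have gap: "Dd - \<kappa>1 * S0 > 0" using \<kappa>1 unfolding Dd_def S0_def d_def by simp
  have \<epsilon>: "\<epsilon> > 0" unfolding \<epsilon>_def using gap pos by simp
  define S' where "S' = S0 + \<epsilon>"
  have S0: "S0 \<ge> 0" unfolding S0_def d_def using d S pos by simp
  have S': "S' > 0" unfolding S'_def using S0 \<epsilon> by simp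
  have "\<epsilon> * \<kappa>1 \<le> \<epsilon> * (\<kappa>1 + 1)" using \<epsilon> by simp
  also have "\<dots> = (Dd - \<kappa>1 * S0) / 2" unfolding \<epsilon>_def using pos by (simp add: field_simps)
  finally have "S' * \<kappa>1 \<le> \<kappa>1 * S0 + (Dd - \<kappa>1 * S0) / 2" unfolding S'_def by (simp add: algebra_simps)
  then have gap': "Dd - S' * \<kappa>1 > 0" using gap by (simp add: field_simps)
  define ch where "ch = chie + 1 / (2 * \<rho>2)"
  have ch: "ch > 0" unfolding ch_def using pos by (simp add: add_pos_pos)
  define c where "c = ch * ce"
  have c: "c > 0" unfolding c_def using ch pos by simp
  have dp: "d > 0" using d d_def by simp
  have Er': "c * Er (Suc k) \<le> c * Er k - ch * (en k)\<^sup>2 - ch * \<mu> * Er k + ch * \<nu> * (tn k)\<^sup>2" for k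
    using mult_left_mono[OF diss[of k], of ch] ch unfolding c_def by (simp add: algebra_simps)
  \<comment> \<open>The entries are the surpluses in front of the five summands of
    \<open>P k\<close>, in the same order.\<close>
  define q where "q = Min {chie - \<rho>1, ch * \<mu>, d / 2, Dd - S' * \<kappa>1, \<epsilon>}"
  have q: "q > 0" unfolding q_def using pos ch dp gap' \<epsilon> by simp
  have ql: "q \<le> chie - \<rho>1" "q \<le> ch * \<mu>" "q \<le> d / 2" "q \<le> Dd - S' * \<kappa>1" "q \<le> \<epsilon>"
    unfolding q_def by (rule Min_le, simp, simp)+
  define C where "C = 1 + 1 / (2 * \<rho>2) + c\<eta> + Csh + \<rho>1 + c + ch * \<nu> + S' * \<kappa>1"
  have C1: "C > 0" "1 / (2 * \<rho>2) \<le> C" "c\<eta> \<le> C" "Csh \<le> C" "\<rho>1 \<le> C" "c \<le> C" "ch * \<nu> + S' * \<kappa>1 \<le> C"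
  proof -
    have "1 / (2 * \<rho>2) \<ge> 0" "ch * \<nu> \<ge> 0" "S' * \<kappa>1 \<ge> 0" using pos ch S' by simp_all
    then show "C > 0" "1 / (2 * \<rho>2) \<le> C" "c\<eta> \<le> C" "Csh \<le> C" "\<rho>1 \<le> C" "c \<le> C" "ch * \<nu> + S' * \<kappa>1 \<le> C"
      unfolding C_def using pos c by linarith+
  qed
  have P: "P k \<ge> 0" for k unfolding P_def using nonneg by simp
  show thesis
  proof (rule that[of q C c S'])
    show "q > 0" "C > 0" "c > 0" "S' > 0" by fact+
    fix k
    have "(en k)\<^sup>2 / (2 * \<rho>2) \<le> C * P k"
    proof -
      have "1 / (2 * \<rho>2) * (en k)\<^sup>2 \<le> C * P k"
        using C1 nonneg[of k] unfolding P_def by (intro mult_mono) auto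
      then show ?thesis by simp
    qed
    moreover have "a * (hn k)\<^sup>2 \<ge> 0" "c * Er k \<ge> 0" "S' * tol k \<ge> 0" using pos c S' nonneg by simp_all
    ultimately show "\<psi> k \<le> \<phi> k + c * Er k + S' * tol k + C * P k" using up[of k] by linarith
    assume k: "k0 \<le> k"
    have t1: "S' * tol (Suc k) \<le> S' * \<kappa>1 * (tn k)\<^sup>2 + S' * b k"
      using mult_left_mono[OF tol[OF k], of S'] S' by (simp add: algebra_simps)
    have "q * P k \<le> (chie - \<rho>1) * (en k)\<^sup>2 + ch * \<mu> * Er k + d / 2 * (hn k)\<^sup>2 + (Dd - S' * \<kappa>1) * (tn k)\<^sup>2 + \<epsilon> * tol k"
      unfolding P_def distrib_left using ql nonneg by (intro add_mono mult_right_mono) auto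
    moreover have "\<phi> (Suc k) \<le> \<phi> k - d * (hn k)\<^sup>2 + (\<rho>1 + 1 / (2 * \<rho>2)) * (en k)\<^sup>2 + Csh * tol k"
      using up[of k] down[of k] unfolding d_def by (simp add: algebra_simps)
    moreover have "d / 4 * (tn k)\<^sup>2 \<le> d / 2 * (hn k)\<^sup>2 + d * C1 / 2 * tol k"
      using mult_left_mono[OF tn[of k], of "d / 4"] dp by (simp add: algebra_simps)
    ultimately show "\<phi> (Suc k) + c * Er (Suc k) + S' * tol (Suc k) + q * P k \<le> \<phi> k + c * Er k + S' * tol k + S' * b k"
      using Er'[of k] t1 unfolding Dd_def S'_def S0_def ch_def by (simp add: algebra_simps)
    have "ch * (en k)\<^sup>2 \<ge> 0" "ch * \<mu> * Er k \<ge> 0" using ch pos nonneg by simp_all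
    then have "\<phi> (Suc k) + c * Er (Suc k) + S' * tol (Suc k) \<le> \<psi> k +
       (\<rho>1 * (en k)\<^sup>2 + c * Er k + c\<eta> * (hn k)\<^sup>2 + (ch * \<nu> + S' * \<kappa>1) * (tn k)\<^sup>2 + Csh * tol k) + S' * b k"
      using Er'[of k] t1 down[of k] by (simp add: algebra_simps)
    also have "\<rho>1 * (en k)\<^sup>2 + c * Er k + c\<eta> * (hn k)\<^sup>2 + (ch * \<nu> + S' * \<kappa>1) * (tn k)\<^sup>2 + Csh * tol k \<le> C * P k"
      unfolding P_def distrib_left using C1 nonneg by (intro add_mono mult_right_mono) auto
    finally show "\<phi> (Suc k) + c * Er (Suc k) + S' * tol (Suc k) \<le> \<psi> k + C * P k + S' * b k" by simp
  qed
qed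

section \<open>One-step estimates along a run\<close>

lemma convex_subgradient_norm_le:
  assumes "g \<in> convex_subdifferential R z" "L-lipschitz_on UNIV R"
  shows "norm g \<le> L"
proof -
  have "R (z + g) \<ge> R z + inner g g"
    using assms(1) unfolding convex_subdifferential_def by (auto dest: spec[of _ "z + g"])
  then have "norm g * norm g \<le> L * norm g"
    using lipschitz_diff_le[OF assms(2), of "z + g" z] by (simp add: power2_norm_eq_inner[symmetric] power2_eq_square)
  then show ?thesis using lipschitz_on_nonneg[OF assms(2)] by (cases "g = 0") auto
qed

lemma regular_subset_limiting: "regular_subdifferential \<phi> z \<subseteq> limiting_subdifferential \<phi> z"
proof
  fix v assume v: "v \<in> regular_subdifferential \<phi> z"
  then have "\<bar>\<phi> z\<bar> \<noteq> \<infinity>" by (simp add: regular_subdifferential_def)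
  moreover have "\<exists>y w. y \<longlonglongrightarrow> z \<and> (\<lambda>i. \<phi> (y i)) \<longlonglongrightarrow> \<phi> z \<and>
      (\<forall>i. w i \<in> regular_subdifferential \<phi> (y i)) \<and> w \<longlonglongrightarrow> v"
    using v by (intro exI[where x = "\<lambda>_. z"] exI[where x = "\<lambda>_. v"] conjI allI tendsto_const)
  ultimately show "v \<in> limiting_subdifferential \<phi> z"
    unfolding limiting_subdifferential_def by (intro CollectI conjI)
qed

text \<open>The interface between algorithm and analysis: multipliers, momentum and the retraction
  have been eliminated, leaving the exact step, the inexact step and the estimates that link them to
  each other and to the next iterate.\<close>

locale surrogate_run = covered_manifold M I V W \<psi> sel C0
  for M :: "'a::euclidean_space set" and I :: "'i set" and V W and \<psi> :: "'i \<Rightarrow> 'a \<Rightarrow> 'b::euclidean_space"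
    and sel C0 +
  fixes F R :: "'a \<Rightarrow> real" and U :: "'a set" and lf lR Mf Mu \<alpha> \<delta> CR L\<Phi> C1 \<rho>1 \<rho>2 :: real
    and x m \<eta> \<eta>h :: "nat \<Rightarrow> 'a" and tol :: "nat \<Rightarrow> real"
  assumes dF: "\<And>z. GDERIV F z :> nabla F z" and cont_dF: "continuous_on UNIV (nabla F)"
    and M_U: "M \<subseteq> U" and lip_dF: "lf-lipschitz_on U (nabla F)" and Mf: "\<And>y. y \<in> M \<Longrightarrow> norm (nabla F y) \<le> Mf"
    and conv_R: "convex_on UNIV R" and lip_R: "lR-lipschitz_on UNIV R"
    and U_ball: "\<And>y v. y \<in> M \<Longrightarrow> v \<in> tangent_space M y \<Longrightarrow> norm v \<le> \<delta> \<Longrightarrow> y + v \<in> U"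
    and \<alpha>: "\<alpha> > 0" "lf \<le> 1 / \<alpha>" and L\<Phi>: "L\<Phi> > 0" and CR: "CR > 0"
    and \<rho>: "\<rho>1 > 0" "\<rho>2 > 0" and Mu: "Mu \<ge> 0"
    and xM: "\<And>k. x k \<in> M" and m: "\<And>k. norm (m k) \<le> Mu"
    and \<eta>: "\<And>k. \<eta> k \<in> tangent_space M (x k)" "\<And>k. norm (\<eta> k) \<le> \<delta>"
    and \<eta>h: "\<And>k. \<eta>h k \<in> tangent_space M (x k)" "\<And>k. norm (\<eta>h k) \<le> \<delta>"
    and \<eta>h_min: "\<And>k v. v \<in> tangent_space M (x k) \<Longrightarrow> step_model R \<alpha> (x k) (m k) (\<eta>h k) \<le> step_model R \<alpha> (x k) (m k) v"
    and inexact: "\<And>k. (norm (\<eta> k - \<eta>h k))\<^sup>2 \<le> C1\<^sup>2 * tol k"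
      "\<And>k. step_model R \<alpha> (x k) (m k) (\<eta> k) \<le> step_model R \<alpha> (x k) (m k) (\<eta>h k) + 2 * C0 * lR * tol k"
    and tol: "\<And>k. tol k \<ge> 0"
    and next_x: "\<And>k. norm (x (Suc k) - x k) \<le> CR * norm (\<eta> k)"
      "\<And>k. F (x (Suc k)) + R (x (Suc k)) \<le> F (x k + \<eta> k) + R (x k + \<eta> k) + L\<Phi> * (norm (\<eta> k))\<^sup>2"
begin

abbreviation "\<Phi> z \<equiv> F z + R z"
abbreviation "grad z \<equiv> riem_grad M F z"
abbreviation "err k \<equiv> m k - grad (x k)"

lemma lf_nonneg: "lf \<ge> 0" using lip_dF by (rule lipschitz_on_nonneg)
lemma lR_nonneg: "lR \<ge> 0" using lip_R by (rule lipschitz_on_nonneg)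

lemma grad_inner: "v \<in> tangent_space M (x k) \<Longrightarrow> inner (grad (x k)) v = inner (nabla F (x k)) v"
  unfolding riem_grad_def by (rule closest_point_subspace(3)[OF subspace_tangent[OF xM]])

lemma \<eta>h_le: "norm (\<eta>h k) \<le> \<alpha> * (Mu + lR)"
proof -
  have "norm (\<eta>h k) \<le> \<alpha> * (norm (m k) + lR)"
    by (rule step_model_bound[OF lip_R conv_R \<alpha>(1) subspace_tangent[OF xM] \<eta>h_min \<eta>h(1)])
  also have "\<dots> \<le> \<alpha> * (Mu + lR)" using m[of k] \<alpha> by (intro mult_left_mono) auto
  finally show ?thesis .
qed

lemma segment_in_U:
  assumes "p \<in> tangent_space M (x k)" "norm p \<le> \<delta>" "p' \<in> tangent_space M (x k)" "norm p' \<le> \<delta>"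
  shows "closed_segment (x k + p) (x k + p') \<subseteq> U"
proof
  fix z assume "z \<in> closed_segment (x k + p) (x k + p')"
  then obtain t where t: "0 \<le> t" "t \<le> 1" "z = (1 - t) *\<^sub>R (x k + p) + t *\<^sub>R (x k + p')"
    unfolding closed_segment_def by blast
  define v where "v = (1 - t) *\<^sub>R p + t *\<^sub>R p'"
  have "z = x k + v" unfolding t(3) v_def by (simp add: algebra_simps)
  moreover have "v \<in> tangent_space M (x k)"
    unfolding v_def using subspace_tangent[OF xM] assms by (intro subspace_add subspace_scale)
  moreover have "norm v \<le> (1 - t) * norm p + t * norm p'"
    unfolding v_def using norm_triangle_ineq[of "(1 - t) *\<^sub>R p" "t *\<^sub>R p'"] t by simp
  moreover have "(1 - t) * norm p + t * norm p' \<le> \<delta>"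
    using convex_bound_le[of "norm p" \<delta> "norm p'" "1 - t" t] assms t by simp
  ultimately show "z \<in> U" using U_ball[OF xM] by auto
qed

text \<open>The descent lemma at x k is combined with the comparison of the exact step with 0 in the
  model. The step is tangent, so the Euclidean and the Riemannian gradient pair with it equally, and
  Young's inequality with weight \<rho>2 splits off the error.\<close>

lemma surrogate_le:
  "\<Phi> (x k + \<eta>h k) \<le> \<Phi> (x k) - (1 / (2 * \<alpha>) - lf / 2 - \<rho>2 / 2) * (norm (\<eta>h k))\<^sup>2 + (norm (err k))\<^sup>2 / (2 * \<rho>2)"
proof -
  have T0: "0 \<in> tangent_space M (x k)" using subspace_0[OF subspace_tangent[OF xM]] .
  have "norm (0::'a) \<le> \<delta>" using order_trans[OF norm_ge_zero \<eta>(2)[of k]] by simp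
  then have "F (x k + \<eta>h k) \<le> F (x k) + inner (nabla F (x k)) (\<eta>h k) + lf / 2 * (norm (\<eta>h k))\<^sup>2"
    using descent_lemma[OF dF lip_dF segment_in_U[OF T0 _ \<eta>h[of k]]] by simp
  moreover have "inner (m k) (\<eta>h k) + (norm (\<eta>h k))\<^sup>2 / (2 * \<alpha>) + R (x k + \<eta>h k) \<le> R (x k)"
    using \<eta>h_min[OF T0] by (simp add: step_model_def)
  moreover have "inner (nabla F (x k)) (\<eta>h k) = inner (m k) (\<eta>h k) - inner (err k) (\<eta>h k)"
    using grad_inner[OF \<eta>h(1)] by (simp add: inner_diff_left)
  moreover have "- inner (err k) (\<eta>h k) \<le> (norm (err k))\<^sup>2 / (2 * \<rho>2) + \<rho>2 / 2 * (norm (\<eta>h k))\<^sup>2"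
  proof -
    have "(norm (err k + \<rho>2 *\<^sub>R \<eta>h k))\<^sup>2 = (norm (err k))\<^sup>2 + 2 * \<rho>2 * inner (err k) (\<eta>h k) + \<rho>2\<^sup>2 * (norm (\<eta>h k))\<^sup>2"
      unfolding power2_norm_eq_inner by (simp add: inner_add_left inner_add_right inner_commute power2_eq_square)
    then have "0 \<le> (norm (err k))\<^sup>2 + 2 * \<rho>2 * inner (err k) (\<eta>h k) + \<rho>2\<^sup>2 * (norm (\<eta>h k))\<^sup>2"
      using zero_le_power2[of "norm (err k + \<rho>2 *\<^sub>R \<eta>h k)"] by simp
    then have "0 \<le> ((norm (err k))\<^sup>2 + 2 * \<rho>2 * inner (err k) (\<eta>h k) + \<rho>2\<^sup>2 * (norm (\<eta>h k))\<^sup>2) / (2 * \<rho>2)"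
      using \<rho> by simp
    then show ?thesis using \<rho> by (simp add: add_divide_distrib power2_eq_square)
  qed
  ultimately show ?thesis by (simp add: algebra_simps)
qed

text \<open>The descent lemma is applied from the exact to the inexact step, and the linear term in
  their difference d is traded for the inexact optimality of the model. The mixed products that
  remain are split by Young's inequality: weight \<rho>1 for the Lipschitz and the error term,
  weight 1 / (4 * \<alpha>) for the product of norms divided by \<alpha>.\<close>

lemma next_le:
  "\<Phi> (x (Suc k)) \<le> \<Phi> (x k + \<eta>h k) + (1 / (4 * \<alpha>) + lf\<^sup>2 * \<rho>1 + 2 * L\<Phi>) * (norm (\<eta>h k))\<^sup>2
     + (C1\<^sup>2 / \<alpha> + 2 * L\<Phi> * C1\<^sup>2 + C1\<^sup>2 / (2 * \<rho>1) + 2 * C0 * lR) * tol k + \<rho>1 * (norm (err k))\<^sup>2"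
proof -
  define d where "d = \<eta> k - \<eta>h k"
  have dT: "d \<in> tangent_space M (x k)"
    unfolding d_def using subspace_tangent[OF xM] \<eta> \<eta>h by (intro subspace_diff)
  have \<eta>d: "\<eta> k = \<eta>h k + d" unfolding d_def by simp
  let ?h = "norm (\<eta>h k)" and ?d = "norm d" and ?e = "norm (err k)"
  let ?G = "nabla F (x k + \<eta>h k)"
  have 1: "F (x k + \<eta> k) \<le> F (x k + \<eta>h k) + inner ?G d + lf / 2 * ?d\<^sup>2"
    using descent_lemma[OF dF lip_dF segment_in_U[OF \<eta>h[of k] \<eta>[of k]]] by (simp add: d_def)
  have inU: "x k + \<eta>h k \<in> U" "x k \<in> U" using U_ball[OF xM \<eta>h] M_U xM by auto
  have "norm (?G - nabla F (x k)) \<le> lf * ?h" using lipschitz_onD[OF lip_dF inU] by (simp add: dist_norm)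
  then have "inner (?G - nabla F (x k)) d \<le> lf * ?h * ?d"
    by (intro order_trans[OF norm_cauchy_schwarz] mult_right_mono) auto
  moreover have "inner (nabla F (x k)) d = inner (m k) d - inner (err k) d"
    using grad_inner[OF dT] by (simp add: inner_diff_left)
  moreover have "- inner (err k) d \<le> ?e * ?d" using Cauchy_Schwarz_ineq2[of "err k" d] by linarith
  ultimately have 2: "inner ?G d \<le> inner (m k) d + lf * ?h * ?d + ?e * ?d" by (simp add: inner_diff_left)
  have "(norm (\<eta> k))\<^sup>2 = ?h\<^sup>2 + 2 * inner (\<eta>h k) d + ?d\<^sup>2"
    unfolding \<eta>d power2_norm_eq_inner by (simp add: inner_add_left inner_add_right inner_commute)
  then have sq: "(norm (\<eta> k))\<^sup>2 / (2 * \<alpha>) = ?h\<^sup>2 / (2 * \<alpha>) + inner (\<eta>h k) d / \<alpha> + ?d\<^sup>2 / (2 * \<alpha>)"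
    using \<alpha> by (simp add: field_simps)
  have "- inner (\<eta>h k) d / \<alpha> \<le> ?h * ?d / \<alpha>"
    using norm_cauchy_schwarz[of "- \<eta>h k" d] \<alpha> by (intro divide_right_mono) auto
  then have iv: "- (inner (\<eta>h k) d / \<alpha>) \<le> ?h * ?d / \<alpha>" by simp
  have md: "inner (m k) (\<eta> k) = inner (m k) (\<eta>h k) + inner (m k) d" unfolding \<eta>d by (rule inner_add_right)
  have 3: "inner (m k) d + R (x k + \<eta> k) \<le> R (x k + \<eta>h k) + 2 * C0 * lR * tol k + ?h * ?d / \<alpha> - ?d\<^sup>2 / (2 * \<alpha>)"
    using inexact(2)[of k] sq iv md unfolding step_model_def by linarith
  \<comment> \<open>The quadratic remainder of 1 is absorbed by the negative square left in 3; this
    is what lf \<le> 1 / \<alpha> is for.\<close>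
  have 4: "lf / 2 * ?d\<^sup>2 \<le> ?d\<^sup>2 / (2 * \<alpha>)"
    using mult_right_mono[OF \<alpha>(2), of "?d\<^sup>2 / 2"] by simp
  have young: "u * v \<le> \<rho>1 * u\<^sup>2 + v\<^sup>2 / (4 * \<rho>1)" for u v :: real
  proof -
    have "0 \<le> (2 * \<rho>1 * u - v)\<^sup>2 / (4 * \<rho>1)" using \<rho> by simp
    also have "\<dots> = \<rho>1 * u\<^sup>2 + v\<^sup>2 / (4 * \<rho>1) - u * v" using \<rho> by (simp add: power2_eq_square field_simps)
    finally show ?thesis by simp
  qed
  have 5: "lf * ?h * ?d \<le> lf\<^sup>2 * \<rho>1 * ?h\<^sup>2 + ?d\<^sup>2 / (4 * \<rho>1)"
    using young[of "lf * ?h" ?d] by (simp add: power_mult_distrib algebra_simps)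
  have 6: "?e * ?d \<le> \<rho>1 * ?e\<^sup>2 + ?d\<^sup>2 / (4 * \<rho>1)" by (rule young)
  have 7: "?h * ?d / \<alpha> \<le> ?h\<^sup>2 / (4 * \<alpha>) + ?d\<^sup>2 / \<alpha>"
  proof -
    have "0 \<le> (?h / 2 - ?d)\<^sup>2 / \<alpha>" using \<alpha> by simp
    also have "\<dots> = ?h\<^sup>2 / (4 * \<alpha>) + ?d\<^sup>2 / \<alpha> - ?h * ?d / \<alpha>"
      using \<alpha> by (simp add: power2_eq_square field_simps)
    finally show ?thesis by simp
  qed
  have 8: "(norm (\<eta> k))\<^sup>2 \<le> 2 * ?h\<^sup>2 + 2 * ?d\<^sup>2"
  proof -
    have "(norm (\<eta> k))\<^sup>2 \<le> (?h + ?d)\<^sup>2" unfolding \<eta>d by (intro power_mono norm_triangle_ineq) auto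
    also have "\<dots> \<le> 2 * ?h\<^sup>2 + 2 * ?d\<^sup>2"
      using zero_le_power2[of "?h - ?d"] by (simp add: power2_eq_square algebra_simps)
    finally show ?thesis .
  qed
  have 9: "L\<Phi> * (norm (\<eta> k))\<^sup>2 \<le> 2 * L\<Phi> * ?h\<^sup>2 + 2 * L\<Phi> * ?d\<^sup>2"
    using mult_left_mono[OF 8, of L\<Phi>] L\<Phi> by (simp add: algebra_simps)
  have "\<Phi> (x (Suc k)) \<le> \<Phi> (x k + \<eta>h k) + (1 / (4 * \<alpha>) + lf\<^sup>2 * \<rho>1 + 2 * L\<Phi>) * ?h\<^sup>2
     + (1 / \<alpha> + 2 * L\<Phi> + 1 / (2 * \<rho>1)) * ?d\<^sup>2 + 2 * C0 * lR * tol k + \<rho>1 * ?e\<^sup>2"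
  proof -
    have h: "?d\<^sup>2 / (4 * \<rho>1) + ?d\<^sup>2 / (4 * \<rho>1) = 1 / (2 * \<rho>1) * ?d\<^sup>2" using \<rho> by (simp add: field_simps)
    have "\<Phi> (x (Suc k)) \<le> \<Phi> (x k + \<eta>h k) + (?h\<^sup>2 / (4 * \<alpha>) + lf\<^sup>2 * \<rho>1 * ?h\<^sup>2 + 2 * L\<Phi> * ?h\<^sup>2)
     + (?d\<^sup>2 / \<alpha> + 2 * L\<Phi> * ?d\<^sup>2 + (?d\<^sup>2 / (4 * \<rho>1) + ?d\<^sup>2 / (4 * \<rho>1))) + 2 * C0 * lR * tol k + \<rho>1 * ?e\<^sup>2"
      using next_x(2)[of k] 1 2 3 4 5 6 7 9 by linarith
    then show ?thesis unfolding h by (simp add: algebra_simps)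
  qed
  also have "(1 / \<alpha> + 2 * L\<Phi> + 1 / (2 * \<rho>1)) * ?d\<^sup>2 \<le> (1 / \<alpha> + 2 * L\<Phi> + 1 / (2 * \<rho>1)) * (C1\<^sup>2 * tol k)"
    using inexact(1)[of k] \<alpha> L\<Phi> \<rho> unfolding d_def by (intro mult_left_mono) auto
  finally show ?thesis by (simp add: algebra_simps)
qed

lemma step_norm_le: "(norm (\<eta> k))\<^sup>2 \<le> 2 * (norm (\<eta>h k))\<^sup>2 + 2 * C1\<^sup>2 * tol k"
proof -
  have "(norm (\<eta> k))\<^sup>2 \<le> (norm (\<eta>h k) + norm (\<eta> k - \<eta>h k))\<^sup>2"
    using norm_triangle_ineq[of "\<eta>h k" "\<eta> k - \<eta>h k"] by (intro power_mono) auto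
  also have "\<dots> \<le> 2 * (norm (\<eta>h k))\<^sup>2 + 2 * (norm (\<eta> k - \<eta>h k))\<^sup>2"
    using zero_le_power2[of "norm (\<eta>h k) - norm (\<eta> k - \<eta>h k)"] by (simp add: power2_eq_square algebra_simps)
  finally show ?thesis using inexact(1)[of k] by simp
qed

text \<open>The vector n is assembled from two normal parts: what the tangential projection removes
  from the gradient of F, and the residual of the optimality condition. Then gradient, subgradient
  and n add up to a gradient difference minus error and scaled step, all of which are small. The
  bound on n controls the curvature term of the subgradient.\<close>

lemma stationarity:
  obtains g n where "g \<in> convex_subdifferential R (x k + \<eta>h k)" "n \<in> normal_space M (x k)"
    "norm (nabla F (x k + \<eta>h k) + g + n) \<le> (lf + 1 / \<alpha>) * norm (\<eta>h k) + norm (err k)"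
    "norm g \<le> lR" "norm n \<le> 2 * Mf + 2 * Mu + 2 * lR"
proof -
  obtain g where g: "g \<in> convex_subdifferential R (x k + \<eta>h k)"
    "\<And>v. v \<in> tangent_space M (x k) \<Longrightarrow> inner (m k + (1 / \<alpha>) *\<^sub>R \<eta>h k + g) v = 0"
    using step_model_optimality[OF conv_R \<alpha>(1) subspace_tangent[OF xM] \<eta>h(1) \<eta>h_min] by blast
  define n where "n = - (nabla F (x k) - grad (x k)) - (m k + (1 / \<alpha>) *\<^sub>R \<eta>h k + g)"
  have n: "n \<in> normal_space M (x k)"
    unfolding normal_eq[OF xM]
  proof
    fix v assume "v \<in> tangent_space M (x k)"
    then show "inner n v = 0"
      unfolding n_def inner_diff_left inner_minus_left using g(2)[of v] grad_inner[of v k]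
      by (simp add: inner_add_left)
  qed
  have ng: "norm g \<le> lR" using convex_subgradient_norm_le[OF g(1) lip_R] .
  have a\<eta>: "norm ((1 / \<alpha>) *\<^sub>R \<eta>h k) \<le> Mu + lR"
    using \<eta>h_le[of k] \<alpha> by (simp add: field_simps)
  have "norm (grad (x k)) \<le> Mf"
    unfolding riem_grad_def using closest_point_subspace(5)[OF subspace_tangent[OF xM]] Mf[OF xM] order_trans by blast
  then have "norm (nabla F (x k) - grad (x k)) \<le> Mf + Mf"
    using Mf[OF xM[of k]] by (intro order_trans[OF norm_triangle_ineq4] add_mono)
  moreover have "norm (m k + (1 / \<alpha>) *\<^sub>R \<eta>h k + g) \<le> (Mu + (Mu + lR)) + lR"
    using m[of k] a\<eta> ng by (intro order_trans[OF norm_triangle_ineq] add_mono)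
  ultimately have "norm n \<le> (Mf + Mf) + ((Mu + (Mu + lR)) + lR)"
    unfolding n_def by (intro order_trans[OF norm_triangle_ineq4] add_mono) (simp_all add: norm_minus_commute)
  then have nn: "norm n \<le> 2 * Mf + 2 * Mu + 2 * lR" by simp
  have inU: "x k + \<eta>h k \<in> U" "x k \<in> U" using U_ball[OF xM \<eta>h] M_U xM by auto
  have "nabla F (x k + \<eta>h k) + g + n = (nabla F (x k + \<eta>h k) - nabla F (x k)) - (err k + (1 / \<alpha>) *\<^sub>R \<eta>h k)"
    unfolding n_def by simp
  also have "norm \<dots> \<le> lf * norm (\<eta>h k) + (norm (err k) + norm (\<eta>h k) / \<alpha>)"
  proof -
    have "norm (nabla F (x k + \<eta>h k) - nabla F (x k)) \<le> lf * norm (\<eta>h k)"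
      using lipschitz_onD[OF lip_dF inU] by (simp add: dist_norm)
    moreover have "norm (err k + (1 / \<alpha>) *\<^sub>R \<eta>h k) \<le> norm (err k) + norm (\<eta>h k) / \<alpha>"
      using norm_triangle_ineq[of "err k" "(1 / \<alpha>) *\<^sub>R \<eta>h k"] \<alpha> by simp
    ultimately show ?thesis by (rule order_trans[OF norm_triangle_ineq4 add_mono])
  qed
  also have "\<dots> = (lf + 1 / \<alpha>) * norm (\<eta>h k) + norm (err k)" by (simp add: algebra_simps)
  finally show thesis using that g(1) n ng nn by blast
qed

lemma subgradient_bound:
  obtains K where "K > 0"
    "\<And>k. \<exists>w\<in>regular_subdifferential (shifted_objective M \<Phi>) (x k, \<eta>h k). norm w \<le> K * (norm (\<eta>h k) + norm (err k))"
proof -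
  obtain C where C: "second_order_bound M I V \<psi> C"
    using second_order_bound_exists[OF compact_M cover] by blast
  then have C_nonneg: "C \<ge> 0" unfolding second_order_bound_def by blast
  define K0 where "K0 = C * C0 * (2 * Mf + 2 * Mu + 2 * lR)"
  have Mf0: "Mf \<ge> 0" using Mf[OF xM[of 0]] norm_ge_zero order_trans by blast
  have K0: "K0 \<ge> 0" unfolding K0_def using C_nonneg C0_pos Mf0 Mu lR_nonneg by simp
  define K where "K = 2 * (lf + 1 / \<alpha>) + 2 + K0"
  have a: "1 / \<alpha> > 0" using \<alpha> by simp
  show thesis
  proof (rule that[of K])
    have "2 * (lf + 1 / \<alpha>) \<ge> 0" using lf_nonneg a by simp
    then show "K > 0" unfolding K_def using K0 by linarith
    fix k
    obtain g n where gn: "g \<in> convex_subdifferential R (x k + \<eta>h k)" "n \<in> normal_space M (x k)"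
      "norm (nabla F (x k + \<eta>h k) + g + n) \<le> (lf + 1 / \<alpha>) * norm (\<eta>h k) + norm (err k)"
      "norm n \<le> 2 * Mf + 2 * Mu + 2 * lR"
      using stationarity by metis
    obtain w where w: "w \<in> regular_subdifferential (shifted_objective M \<Phi>) (x k, \<eta>h k)"
      "norm w \<le> 2 * norm (nabla F (x k + \<eta>h k) + g + n) + C * C0 * norm (\<eta>h k) * norm n"
      using regular_subgradient_shifted[OF C xM \<eta>h(1) gn(2) dF gn(1)] by blast
    have "C * C0 * norm (\<eta>h k) * norm n \<le> C * C0 * norm (\<eta>h k) * (2 * Mf + 2 * Mu + 2 * lR)"
      using gn(4) C_nonneg C0_pos by (intro mult_left_mono) auto
    also have "\<dots> = K0 * norm (\<eta>h k)" unfolding K0_def by simp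
    finally have "norm w \<le> 2 * ((lf + 1 / \<alpha>) * norm (\<eta>h k) + norm (err k)) + K0 * norm (\<eta>h k)"
      using w(2) gn(3) by simp
    also have "\<dots> = (2 * (lf + 1 / \<alpha>) + K0) * norm (\<eta>h k) + 2 * norm (err k)" by (simp add: algebra_simps)
    also have "\<dots> \<le> K * norm (\<eta>h k) + K * norm (err k)"
      unfolding K_def using lf_nonneg a K0 by (intro add_mono mult_right_mono) auto
    finally show "\<exists>w\<in>regular_subdifferential (shifted_objective M \<Phi>) (x k, \<eta>h k). norm w \<le> K * (norm (\<eta>h k) + norm (err k))"
      using w(1) by (auto simp: distrib_left)
  qed
qed

text \<open>The subgradients are bounded by lR and converge along a subsequence. The residuals tend
  to 0, so the normals converge as well, and the convex subdifferential and the normal bundle both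
  have closed graphs.\<close>

lemma limit_critical:
  assumes lim: "x \<longlonglongrightarrow> xs" and \<eta>0: "\<eta>h \<longlonglongrightarrow> 0" and e0: "(\<lambda>k. err k) \<longlonglongrightarrow> 0"
  shows "critical_point M F R xs"
proof -
  have "\<forall>k. \<exists>g n. g \<in> convex_subdifferential R (x k + \<eta>h k) \<and> n \<in> normal_space M (x k) \<and>
    norm (nabla F (x k + \<eta>h k) + g + n) \<le> (lf + 1 / \<alpha>) * norm (\<eta>h k) + norm (err k) \<and> norm g \<le> lR"
    using stationarity by metis
  then obtain g n where g: "\<And>k. g k \<in> convex_subdifferential R (x k + \<eta>h k)"
    and n: "\<And>k. n k \<in> normal_space M (x k)"
    and s: "\<And>k. norm (nabla F (x k + \<eta>h k) + g k + n k) \<le> (lf + 1 / \<alpha>) * norm (\<eta>h k) + norm (err k)"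
    and gb: "\<And>k. norm (g k) \<le> lR"
    by metis
  have "seq_compact (cball (0::'a) lR)" using compact_imp_seq_compact[OF compact_cball] .
  then obtain gs \<sigma> where \<sigma>: "strict_mono \<sigma>" "(g \<circ> \<sigma>) \<longlonglongrightarrow> gs"
    using gb unfolding seq_compact_def by (metis mem_cball_0)
  have zlim: "(\<lambda>k. x k + \<eta>h k) \<longlonglongrightarrow> xs" using tendsto_add[OF lim \<eta>0] by simp
  note sub = LIMSEQ_subseq_LIMSEQ[OF _ \<sigma>(1), unfolded o_def]
  have gl: "(\<lambda>k. g (\<sigma> k)) \<longlonglongrightarrow> gs" using \<sigma>(2) by (simp add: o_def)
  have Rc: "isCont R y" for y
    using lipschitz_on_continuous_on[OF lip_R] continuous_on_eq_continuous_at[OF open_UNIV] by blast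
  have "gs \<in> convex_subdifferential R xs"
    unfolding convex_subdifferential_def
  proof (intro CollectI allI)
    fix y
    have l: "(\<lambda>k. R (x (\<sigma> k) + \<eta>h (\<sigma> k)) + inner (g (\<sigma> k)) (y - (x (\<sigma> k) + \<eta>h (\<sigma> k)))) \<longlonglongrightarrow> R xs + inner gs (y - xs)"
      by (intro tendsto_intros isCont_tendsto_compose[OF Rc] gl sub[OF zlim])
    show "R xs + inner gs (y - xs) \<le> R y"
      by (rule tendsto_upperbound[OF l]) (use g in \<open>auto simp: convex_subdifferential_def\<close>)
  qed
  moreover have "- nabla F xs - gs \<in> normal_space M xs"
  proof (rule normal_space_limit[of "\<lambda>k. x (\<sigma> k)" xs "\<lambda>k. n (\<sigma> k)"])
    show "x (\<sigma> k) \<in> M" "n (\<sigma> k) \<in> normal_space M (x (\<sigma> k))" for k using xM n by auto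
    show "(\<lambda>k. x (\<sigma> k)) \<longlonglongrightarrow> xs" by (rule sub[OF lim])
    have "(\<lambda>k. (lf + 1 / \<alpha>) * norm (\<eta>h k) + norm (err k)) \<longlonglongrightarrow> (lf + 1 / \<alpha>) * norm (0::'a) + norm (0::'a)"
      by (intro tendsto_intros \<eta>0 e0)
    then have "(\<lambda>k. nabla F (x k + \<eta>h k) + g k + n k) \<longlonglongrightarrow> 0"
      by (intro Lim_null_comparison[OF always_eventually[OF allI[OF s]]]) simp
    note s0 = sub[OF this]
    have "isCont (nabla F) xs" using cont_dF continuous_on_eq_continuous_at[OF open_UNIV] by blast
    then have "(\<lambda>k. nabla F (x k + \<eta>h k)) \<longlonglongrightarrow> nabla F xs" using isCont_tendsto_compose zlim by blast
    note F0 = sub[OF this]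
    have "(\<lambda>k. (nabla F (x (\<sigma> k) + \<eta>h (\<sigma> k)) + g (\<sigma> k) + n (\<sigma> k)) - nabla F (x (\<sigma> k) + \<eta>h (\<sigma> k)) - g (\<sigma> k)) \<longlonglongrightarrow>
       0 - nabla F xs - gs" by (intro tendsto_diff s0 F0 gl)
    then show "(\<lambda>k. n (\<sigma> k)) \<longlonglongrightarrow> - nabla F xs - gs" by simp
  qed
  moreover have "xs \<in> M" using closed_sequentially[OF compact_imp_closed[OF compact_M]] xM lim by blast
  moreover have "0 = nabla F xs + gs + (- nabla F xs - gs)" by simp
  ultimately show ?thesis unfolding critical_point_def by blast
qed

end

section \<open>KL inequality and perturbed descent of the run\<close>

lemma concave_below_tangent:
  fixes \<phi> :: "real \<Rightarrow> real"
  assumes "concave_on {0..<\<epsilon>} \<phi>" "\<phi> differentiable (at a)" "0 < a" "a < \<epsilon>" "0 \<le> b" "b < \<epsilon>"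
  shows "\<phi> b \<le> \<phi> a + deriv \<phi> a * (b - a)"
proof -
  have "(\<phi> has_field_derivative deriv \<phi> a) (at a)"
    using assms(2) DERIV_deriv_iff_real_differentiable by blast
  then have "((\<lambda>t. - \<phi> t) has_field_derivative - deriv \<phi> a) (at a within {0..<\<epsilon>})"
    by (intro DERIV_minus) (rule DERIV_subset, auto)
  moreover have "convex_on {0..<\<epsilon>} (\<lambda>t. - \<phi> t)" using assms(1) unfolding concave_on_def .
  moreover have "a \<in> interior {0..<\<epsilon>}" using assms by (simp add: interior_atLeastLessThan)
  ultimately have "- \<phi> b - - \<phi> a \<ge> - deriv \<phi> a * (b - a)"
    using convex_on_imp_above_tangent[of "{0..<\<epsilon>}" "\<lambda>t. - \<phi> t" a b "- deriv \<phi> a"] assms by auto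
  then show ?thesis by simp
qed

lemma KL_with_subgradient:
  assumes KL: "KL_with \<phi> zb \<epsilon> \<rho> f" and "\<phi> z = ereal a" "\<phi> zb = ereal b"
    and "norm (z - zb) < \<rho>" "0 < a - b" "a - b < \<epsilon>" and v: "v \<in> limiting_subdifferential \<phi> z"
  shows "1 \<le> deriv f (a - b) * norm v"
proof -
  have d: "deriv f (a - b) > 0" using KL assms unfolding KL_with_def by auto
  have "1 \<le> ereal (deriv f (real_of_ereal (\<phi> z - \<phi> zb))) * dist_zero (limiting_subdifferential \<phi> z)"
    using KL assms unfolding KL_with_def by auto
  also have "\<dots> = ereal (deriv f (a - b)) * dist_zero (limiting_subdifferential \<phi> z)" using assms by simp
  also have "\<dots> \<le> ereal (deriv f (a - b)) * ereal (norm v)"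
    unfolding dist_zero_def using v d by (intro ereal_mult_left_mono INF_lower) auto
  finally show ?thesis by simp
qed

text \<open>Here \<kappa>2 is the constant after an index shift: the tolerance recursion uses (k +
  1) powr (- r) and a sum in place of a maximum. N \<ge> 1 avoids the base 0, where
  \<open>powr\<close> has value 0.\<close>

locale dissipative_run = surrogate_run M I V W \<psi> sel C0 F R U lf lR Mf Mu \<alpha> \<delta> CR L\<Phi> C1 \<rho>1 \<rho>2 x m \<eta> \<eta>h tol
  for M :: "'a::euclidean_space set" and I :: "'i set" and V W and \<psi> :: "'i \<Rightarrow> 'a \<Rightarrow> 'b::euclidean_space"
    and sel C0 and F R :: "'a \<Rightarrow> real" and U lf lR Mf Mu \<alpha> \<delta> CR L\<Phi> C1 \<rho>1 \<rho>2
    and x m \<eta> \<eta>h :: "nat \<Rightarrow> 'a" and tol :: "nat \<Rightarrow> real" +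
  fixes Er :: "nat \<Rightarrow> real" and ce \<mu> \<nu> \<kappa>1 \<kappa>2 r chie a c\<eta> Csh :: real and N :: nat
  defines "a \<equiv> 1 / (2 * \<alpha>) - lf / 2 - \<rho>2 / 2"
    and "c\<eta> \<equiv> 1 / (4 * \<alpha>) + lf\<^sup>2 * \<rho>1 + 2 * L\<Phi>"
    and "Csh \<equiv> C1\<^sup>2 / \<alpha> + 2 * L\<Phi> * C1\<^sup>2 + C1\<^sup>2 / (2 * \<rho>1) + 2 * C0 * lR"
  assumes pos: "ce > 0" "\<mu> > 0" "\<nu> > 0" "chie > \<rho>1" "\<kappa>1 \<ge> 0" "\<kappa>2 \<ge> 0" "r > 2" "a - c\<eta> > 0" "N \<ge> 1"
    and \<kappa>1: "\<kappa>1 * ((a - c\<eta>) * C1\<^sup>2 / 2 + Csh) < (a - c\<eta>) / 4 - \<nu> / (2 * \<rho>2) - chie * \<nu>"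
    and Er: "\<And>k. Er k \<ge> 0"
    and dissipation: "\<And>k. (norm (m k - riem_grad M F (x k)))\<^sup>2 + \<mu> * Er k \<le> ce * (Er k - Er (Suc k)) + \<nu> * (norm (\<eta> k))\<^sup>2"
    and tol_rec: "\<And>k. N \<le> k \<Longrightarrow> tol (Suc k) \<le> \<kappa>1 * (norm (\<eta> k))\<^sup>2 + \<kappa>2 * (real k + 1) powr (- r)"
begin

text \<open>The perturbed value solves (r - 1) * \<theta>0 = r / 2 and so matches T k powr \<theta>0
  with \<tau> k. Without perturbation it is 1/2, the smallest value that
  \<open>descent_sequence\<close> admits.\<close>

definition "\<theta>0 = (if \<kappa>2 = 0 then 1 / 2 else r / (2 * (r - 1)))"
definition "\<tau> k = (if \<kappa>2 = 0 then 0 else real k powr (- (r / 2)))"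
text \<open>An integral-type majorant of the tail sums of \<tau>: r / 2 - 1 comes from integrating
  the power, and 2 powr (r / 2) pays for comparing k with k + 1.\<close>

definition "\<Theta> k = (if \<kappa>2 = 0 then 0 else 2 powr (r / 2) / (r / 2 - 1) * real k powr (- (r / 2 - 1)))"
definition "s k = sqrt ((norm (err k))\<^sup>2 + Er k + (norm (\<eta>h k))\<^sup>2 + (norm (\<eta> k))\<^sup>2 + tol k)"

lemma \<theta>0: "1 / 2 \<le> \<theta>0" "\<theta>0 < 1" "\<kappa>2 \<noteq> 0 \<Longrightarrow> (r - 1) * \<theta>0 = r / 2"
  unfolding \<theta>0_def using pos by (auto simp: field_simps)

lemma unperturbed: "\<kappa>2 = 0 \<Longrightarrow> \<tau> k = 0" "\<kappa>2 = 0 \<Longrightarrow> \<Theta> k = 0"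
  unfolding \<tau>_def \<Theta>_def by auto

lemma s_sq: "(s k)\<^sup>2 = (norm (err k))\<^sup>2 + Er k + (norm (\<eta>h k))\<^sup>2 + (norm (\<eta> k))\<^sup>2 + tol k"
  unfolding s_def using Er tol by simp

lemma s_ge: "norm (err k) \<le> s k" "norm (\<eta>h k) \<le> s k" "norm (\<eta> k) \<le> s k" "Er k \<le> (s k)\<^sup>2" "tol k \<le> (s k)\<^sup>2" "s k \<ge> 0"
proof -
  show "Er k \<le> (s k)\<^sup>2" "tol k \<le> (s k)\<^sup>2" unfolding s_sq using Er tol by simp_all
  show "norm (err k) \<le> s k" "norm (\<eta>h k) \<le> s k" "norm (\<eta> k) \<le> s k"
    unfolding s_def using Er[of k] tol[of k] by (auto intro!: real_le_rsqrt)
  show "s k \<ge> 0" unfolding s_def using Er tol by simp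
qed

lemma bounded_below: obtains L where "\<And>y. y \<in> M \<Longrightarrow> L \<le> \<Phi> y"
proof -
  have "isCont F z" for z using dF[of z] has_derivative_continuous unfolding gderiv_def by blast
  then have "continuous_on M F" by (simp add: continuous_at_imp_continuous_on)
  moreover have "continuous_on M R"
    using lipschitz_on_continuous_on[OF lip_R] continuous_on_subset by blast
  ultimately have "continuous_on M \<Phi>" by (rule continuous_on_add)
  moreover have "M \<noteq> {}" using xM by blast
  ultimately obtain y where "y \<in> M" "\<And>z. z \<in> M \<Longrightarrow> \<Phi> y \<le> \<Phi> z"
    using continuous_attains_inf[OF compact_M, of \<Phi>] by blast
  then show thesis using that by blast
qed

lemma descent:
  obtains \<Phi>s D T q C CT where
    "descent_sequence x s D (\<lambda>k. \<Phi> (x k + \<eta>h k) - \<Phi>s) \<tau> \<Theta> T q C \<theta>0 N"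
    "CT \<ge> 0" "\<kappa>2 = 0 \<Longrightarrow> CT = 0" "\<And>k. T k = CT * real k powr (- (r - 1))"
    "\<And>k. N \<le> k \<Longrightarrow> \<Phi> (x k + \<eta>h k) - \<Phi>s \<le> D k + C * (s k)\<^sup>2"
    "(\<lambda>k. \<Phi> (x k)) \<longlonglongrightarrow> \<Phi>s" "(\<lambda>k. \<Phi> (x k + \<eta>h k) - \<Phi>s) \<longlonglongrightarrow> 0"
proof -
  have \<alpha>pos: "0 \<le> c\<eta>" "0 \<le> Csh" "0 \<le> a"
  proof -
    show "0 \<le> c\<eta>" unfolding c\<eta>_def using \<alpha> \<rho> L\<Phi> by simp
    then show "0 \<le> a" using pos by simp
    show "0 \<le> Csh" unfolding Csh_def using \<alpha> \<rho> L\<Phi> C0_pos lR_nonneg by simp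
  qed
  obtain q C c S where qC: "q > 0" "C > 0" "c > 0" "S > 0"
    and V1: "\<And>k. N \<le> k \<Longrightarrow> \<Phi> (x (Suc k)) + c * Er (Suc k) + S * tol (Suc k) +
        q * ((norm (err k))\<^sup>2 + Er k + (norm (\<eta>h k))\<^sup>2 + (norm (\<eta> k))\<^sup>2 + tol k)
      \<le> \<Phi> (x k) + c * Er k + S * tol k + S * (\<kappa>2 * (real k + 1) powr (- r))"
    and V2: "\<And>k. \<Phi> (x k + \<eta>h k) \<le> \<Phi> (x k) + c * Er k + S * tol k +
        C * ((norm (err k))\<^sup>2 + Er k + (norm (\<eta>h k))\<^sup>2 + (norm (\<eta> k))\<^sup>2 + tol k)"
    and V3: "\<And>k. N \<le> k \<Longrightarrow> \<Phi> (x (Suc k)) + c * Er (Suc k) + S * tol (Suc k) \<le> \<Phi> (x k + \<eta>h k) +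
        C * ((norm (err k))\<^sup>2 + Er k + (norm (\<eta>h k))\<^sup>2 + (norm (\<eta> k))\<^sup>2 + tol k)
        + S * (\<kappa>2 * (real k + 1) powr (- r))"
    \<comment> \<open>The parameter \<open>C1\<close> of \<open>lyapunov\<close> is instantiated
      with the square of the constant \<open>C1\<close> of the run.\<close>
    by (rule lyapunov[where \<phi> = "\<lambda>k. \<Phi> (x k)" and \<psi> = "\<lambda>k. \<Phi> (x k + \<eta>h k)" and en = "\<lambda>k. norm (err k)"
      and hn = "\<lambda>k. norm (\<eta>h k)" and tn = "\<lambda>k. norm (\<eta> k)" and tol = tol and Er = Er
      and b = "\<lambda>k. \<kappa>2 * (real k + 1) powr (- r)" and ?C1.0 = "C1\<^sup>2" and ?k0.0 = N, OF pos(1-3) \<rho> pos(4,5) \<alpha>pos(3,2,1) Er tol pos(8) \<kappa>1 zero_le_power2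
      surrogate_le[folded a_def] next_le[folded c\<eta>_def Csh_def] step_norm_le dissipation tol_rec], assumption)
      blast
  \<comment> \<open>Chosen so that the decrement of T, at least CT * (r - 1) * (k + 1) powr (- r),
    covers exactly the perturbation of the descent inequality.\<close>
  define CT where "CT = S * \<kappa>2 / (r - 1)"
  define T where "T k = CT * real k powr (- (r - 1))" for k :: nat
  define Vs where "Vs k = \<Phi> (x k) + c * Er k + S * tol k" for k
  define Y where "Y k = Vs k + T k" for k
  have CT: "CT \<ge> 0" "\<kappa>2 = 0 \<Longrightarrow> CT = 0" unfolding CT_def using qC pos by auto
  have T0: "T k \<ge> 0" for k unfolding T_def using CT by simp
  have Tdiff: "S * (\<kappa>2 * (real k + 1) powr (- r)) \<le> T k - T (Suc k)" if "N \<le> k" for k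
  proof -
    have "(r - 1) * (real k + 1) powr (- (r - 1) - 1) \<le> real k powr (- (r - 1)) - (real k + 1) powr (- (r - 1))"
      using that pos by (intro powr_decrement_ge) auto
    from mult_left_mono[OF this CT(1)]
    have "CT * ((r - 1) * (real k + 1) powr (- r)) \<le> T k - T (Suc k)"
      unfolding T_def by (simp add: algebra_simps)
    moreover have "CT * ((r - 1) * (real k + 1) powr (- r)) = S * (\<kappa>2 * (real k + 1) powr (- r))"
      unfolding CT_def using pos by simp
    ultimately show ?thesis by simp
  qed
  have Tlim: "T \<longlonglongrightarrow> 0"
  proof -
    have "(\<lambda>k. CT * real k powr (- (r - 1))) \<longlonglongrightarrow> CT * 0"
      using pos by (intro tendsto_intros tendsto_neg_powr filterlim_real_sequentially) auto
    then show ?thesis unfolding T_def by simp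
  qed
  have Ydesc: "Y (Suc k) + q * (s k)\<^sup>2 \<le> Y k" if "N \<le> k" for k
    using V1[OF that] Tdiff[OF that] unfolding Y_def Vs_def s_sq by simp
  have Ydec: "Y (Suc k) \<le> Y k" if "N \<le> k" for k
    using Ydesc[OF that] qC by (smt (verit) mult_nonneg_nonneg zero_le_power2)
  obtain L where L: "\<And>y. y \<in> M \<Longrightarrow> L \<le> \<Phi> y" using bounded_below by blast
  have YL: "L \<le> Y k" for k
  proof -
    have "c * Er k \<ge> 0" "S * tol k \<ge> 0" using qC Er tol by simp_all
    then show ?thesis using L[OF xM[of k]] T0[of k] unfolding Y_def Vs_def by linarith
  qed
  have "decseq (\<lambda>k. Y (k + N))" unfolding decseq_Suc_iff using Ydec by simp
  then obtain \<Phi>s where \<Phi>s: "(\<lambda>k. Y (k + N)) \<longlonglongrightarrow> \<Phi>s" "\<forall>k. \<Phi>s \<le> Y (k + N)"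
    using decseq_convergent[of "\<lambda>k. Y (k + N)" L] YL by metis
  have Ylim: "Y \<longlonglongrightarrow> \<Phi>s" using LIMSEQ_offset[OF \<Phi>s(1)] .
  define D where "D k = Y k - \<Phi>s" for k
  have D0: "D k \<ge> 0" if "N \<le> k" for k
    using \<Phi>s(2)[rule_format, of "k - N"] that unfolding D_def by simp
  have Dlim: "D \<longlonglongrightarrow> 0"
    using tendsto_diff[OF Ylim tendsto_const[of \<Phi>s]] unfolding D_def by simp
  \<comment> \<open>One constant for the three uses of C in \<open>descent_sequence\<close>:
    \<open>upper\<close>, \<open>steps\<close> and \<open>T_\<tau>\<close>.\<close>
  define Cm where "Cm = C + CR + CT powr \<theta>0"
  have "CT powr \<theta>0 \<ge> 0" by simp
  then have Cm: "Cm > 0" "C \<le> Cm" "CR \<le> Cm" "CT powr \<theta>0 \<le> Cm"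
    unfolding Cm_def using qC CR by linarith+
  have upper: "D (Suc k) \<le> \<Phi> (x k + \<eta>h k) - \<Phi>s + Cm * (s k)\<^sup>2 + T k" if "N \<le> k" for k
  proof -
    have "C * (s k)\<^sup>2 \<le> Cm * (s k)\<^sup>2" using Cm by (intro mult_right_mono) auto
    then show ?thesis
      using V3[OF that] Tdiff[OF that] unfolding D_def Y_def Vs_def s_sq by simp
  qed
  have ds: "descent_sequence x s D (\<lambda>k. \<Phi> (x k + \<eta>h k) - \<Phi>s) \<tau> \<Theta> T q Cm \<theta>0 N"
  proof (unfold_locales)
    show "0 < q" "0 < Cm" "1 / 2 \<le> \<theta>0" "\<theta>0 < 1" using qC Cm \<theta>0 by auto
    show "0 \<le> s k" "0 \<le> T k" for k using s_ge T0 by auto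
    show "0 \<le> \<tau> k" "0 \<le> \<Theta> k" for k unfolding \<tau>_def \<Theta>_def using pos by auto
    show "D \<longlonglongrightarrow> 0" by (rule Dlim)
    show "\<Theta> \<longlonglongrightarrow> 0"
    proof (cases "\<kappa>2 = 0")
      case False
      have "(\<lambda>k. 2 powr (r / 2) / (r / 2 - 1) * real k powr (- (r / 2 - 1))) \<longlonglongrightarrow> 2 powr (r / 2) / (r / 2 - 1) * 0"
        using pos by (intro tendsto_mult tendsto_const tendsto_neg_powr filterlim_real_sequentially) auto
      then show ?thesis unfolding \<Theta>_def using False by simp
    next
      case True
      then have "\<Theta> = (\<lambda>_. 0)" using unperturbed(2) by blast
      then show ?thesis by (metis tendsto_const)
    qed
    fix k assume k: "N \<le> k"
    show "0 \<le> D k" by (rule D0[OF k])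
    show "D (Suc k) + q * (s k)\<^sup>2 \<le> D k" using Ydesc[OF k] unfolding D_def by simp
    show "D (Suc k) \<le> \<Phi> (x k + \<eta>h k) - \<Phi>s + Cm * (s k)\<^sup>2 + T k" by (rule upper[OF k])
    show "norm (x (Suc k) - x k) \<le> Cm * s k"
      using next_x(1)[of k] mult_mono[OF Cm(3) s_ge(3)[of k]] Cm by simp
    have k1: "real k \<ge> 1" using k pos by simp
    show "T k powr \<theta>0 \<le> Cm * \<tau> k"
    proof (cases "\<kappa>2 = 0")
      case True then show ?thesis unfolding T_def \<tau>_def using CT by simp
    next
      case False
      have "T k powr \<theta>0 = CT powr \<theta>0 * real k powr (- ((r - 1) * \<theta>0))"
        unfolding T_def using CT k1 by (simp add: powr_mult powr_powr algebra_simps)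
      also have "\<dots> \<le> Cm * \<tau> k"
        unfolding \<theta>0(3)[OF False] \<tau>_def using False Cm by (simp add: mult_right_mono)
      finally show ?thesis .
    qed
    show "\<tau> k \<le> \<Theta> k - \<Theta> (Suc k)"
    proof (cases "\<kappa>2 = 0")
      case False
      let ?\<sigma> = "r / 2 - 1"
      have \<sigma>: "?\<sigma> > 0" using pos by simp
      have "real k powr (- (r / 2)) \<le> 2 powr (r / 2) * (real k + 1) powr (- (r / 2))"
        using pos k1 by (intro powr_Suc_ge) auto
      also have "\<dots> = 2 powr (r / 2) / ?\<sigma> * (?\<sigma> * (real k + 1) powr (- ?\<sigma> - 1))" using \<sigma> by simp
      also have "\<dots> \<le> 2 powr (r / 2) / ?\<sigma> * (real k powr (- ?\<sigma>) - (real k + 1) powr (- ?\<sigma>))"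
        using \<sigma> k1 by (intro mult_left_mono powr_decrement_ge) auto
      finally show ?thesis unfolding \<tau>_def \<Theta>_def using False by (simp add: algebra_simps)
    next
      case True
      show ?thesis using unperturbed[OF True] by simp
    qed
  qed
  have slim: "s \<longlonglongrightarrow> 0" by (rule descent_sequence.s_lim[OF ds])
  have s2: "(\<lambda>k. (s k)\<^sup>2) \<longlonglongrightarrow> 0" using tendsto_power[OF slim, of 2] by simp
  have gD: "\<Phi> (x k + \<eta>h k) - \<Phi>s \<le> D k + Cm * (s k)\<^sup>2" for k
  proof -
    have "C * (s k)\<^sup>2 \<le> Cm * (s k)\<^sup>2" using Cm by (intro mult_right_mono) auto
    then show ?thesis using V2[of k] T0[of k] unfolding D_def Y_def Vs_def s_sq by simp
  qed
  have Vlim: "Vs \<longlonglongrightarrow> \<Phi>s"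
    using tendsto_diff[OF Ylim Tlim] unfolding Y_def by simp
  have \<Phi>lim: "(\<lambda>k. \<Phi> (x k)) \<longlonglongrightarrow> \<Phi>s"
  proof (rule tendsto_sandwich[of "\<lambda>k. Vs k - (c + S) * (s k)\<^sup>2" _ _ Vs])
    have "(\<lambda>k. Vs k - (c + S) * (s k)\<^sup>2) \<longlonglongrightarrow> \<Phi>s - (c + S) * 0" by (intro tendsto_intros Vlim s2)
    then show "(\<lambda>k. Vs k - (c + S) * (s k)\<^sup>2) \<longlonglongrightarrow> \<Phi>s" by simp
    show "\<forall>\<^sub>F k in sequentially. Vs k - (c + S) * (s k)\<^sup>2 \<le> \<Phi> (x k)"
    proof (rule always_eventually, rule allI)
      fix k
      have "c * Er k \<le> c * (s k)\<^sup>2" "S * tol k \<le> S * (s k)\<^sup>2" using s_ge qC by simp_all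
      then show "Vs k - (c + S) * (s k)\<^sup>2 \<le> \<Phi> (x k)" unfolding Vs_def by (simp add: algebra_simps)
    qed
    show "\<forall>\<^sub>F k in sequentially. \<Phi> (x k) \<le> Vs k"
      unfolding Vs_def using qC Er tol by (intro always_eventually) simp
  qed (rule Vlim)
  have glim: "(\<lambda>k. \<Phi> (x k + \<eta>h k) - \<Phi>s) \<longlonglongrightarrow> 0"
  proof (rule tendsto_sandwich[of "\<lambda>k. - (Cm * (s k)\<^sup>2) - T k" _ _ "\<lambda>k. D k + Cm * (s k)\<^sup>2"])
    have "(\<lambda>k. - (Cm * (s k)\<^sup>2) - T k) \<longlonglongrightarrow> - (Cm * 0) - 0" by (intro tendsto_intros s2 Tlim)
    then show "(\<lambda>k. - (Cm * (s k)\<^sup>2) - T k) \<longlonglongrightarrow> 0" by simp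
    have "(\<lambda>k. D k + Cm * (s k)\<^sup>2) \<longlonglongrightarrow> 0 + Cm * 0" by (intro tendsto_intros s2 Dlim)
    then show "(\<lambda>k. D k + Cm * (s k)\<^sup>2) \<longlonglongrightarrow> 0" by simp
    show "\<forall>\<^sub>F k in sequentially. \<Phi> (x k + \<eta>h k) - \<Phi>s \<le> D k + Cm * (s k)\<^sup>2" using gD by simp
    show "\<forall>\<^sub>F k in sequentially. - (Cm * (s k)\<^sup>2) - T k \<le> \<Phi> (x k + \<eta>h k) - \<Phi>s"
      using eventually_ge_at_top[of N]
    proof eventually_elim
      case (elim k)
      then show ?case using upper[OF elim] D0[of "Suc k"] by simp
    qed
  qed
  show thesis
    by (rule that[OF ds CT]) (use T_def gD \<Phi>lim glim in auto)
qed

end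

section \<open>Convergence and rates\<close>

lemma scaled_powr_mono:
  fixes k c :: real
  assumes "k \<ge> 1" "p \<le> q" "c \<ge> 0"
  shows "c * k powr p \<le> c * k powr q"
  using assms by (intro mult_left_mono powr_mono) auto

context dissipative_run
begin

abbreviation "\<Phi>0 \<equiv> shifted_objective M \<Phi>"

lemma \<Phi>0_run: "\<Phi>0 (x k, \<eta>h k) = ereal (\<Phi> (x k + \<eta>h k))"
  using xM \<eta>h(1) by (simp add: shifted_objective_def tangent_bundle_def)

lemma \<Phi>0_zero: "y \<in> M \<Longrightarrow> \<Phi>0 (y, 0) = ereal (\<Phi> y)"
  using subspace_0[OF subspace_tangent] by (simp add: shifted_objective_def tangent_bundle_def)

text \<open>The radius is halved because both components of the pair must be close to (y, 0). The
  factor 2 * K arises since exact step and error are each at most s k.\<close>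

lemma KL_run:
  assumes K: "K > 0" "\<And>k. \<exists>w\<in>regular_subdifferential \<Phi>0 (x k, \<eta>h k). norm w \<le> K * (norm (\<eta>h k) + norm (err k))"
    and KL: "KL_with \<Phi>0 (y, 0) \<epsilon> \<rho> f" and y: "y \<in> M" "\<Phi> y = \<Phi>s"
    and near: "norm (x k - y) < \<rho> / 2" "s k < \<rho> / 2"
    and g: "0 < \<Phi> (x k + \<eta>h k) - \<Phi>s" "\<Phi> (x k + \<eta>h k) - \<Phi>s < \<epsilon>"
  shows "1 \<le> deriv f (\<Phi> (x k + \<eta>h k) - \<Phi>s) * (2 * K * s k)"
proof -
  obtain w where w: "w \<in> regular_subdifferential \<Phi>0 (x k, \<eta>h k)" "norm w \<le> K * (norm (\<eta>h k) + norm (err k))"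
    using K(2) by blast
  have "norm w \<le> K * (s k + s k)"
    using s_ge(1,2)[of k] K(1) by (intro order_trans[OF w(2)] mult_left_mono) auto
  then have nw: "norm w \<le> 2 * K * s k" by simp
  have "norm ((x k, \<eta>h k) - (y, 0)) \<le> norm (x k - y) + norm (\<eta>h k)"
    by (simp add: norm_Pair sqrt_sum_squares_le_sum)
  then have "norm ((x k, \<eta>h k) - (y, 0)) < \<rho>" using near s_ge(2)[of k] by simp
  then have 1: "1 \<le> deriv f (\<Phi> (x k + \<eta>h k) - \<Phi>s) * norm w"
    using KL_with_subgradient[OF KL \<Phi>0_run[of k] \<Phi>0_zero[OF y(1)]] g y regular_subset_limiting w(1) by blast
  have "deriv f (\<Phi> (x k + \<eta>h k) - \<Phi>s) > 0" using KL g unfolding KL_with_def by auto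
  with 1 show ?thesis using nw by (meson less_imp_le mult_left_mono order_trans)
qed

text \<open>KL is invoked at (xb, 0) for a cluster point xb of the iterates, which exists by
  compactness. Value and stationarity there follow by passing to the limit, as steps and
  subgradients tend to 0. This gives convergence to xb, and the KL exponent at the same pair then
  yields the rates.\<close>

lemma run_conclusion:
  assumes KL: "\<And>y v. (y, v) \<in> tangent_bundle M \<Longrightarrow> norm v \<le> bnd \<Longrightarrow>
      \<Phi>0 (y, v) = lim (\<lambda>k. \<Phi>0 (x k, \<eta>h k)) \<Longrightarrow> 0 \<in> limiting_subdifferential \<Phi>0 (y, v) \<Longrightarrow> KL_property \<Phi>0 (y, v)"
    and bnd: "bnd \<ge> 0"
  shows "\<bar>lim (\<lambda>k. \<Phi>0 (x k, \<eta>h k))\<bar> \<noteq> \<infinity> \<and> (\<lambda>k. \<Phi>0 (x k, \<eta>h k)) \<longlonglongrightarrow> lim (\<lambda>k. \<Phi>0 (x k, \<eta>h k)) \<and>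
    (\<exists>xs. x \<longlonglongrightarrow> xs \<and> critical_point M F R xs \<and>
      (\<forall>\<theta>. KL_exponent \<Phi>0 (xs, 0) \<theta> \<longrightarrow>
        (\<kappa>2 = 0 \<and> \<theta> \<le> 1/2 \<longrightarrow>
          (\<exists>\<rho>. 0 < \<rho> \<and> \<rho> < 1 \<and>
             (\<lambda>k. real_of_ereal \<bar>\<Phi>0 (x k, \<eta>h k) - \<Phi>0 (xs, 0)\<bar>) \<in> O(\<lambda>k. \<rho> ^ k) \<and>
             (\<lambda>k. norm (\<eta>h k) + norm (\<eta> k)) \<in> O(\<lambda>k. \<rho> ^ k) \<and>
             (\<lambda>k. norm (x k - xs)) \<in> O(\<lambda>k. \<rho> ^ k))) \<and>
        (let \<theta>b = (if \<kappa>2 > 0 then max \<theta> (r / (2 * (r - 1))) else \<theta>);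
             \<kappa> = (if \<kappa>2 = 0 then (1 - \<theta>) / (2 * \<theta> - 1)
                  else Min {(1 - \<theta>b) / (2 * \<theta>b - 1), r * (1 - \<theta>b) / (2 * \<theta>b), (r - 2) / 2})
         in 1/2 < \<theta>b \<and> \<theta>b < 1 \<longrightarrow>
             (\<lambda>k. real_of_ereal \<bar>\<Phi>0 (x k, \<eta>h k) - \<Phi>0 (xs, 0)\<bar>)
               \<in> O(\<lambda>k. real k powr (- 1 / (2 * \<theta>b - 1)) + real k powr (- r / (2 * \<theta>b))) \<and>
             (\<lambda>k. norm (\<eta>h k) + norm (\<eta> k))
               \<in> O(\<lambda>k. real k powr (- 1 / (4 * \<theta>b - 2)) + real k powr (- r / (4 * \<theta>b))) \<and>
             (\<lambda>k. norm (x k - xs)) \<in> O(\<lambda>k. real k powr (- \<kappa>)))))"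
proof -
  obtain \<Phi>s D T q C CT where ds: "descent_sequence x s D (\<lambda>k. \<Phi> (x k + \<eta>h k) - \<Phi>s) \<tau> \<Theta> T q C \<theta>0 N"
    and CT: "CT \<ge> 0" "\<kappa>2 = 0 \<Longrightarrow> CT = 0" and T: "\<And>k. T k = CT * real k powr (- (r - 1))"
    and gD: "\<And>k. N \<le> k \<Longrightarrow> \<Phi> (x k + \<eta>h k) - \<Phi>s \<le> D k + C * (s k)\<^sup>2"
    and \<Phi>lim: "(\<lambda>k. \<Phi> (x k)) \<longlonglongrightarrow> \<Phi>s" and glim: "(\<lambda>k. \<Phi> (x k + \<eta>h k) - \<Phi>s) \<longlonglongrightarrow> 0"
    by (rule descent) blast
  interpret ds: descent_sequence x s D "\<lambda>k. \<Phi> (x k + \<eta>h k) - \<Phi>s" \<tau> \<Theta> T q C \<theta>0 N by (rule ds)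
  define g where "g k = \<Phi> (x k + \<eta>h k) - \<Phi>s" for k
  have slim: "s \<longlonglongrightarrow> 0" by (rule ds.s_lim)
  have \<eta>0: "\<eta>h \<longlonglongrightarrow> 0"
    by (rule Lim_null_comparison[OF always_eventually slim]) (use s_ge in blast)
  have e0: "(\<lambda>k. err k) \<longlonglongrightarrow> 0"
    by (rule Lim_null_comparison[OF always_eventually slim]) (use s_ge in blast)
  have "(\<lambda>k. \<Phi> (x k + \<eta>h k)) \<longlonglongrightarrow> \<Phi>s" using tendsto_add[OF glim tendsto_const[of \<Phi>s]] by simp
  then have \<Phi>0lim: "(\<lambda>k. \<Phi>0 (x k, \<eta>h k)) \<longlonglongrightarrow> ereal \<Phi>s" unfolding \<Phi>0_run by simp
  then have lim: "lim (\<lambda>k. \<Phi>0 (x k, \<eta>h k)) = ereal \<Phi>s" by (rule limI)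
  obtain K where K: "K > 0"
    "\<And>k. \<exists>w\<in>regular_subdifferential \<Phi>0 (x k, \<eta>h k). norm w \<le> K * (norm (\<eta>h k) + norm (err k))"
    using subgradient_bound by blast
  then obtain w where w: "\<And>k. w k \<in> regular_subdifferential \<Phi>0 (x k, \<eta>h k)"
    "\<And>k. norm (w k) \<le> K * (norm (\<eta>h k) + norm (err k))" by metis
  have "(\<lambda>k. K * (norm (\<eta>h k) + norm (err k))) \<longlonglongrightarrow> K * (norm (0::'a) + norm (0::'a))"
    by (intro tendsto_intros \<eta>0 e0)
  then have w0: "w \<longlonglongrightarrow> 0"
    by (intro Lim_null_comparison[OF always_eventually[OF allI[OF w(2)]]]) simp
  have seqM: "seq_compact M" using compact_imp_seq_compact[OF compact_M] .
  then obtain xb \<sigma> where xb: "xb \<in> M" and \<sigma>: "strict_mono \<sigma>" "(x \<circ> \<sigma>) \<longlonglongrightarrow> xb"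
    using xM unfolding seq_compact_def by metis
  have R_cont: "isCont R y" for y
    using lipschitz_on_continuous_on[OF lip_R] continuous_on_eq_continuous_at[OF open_UNIV] by blast
  have F_cont: "isCont F y" for y using dF[of y] has_derivative_continuous unfolding gderiv_def by blast
  have \<Phi>_limit: "\<Phi> y = \<Phi>s" if "(\<lambda>k. x (\<sigma>' k)) \<longlonglongrightarrow> y" "strict_mono \<sigma>'" for y \<sigma>'
  proof -
    have "(\<lambda>k. \<Phi> (x (\<sigma>' k))) \<longlonglongrightarrow> \<Phi> y"
      by (intro tendsto_add isCont_tendsto_compose[OF F_cont] isCont_tendsto_compose[OF R_cont] that)
    moreover have "(\<lambda>k. \<Phi> (x (\<sigma>' k))) \<longlonglongrightarrow> \<Phi>s"
      using LIMSEQ_subseq_LIMSEQ[OF \<Phi>lim that(2)] by (simp add: o_def)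
    ultimately show ?thesis by (rule LIMSEQ_unique)
  qed
  have \<sigma>': "(\<lambda>k. x (\<sigma> k)) \<longlonglongrightarrow> xb" using \<sigma>(2) by (simp add: o_def)
  have \<Phi>xb: "\<Phi> xb = \<Phi>s" by (rule \<Phi>_limit[OF \<sigma>' \<sigma>(1)])
  have sub0: "0 \<in> limiting_subdifferential \<Phi>0 (xb, 0)"
  proof -
    note sub = LIMSEQ_subseq_LIMSEQ[OF _ \<sigma>(1), unfolded o_def]
    have "(\<lambda>k. (x (\<sigma> k), \<eta>h (\<sigma> k))) \<longlonglongrightarrow> (xb, 0)" by (intro tendsto_Pair \<sigma>' sub[OF \<eta>0])
    moreover have "(\<lambda>k. \<Phi>0 (x (\<sigma> k), \<eta>h (\<sigma> k))) \<longlonglongrightarrow> \<Phi>0 (xb, 0)"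
      unfolding \<Phi>0_zero[OF xb] \<Phi>xb by (rule sub[OF \<Phi>0lim])
    moreover have "(\<lambda>k. w (\<sigma> k)) \<longlonglongrightarrow> 0" by (rule sub[OF w0])
    moreover have "\<forall>k. w (\<sigma> k) \<in> regular_subdifferential \<Phi>0 (x (\<sigma> k), \<eta>h (\<sigma> k))" using w(1) by blast
    ultimately have "\<exists>y w. y \<longlonglongrightarrow> (xb, 0) \<and> (\<lambda>i. \<Phi>0 (y i)) \<longlonglongrightarrow> \<Phi>0 (xb, 0) \<and>
        (\<forall>i. w i \<in> regular_subdifferential \<Phi>0 (y i)) \<and> w \<longlonglongrightarrow> 0"
      by (intro exI[where x = "\<lambda>k. (x (\<sigma> k), \<eta>h (\<sigma> k))"] exI[where x = "\<lambda>k. w (\<sigma> k)"] conjI)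
    moreover have "\<bar>\<Phi>0 (xb, 0)\<bar> \<noteq> \<infinity>" unfolding \<Phi>0_zero[OF xb] by simp
    ultimately show ?thesis unfolding limiting_subdifferential_def by (intro CollectI conjI)
  qed
  have "KL_property \<Phi>0 (xb, 0)"
    using sub0 bnd \<Phi>0_zero[OF xb] \<Phi>xb lim xb subspace_0[OF subspace_tangent[OF xb]]
    by (intro KL) (auto simp: tangent_bundle_def)
  then obtain \<epsilon> \<rho> f where KLw: "KL_with \<Phi>0 (xb, 0) \<epsilon> \<rho> f" unfolding KL_property_def by blast
  have f: "\<epsilon> > 0" "\<rho> > 0" "continuous_on {0..<\<epsilon>} f" "concave_on {0..<\<epsilon>} f" "f 0 = 0"
    "\<And>t. 0 \<le> t \<Longrightarrow> t < \<epsilon> \<Longrightarrow> f t \<ge> 0" "\<And>t. 0 < t \<Longrightarrow> t < \<epsilon> \<Longrightarrow> f differentiable (at t)"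
    "\<And>t. 0 < t \<Longrightarrow> t < \<epsilon> \<Longrightarrow> deriv f t > 0"
    using KLw unfolding KL_with_def by auto
  have xlim: "x \<longlonglongrightarrow> xb"
  proof (rule ds.KL_convergence[where \<phi> = f and h = "deriv f" and \<rho> = "\<rho> / 2" and C' = "2 * K" and \<epsilon> = \<epsilon>])
    show "f b \<le> f a + deriv f a * (b - a)" if "0 < a" "a < \<epsilon>" "0 \<le> b" "b < \<epsilon>" for a b
      using concave_below_tangent f that by blast
    show "1 \<le> deriv f (\<Phi> (x k + \<eta>h k) - \<Phi>s) * (2 * K * s k)"
      if "norm (x k - xb) < \<rho> / 2" "s k < \<rho> / 2" "0 < \<Phi> (x k + \<eta>h k) - \<Phi>s" "\<Phi> (x k + \<eta>h k) - \<Phi>s < \<epsilon>" for k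
      by (rule KL_run[OF K KLw xb \<Phi>xb that])
    show "\<exists>k\<ge>n. norm (x k - xb) < e" if e: "e > 0" for e n
    proof -
      obtain n' where "\<And>k. k \<ge> n' \<Longrightarrow> dist (x (\<sigma> k)) xb < e"
        using \<sigma>' e unfolding lim_sequentially by blast
      then have "norm (x (\<sigma> (max n n')) - xb) < e" by (simp add: dist_norm)
      moreover have "\<sigma> (max n n') \<ge> n" using seq_suble[OF \<sigma>(1), of "max n n'"] by linarith
      ultimately show ?thesis by blast
    qed
  qed (use f K glim in auto)
  have crit: "critical_point M F R xb" by (rule limit_critical[OF xlim \<eta>0 e0])
  have gabs: "real_of_ereal \<bar>\<Phi>0 (x k, \<eta>h k) - \<Phi>0 (xb, 0)\<bar> = \<bar>g k\<bar>" for k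
    unfolding \<Phi>0_run \<Phi>0_zero[OF xb] \<Phi>xb g_def by simp
  have sD: "(s k)\<^sup>2 \<le> D k / q" if "N \<le> k" for k
    using ds.descent[OF that] ds.D[of "Suc k"] that ds.q by (simp add: field_simps)
  \<comment> \<open>The surrogate gap may be negative. Its lower bound uses \<open>upper\<close> and
    the nonnegativity of D (Suc k).\<close>
  have gle: "\<bar>g k\<bar> \<le> (1 + C / q) * D k + T k" if "N \<le> k" for k
  proof -
    have "C * (s k)\<^sup>2 \<le> C / q * D k" using mult_left_mono[OF sD[OF that], of C] ds.C by simp
    moreover have "g k \<le> D k + C * (s k)\<^sup>2" unfolding g_def by (rule gD[OF that])
    moreover have "- g k \<le> C * (s k)\<^sup>2 + T k" unfolding g_def
      using ds.upper[OF that] ds.D[of "Suc k"] that by simp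
    ultimately show ?thesis using ds.D[OF that] ds.T[of k] by (simp add: algebra_simps)
  qed
  have sqD: "s k \<le> sqrt (D k / q)" if "N \<le> k" for k by (rule ds.s_le[OF that])
  have Ddec: "D (Suc k) \<le> D k" if "N \<le> k" for k
    using ds.descent[OF that] ds.q by (smt (verit) mult_nonneg_nonneg zero_le_power2)
  have rates: "\<exists>K' N1. K' > 0 \<and> N \<le> N1 \<and>
      (\<forall>k\<ge>N1. D (Suc k) powr max \<theta> \<theta>0 \<le> K' * (s k + \<tau> k) \<and>
       norm (x k - xb) \<le> K' * (s k + \<Theta> k + D (Suc k) powr (1 - max \<theta> \<theta>0)))"
    if exps: "KL_exponent \<Phi>0 (xb, 0) \<theta>" for \<theta>
  proof -
    obtain \<epsilon> \<rho> c where \<theta>: "0 \<le> \<theta>" "\<theta> < 1" "c > 0" and KLe: "KL_with \<Phi>0 (xb, 0) \<epsilon> \<rho> (\<lambda>s. c * s powr (1 - \<theta>))"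
      using exps unfolding KL_exponent_def by blast
    have \<epsilon>: "\<epsilon> > 0" "\<rho> > 0" using KLe unfolding KL_with_def by auto
    have der: "deriv (\<lambda>s. c * s powr (1 - \<theta>)) t = c * (1 - \<theta>) * t powr (- \<theta>)" if "t > 0" for t
    proof (rule DERIV_imp_deriv)
      show "((\<lambda>s. c * s powr (1 - \<theta>)) has_real_derivative c * (1 - \<theta>) * t powr (- \<theta>)) (at t)"
        using DERIV_cmult[OF has_real_derivative_powr[OF that, of "1 - \<theta>"], of c] by (simp add: mult.assoc)
    qed
    show ?thesis
    proof (rule ds.KL_rates[OF xlim, where c = "c * (1 - \<theta>)" and \<theta> = \<theta> and \<rho> = "\<rho> / 2" and \<epsilon> = \<epsilon> and C' = "2 * K"])
      show "1 \<le> c * (1 - \<theta>) * (\<Phi> (x k + \<eta>h k) - \<Phi>s) powr (- \<theta>) * (2 * K * s k)"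
        if "norm (x k - xb) < \<rho> / 2" "s k < \<rho> / 2" "0 < \<Phi> (x k + \<eta>h k) - \<Phi>s" "\<Phi> (x k + \<eta>h k) - \<Phi>s < \<epsilon>" for k
        using KL_run[OF K KLe xb \<Phi>xb that] unfolding der[OF that(3)] .
    qed (use \<theta> \<epsilon> K glim in auto)
  qed
  have conclusion_geometric: "\<exists>\<rho>. 0 < \<rho> \<and> \<rho> < 1 \<and>
             (\<lambda>k. \<bar>g k\<bar>) \<in> O(\<lambda>k. \<rho> ^ k) \<and> (\<lambda>k. norm (\<eta>h k) + norm (\<eta> k)) \<in> O(\<lambda>k. \<rho> ^ k) \<and>
             (\<lambda>k. norm (x k - xb)) \<in> O(\<lambda>k. \<rho> ^ k)"
    if exps: "KL_exponent \<Phi>0 (xb, 0) \<theta>" and \<kappa>0: "\<kappa>2 = 0" and \<theta>: "\<theta> \<le> 1 / 2" for \<theta>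
  proof -
    have [simp]: "\<theta>0 = 1 / 2" "\<tau> k = 0" "\<Theta> k = 0" "T k = 0" for k
      unfolding \<theta>0_def \<tau>_def \<Theta>_def T using \<kappa>0 CT by auto
    have m: "max \<theta> \<theta>0 = 1 / 2" using \<theta> by simp
    obtain K' N1 where K': "K' > 0" "N \<le> N1"
      and r1: "\<And>k. N1 \<le> k \<Longrightarrow> D (Suc k) powr (1 / 2) \<le> K' * s k"
      and r2: "\<And>k. N1 \<le> k \<Longrightarrow> norm (x k - xb) \<le> K' * (s k + D (Suc k) powr (1 / 2))"
      using rates[OF exps] unfolding m by auto
    \<comment> \<open>Squaring \<open>r1\<close> and inserting the descent gives D (Suc k) \<le> L *
      (D k - D (Suc k)), hence contraction by L / (1 + L).\<close>
    define L where "L = K'\<^sup>2 / q"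
    have L: "L > 0" unfolding L_def using K' ds.q by simp
    define \<beta> where "\<beta> = L / (1 + L)"
    have \<beta>: "0 < \<beta>" "\<beta> < 1" unfolding \<beta>_def using L by auto
    have "D (Suc k) \<le> \<beta> * D k" if "N1 \<le> k" for k
    proof -
      have kN: "N \<le> k" using that K' by simp
      have "sqrt (D (Suc k)) \<le> K' * s k" using r1[OF that] ds.D[of "Suc k"] kN by (simp add: powr_half_sqrt)
      then have "D (Suc k) \<le> (K' * s k)\<^sup>2" by (rule sqrt_le_D)
      also have "\<dots> = K'\<^sup>2 * (s k)\<^sup>2" by (rule power_mult_distrib)
      also have "\<dots> \<le> K'\<^sup>2 * ((D k - D (Suc k)) / q)"
        using ds.descent[OF kN] ds.q by (intro mult_left_mono) (auto simp: field_simps)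
      also have "\<dots> = L * (D k - D (Suc k))" unfolding L_def by simp
      finally show ?thesis unfolding \<beta>_def using L by (simp add: field_simps)
    qed
    then obtain A where A: "A > 0" "\<And>k. N1 \<le> k \<Longrightarrow> D k \<le> A * \<beta> ^ k"
      using geometric_rate[of \<beta> N1 D] \<beta> ds.D K'(2) by (metis order_trans)
    \<comment> \<open>Steps and distances are controlled by the square root of D, so their rate is
      sqrt \<beta>, which also dominates the rate \<beta> of the values.\<close>
    define \<rho> where "\<rho> = sqrt \<beta>"
    have \<rho>: "0 < \<rho>" "\<rho> < 1" "\<beta> \<le> \<rho>" unfolding \<rho>_def using \<beta>
      by (auto intro!: real_le_rsqrt simp: power2_eq_square mult_left_le)
    have \<rho>k: "sqrt (\<beta> ^ k) = \<rho> ^ k" "\<beta> ^ k \<le> \<rho> ^ k" for k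
      unfolding \<rho>_def using \<beta> \<rho> by (auto simp: real_sqrt_power intro: power_mono simp flip: \<rho>_def)
    have sb: "s k \<le> sqrt (A / q) * \<rho> ^ k" if "N1 \<le> k" for k
    proof -
      have "s k \<le> sqrt (D k / q)" using sqD that K' by simp
      also have "\<dots> \<le> sqrt (A * \<beta> ^ k / q)" using A(2)[OF that] ds.q by (simp add: divide_right_mono)
      also have "\<dots> = sqrt (A / q) * \<rho> ^ k" by (simp add: real_sqrt_mult real_sqrt_divide \<rho>k)
      finally show ?thesis .
    qed
    have Db: "D (Suc k) powr (1 / 2) \<le> sqrt A * \<rho> ^ k" if "N1 \<le> k" for k
    proof -
      have "D (Suc k) powr (1 / 2) = sqrt (D (Suc k))" using ds.D[of "Suc k"] that K' by (simp add: powr_half_sqrt)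
      also have "\<dots> \<le> sqrt (A * \<beta> ^ k)" using A(2)[OF that] Ddec[of k] that K' by simp
      also have "\<dots> = sqrt A * \<rho> ^ k" by (simp add: real_sqrt_mult \<rho>k)
      finally show ?thesis .
    qed
    show ?thesis
    proof (intro exI[of _ \<rho>] conjI \<rho>)
      show "(\<lambda>k. \<bar>g k\<bar>) \<in> O(\<lambda>k. \<rho> ^ k)"
      proof (rule bigoI[where c = "(1 + C / q) * A"], rule eventually_sequentiallyI[of N1])
        fix k assume k: "N1 \<le> k"
        have "\<bar>g k\<bar> \<le> (1 + C / q) * D k" using gle[of k] k K' by simp
        also have "\<dots> \<le> (1 + C / q) * (A * \<beta> ^ k)" using A(2)[OF k] ds.C ds.q by (intro mult_left_mono) auto
        also have "\<dots> \<le> (1 + C / q) * (A * \<rho> ^ k)" using \<rho>k A ds.C ds.q by (intro mult_left_mono) auto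
        finally show "norm \<bar>g k\<bar> \<le> (1 + C / q) * A * norm (\<rho> ^ k)" using \<rho> by simp
      qed
      show "(\<lambda>k. norm (\<eta>h k) + norm (\<eta> k)) \<in> O(\<lambda>k. \<rho> ^ k)"
      proof (rule bigoI[where c = "2 * sqrt (A / q)"], rule eventually_sequentiallyI[of N1])
        fix k assume k: "N1 \<le> k"
        show "norm (norm (\<eta>h k) + norm (\<eta> k)) \<le> 2 * sqrt (A / q) * norm (\<rho> ^ k)"
          using sb[OF k] s_ge(2,3)[of k] \<rho> by simp
      qed
      show "(\<lambda>k. norm (x k - xb)) \<in> O(\<lambda>k. \<rho> ^ k)"
      proof (rule bigoI[where c = "K' * (sqrt (A / q) + sqrt A)"], rule eventually_sequentiallyI[of N1])
        fix k assume k: "N1 \<le> k"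
        have "norm (x k - xb) \<le> K' * (sqrt (A / q) * \<rho> ^ k + sqrt A * \<rho> ^ k)"
          using sb[OF k] Db[OF k] K' by (intro order_trans[OF r2[OF k]] mult_left_mono add_mono) auto
        then show "norm (norm (x k - xb)) \<le> K' * (sqrt (A / q) + sqrt A) * norm (\<rho> ^ k)"
          using \<rho> by (simp add: algebra_simps)
      qed
    qed
  qed
  have conclusion_powr:
    "(\<lambda>k. \<bar>g k\<bar>) \<in> O(\<lambda>k. real k powr (- 1 / (2 * \<theta>b - 1)) + real k powr (- r / (2 * \<theta>b))) \<and>
     (\<lambda>k. norm (\<eta>h k) + norm (\<eta> k)) \<in> O(\<lambda>k. real k powr (- 1 / (4 * \<theta>b - 2)) + real k powr (- r / (4 * \<theta>b))) \<and>
     (\<lambda>k. norm (x k - xb)) \<in> O(\<lambda>k. real k powr (- \<kappa>))"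
    if exps: "KL_exponent \<Phi>0 (xb, 0) \<theta>" and \<theta>b: "1 / 2 < \<theta>b" "\<theta>b < 1"
      and \<theta>b_eq: "\<theta>b = max \<theta> \<theta>0"
      and \<kappa>: "\<kappa> \<le> (1 - \<theta>b) / (2 * \<theta>b - 1)" "\<kappa>2 \<noteq> 0 \<Longrightarrow> \<kappa> \<le> r * (1 - \<theta>b) / (2 * \<theta>b)" "\<kappa>2 \<noteq> 0 \<Longrightarrow> \<kappa> \<le> (r - 2) / 2"
    for \<theta> \<theta>b \<kappa>
  proof -
    obtain K' N1 where K': "K' > 0" "N \<le> N1"
      and r1: "\<And>k. N1 \<le> k \<Longrightarrow> D (Suc k) powr \<theta>b \<le> K' * (s k + \<tau> k)"
      and r2: "\<And>k. N1 \<le> k \<Longrightarrow> norm (x k - xb) \<le> K' * (s k + \<Theta> k + D (Suc k) powr (1 - \<theta>b))"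
      using rates[OF exps] unfolding \<theta>b_eq by blast
    have N1: "N1 \<ge> 1" using K' pos by simp
    \<comment> \<open>Squaring \<open>r1\<close> doubles the exponent and turns s k into a quantity
      bounded by the decrement of D, the recursion of \<open>powr_rate\<close>.\<close>
    define p where "p = 2 * \<theta>b"
    have p: "p > 1" "p < 2" unfolding p_def using \<theta>b by auto
    \<comment> \<open>The decay exponent of D: 1 / (p - 1) is dictated by the KL exponent, r / p by
      the requirement that k powr (- r), the square of \<tau> k, be at most k powr (- (\<sigma> *
      p)).\<close>
    define \<sigma> where "\<sigma> = (if \<kappa>2 = 0 then 1 / (p - 1) else min (1 / (p - 1)) (r / p))"
    have \<sigma>: "\<sigma> > 0" "\<sigma> \<le> 1 / (p - 1)" "\<kappa>2 \<noteq> 0 \<Longrightarrow> \<sigma> \<le> r / p" unfolding \<sigma>_def using p pos by auto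
    have \<sigma>p: "\<sigma> * (p - 1) \<le> 1" using \<sigma>(2) p by (simp add: field_simps)
    \<comment> \<open>Follows from \<theta>b \<ge> \<theta>0 and ensures that T decays no more
      slowly than k powr (- \<sigma>).\<close>
    have r_p: "r / p \<le> r - 1" if "\<kappa>2 \<noteq> 0"
    proof -
      have "(r - 1) * \<theta>0 \<le> (r - 1) * \<theta>b" unfolding \<theta>b_eq using pos by (intro mult_left_mono) auto
      then have "r / 2 \<le> (r - 1) * \<theta>b" using \<theta>0(3)[OF that] by simp
      then show ?thesis using p unfolding p_def by (simp add: field_simps)
    qed
    have \<tau>2: "(\<tau> k)\<^sup>2 \<le> real k powr (- (\<sigma> * p))" if "k \<ge> 1" for k
    proof (cases "\<kappa>2 = 0")
      case False
      have "(\<tau> k)\<^sup>2 = real k powr (- r)"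
        unfolding \<tau>_def using False that by (simp add: power2_eq_square flip: powr_add)
      also have "\<dots> \<le> real k powr (- (\<sigma> * p))"
        using that \<sigma>(3)[OF False] p by (intro powr_mono) (auto simp: field_simps)
      finally show ?thesis .
    next
      case True
      show ?thesis using unperturbed[OF True] by simp
    qed
    define K2 where "K2 = 2 * K'\<^sup>2 * (1 / q + 1)"
    have K2: "K2 > 0" unfolding K2_def using K' ds.q by (simp add: add_pos_pos)
    have "D (Suc k) powr p \<le> K2 * (D k - D (Suc k) + real k powr (- (\<sigma> * p)))" if k: "N1 \<le> k" for k
    proof -
      have kN: "N \<le> k" "k \<ge> 1" using k K' N1 by auto
      have "D (Suc k) powr p = (D (Suc k) powr \<theta>b)\<^sup>2"
        unfolding p_def by (simp add: power2_eq_square flip: powr_add)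
      also have "\<dots> \<le> (K' * (s k + \<tau> k))\<^sup>2" using r1[OF k] by (intro power_mono) auto
      also have "\<dots> \<le> K'\<^sup>2 * (2 * (s k)\<^sup>2 + 2 * (\<tau> k)\<^sup>2)"
      proof -
        have "(s k + \<tau> k)\<^sup>2 \<le> 2 * (s k)\<^sup>2 + 2 * (\<tau> k)\<^sup>2"
          using zero_le_power2[of "s k - \<tau> k"] by (simp add: power2_eq_square algebra_simps)
        then show ?thesis by (simp add: power_mult_distrib mult_left_mono)
      qed
      also have "\<dots> \<le> K'\<^sup>2 * (2 * ((1 / q + 1) * (D k - D (Suc k))) + 2 * ((1 / q + 1) * real k powr (- (\<sigma> * p))))"
      proof (intro mult_left_mono add_mono)
        have dd: "(s k)\<^sup>2 \<le> 1 / q * (D k - D (Suc k))" using ds.descent[OF kN(1)] ds.q by (simp add: field_simps)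
        also have "\<dots> \<le> (1 / q + 1) * (D k - D (Suc k))" using Ddec[OF kN(1)] by (intro mult_right_mono) auto
        finally show "(s k)\<^sup>2 \<le> (1 / q + 1) * (D k - D (Suc k))" .
        have "(\<tau> k)\<^sup>2 \<le> 1 * real k powr (- (\<sigma> * p))" using \<tau>2 kN by simp
        also have "\<dots> \<le> (1 / q + 1) * real k powr (- (\<sigma> * p))" using ds.q by (intro mult_right_mono) auto
        finally show "(\<tau> k)\<^sup>2 \<le> (1 / q + 1) * real k powr (- (\<sigma> * p))" .
      qed auto
      also have "\<dots> = K2 * (D k - D (Suc k) + real k powr (- (\<sigma> * p)))"
      proof -
        have "a * (2 * (Q * X) + 2 * (Q * Y)) = 2 * a * Q * (X + Y)" for a Q X Y :: real
          by (simp add: algebra_simps)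
        then show ?thesis unfolding K2_def .
      qed
      finally show ?thesis .
    qed
    then obtain A where A: "A > 0" "\<And>k. N1 \<le> k \<Longrightarrow> D k \<le> A * real k powr (- \<sigma>)"
      using powr_rate[OF p(1) K2 \<sigma>(1) \<sigma>p N1, of D] ds.D K'(2) by (metis order_trans)
    have sb: "s k \<le> sqrt (A / q) * real k powr (- (\<sigma> / 2))" if "N1 \<le> k" for k
    proof -
      have "s k \<le> sqrt (D k / q)" using sqD that K' by simp
      also have "\<dots> \<le> sqrt (A * real k powr (- \<sigma>) / q)" using A(2)[OF that] ds.q by (simp add: divide_right_mono)
      also have "\<dots> = sqrt (A / q) * sqrt (real k powr (- \<sigma>))" by (simp add: real_sqrt_mult real_sqrt_divide)
      also have "sqrt (real k powr (- \<sigma>)) = real k powr (- (\<sigma> / 2))"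
        by (simp add: powr_powr flip: powr_half_sqrt)
      finally show ?thesis .
    qed
    have Tb: "T k \<le> CT * real k powr (- \<sigma>)" if "N1 \<le> k" for k
    proof (cases "\<kappa>2 = 0")
      case False
      have "real k powr (- (r - 1)) \<le> real k powr (- \<sigma>)"
        using that N1 \<sigma>(3)[OF False] r_p[OF False] by (intro powr_mono) auto
      then show ?thesis unfolding T using CT by (intro mult_left_mono) auto
    qed (use CT T in simp)
    \<comment> \<open>\<sigma> equals one of the two exponents, so the sum of both powers covers
      every case.\<close>
    have rate_le: "real k powr (- \<sigma> * h) \<le> real k powr (- (1 / (p - 1)) * h) + real k powr (- (r / p) * h)" for k h
      unfolding \<sigma>_def min_def by (simp split: if_splits)
    have e1: "- 1 / (2 * \<theta>b - 1) = - (1 / (p - 1)) * 1" "- r / (2 * \<theta>b) = - (r / p) * 1"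
      "- 1 / (4 * \<theta>b - 2) = - (1 / (p - 1)) * (1 / 2)" "- r / (4 * \<theta>b) = - (r / p) * (1 / 2)"
      unfolding p_def using \<theta>b by (auto simp: field_simps)
    have c1: "(\<lambda>k. \<bar>g k\<bar>) \<in> O(\<lambda>k. real k powr (- 1 / (2 * \<theta>b - 1)) + real k powr (- r / (2 * \<theta>b)))"
    proof (rule bigoI[where c = "(1 + C / q) * A + CT"], rule eventually_sequentiallyI[of N1])
      fix k assume k: "N1 \<le> k"
      have "\<bar>g k\<bar> \<le> (1 + C / q) * D k + T k" using gle[of k] k K' by simp
      also have "\<dots> \<le> (1 + C / q) * (A * real k powr (- \<sigma>)) + CT * real k powr (- \<sigma>)"
        using A(2)[OF k] Tb[OF k] ds.C ds.q by (intro add_mono mult_left_mono) auto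
      also have "\<dots> = ((1 + C / q) * A + CT) * real k powr (- \<sigma> * 1)" by (simp add: algebra_simps)
      also have "\<dots> \<le> ((1 + C / q) * A + CT) * (real k powr (- (1 / (p - 1)) * 1) + real k powr (- (r / p) * 1))"
        using A CT ds.C ds.q by (intro mult_left_mono rate_le) auto
      finally show "norm \<bar>g k\<bar> \<le> ((1 + C / q) * A + CT) * norm (real k powr (- 1 / (2 * \<theta>b - 1)) + real k powr (- r / (2 * \<theta>b)))"
        unfolding e1 by simp
    qed
    have c2: "(\<lambda>k. norm (\<eta>h k) + norm (\<eta> k)) \<in> O(\<lambda>k. real k powr (- 1 / (4 * \<theta>b - 2)) + real k powr (- r / (4 * \<theta>b)))"
    proof (rule bigoI[where c = "2 * sqrt (A / q)"], rule eventually_sequentiallyI[of N1])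
      fix k assume k: "N1 \<le> k"
      have "norm (\<eta>h k) + norm (\<eta> k) \<le> 2 * s k" using s_ge(2,3)[of k] by simp
      also have "\<dots> \<le> 2 * (sqrt (A / q) * real k powr (- \<sigma> * (1 / 2)))" using sb[OF k] by simp
      also have "\<dots> = 2 * sqrt (A / q) * real k powr (- \<sigma> * (1 / 2))" by simp
      also have "\<dots> \<le> 2 * sqrt (A / q) * (real k powr (- (1 / (p - 1)) * (1 / 2)) + real k powr (- (r / p) * (1 / 2)))"
        using A ds.q by (intro mult_left_mono rate_le) auto
      finally show "norm (norm (\<eta>h k) + norm (\<eta> k)) \<le> 2 * sqrt (A / q) * norm (real k powr (- 1 / (4 * \<theta>b - 2)) + real k powr (- r / (4 * \<theta>b)))"
        unfolding e1 by simp
    qed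
    have \<kappa>\<sigma>: "\<kappa> \<le> \<sigma> * (1 - \<theta>b)"
    proof -
      have "(1 - \<theta>b) / (2 * \<theta>b - 1) = 1 / (p - 1) * (1 - \<theta>b)" "r * (1 - \<theta>b) / (2 * \<theta>b) = r / p * (1 - \<theta>b)"
        unfolding p_def by simp_all
      then show ?thesis using \<kappa>(1,2) unfolding \<sigma>_def min_def by auto
    qed
    \<comment> \<open>As \<theta>b > 1/2, the step term, of order k powr (- (\<sigma> / 2)), is no
      larger than the contribution of D powr (1 - \<theta>b).\<close>
    have "\<sigma> * (1 - \<theta>b) \<le> \<sigma> * (1 / 2)" using \<sigma> \<theta>b by (intro mult_left_mono) auto
    then have \<kappa>\<sigma>2: "\<kappa> \<le> \<sigma> / 2" using \<kappa>\<sigma> by simp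
    define c\<Theta> where "c\<Theta> = 2 powr (r / 2) / (r / 2 - 1)"
    have c\<Theta>: "c\<Theta> \<ge> 0" unfolding c\<Theta>_def using pos by simp
    define Cx where "Cx = K' * (sqrt (A / q) + c\<Theta> + A powr (1 - \<theta>b))"
    have c3: "(\<lambda>k. norm (x k - xb)) \<in> O(\<lambda>k. real k powr (- \<kappa>))"
    proof (rule bigoI[where c = Cx], rule eventually_sequentiallyI[of N1])
      fix k assume k: "N1 \<le> k"
      have k1: "real k \<ge> 1" using k N1 by simp
      have 1: "s k \<le> sqrt (A / q) * real k powr (- \<kappa>)"
        by (rule order_trans[OF sb[OF k] scaled_powr_mono[OF k1]]) (use \<kappa>\<sigma>2 A ds.q in auto)
      have 2: "\<Theta> k \<le> c\<Theta> * real k powr (- \<kappa>)"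
      proof (cases "\<kappa>2 = 0")
        case False
        then show ?thesis
          unfolding \<Theta>_def c\<Theta>_def[symmetric]
          using scaled_powr_mono[OF k1, of "- (r / 2 - 1)" "- \<kappa>" c\<Theta>] c\<Theta> \<kappa>(3) by (simp add: field_simps)
      next
        case True
        show ?thesis using unperturbed(2)[OF True] c\<Theta> by simp
      qed
      have "D (Suc k) powr (1 - \<theta>b) \<le> (A * real k powr (- \<sigma>)) powr (1 - \<theta>b)"
        using A(2)[OF k] Ddec[of k] ds.D[of "Suc k"] k K' \<theta>b by (intro powr_mono2) auto
      also have "\<dots> = A powr (1 - \<theta>b) * real k powr (- (\<sigma> * (1 - \<theta>b)))"
        using A by (simp add: powr_mult powr_powr)
      also have "\<dots> \<le> A powr (1 - \<theta>b) * real k powr (- \<kappa>)"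
        using \<kappa>\<sigma> by (intro scaled_powr_mono[OF k1]) auto
      finally have 3: "D (Suc k) powr (1 - \<theta>b) \<le> A powr (1 - \<theta>b) * real k powr (- \<kappa>)" .
      have "norm (x k - xb) \<le> K' * (sqrt (A / q) * real k powr (- \<kappa>) + c\<Theta> * real k powr (- \<kappa>) + A powr (1 - \<theta>b) * real k powr (- \<kappa>))"
        using 1 2 3 K' by (intro order_trans[OF r2[OF k]] mult_left_mono add_mono) auto
      also have "\<dots> = Cx * real k powr (- \<kappa>)" unfolding Cx_def by (simp add: algebra_simps)
      finally show "norm (norm (x k - xb)) \<le> Cx * norm (real k powr (- \<kappa>))" by simp
    qed
    show ?thesis using c1 c2 c3 by blast
  qed
  show ?thesis
  proof (intro conjI exI[of _ xb] allI impI xlim crit)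
    show "\<bar>lim (\<lambda>k. \<Phi>0 (x k, \<eta>h k))\<bar> \<noteq> \<infinity>" unfolding lim by simp
    show "(\<lambda>k. \<Phi>0 (x k, \<eta>h k)) \<longlonglongrightarrow> lim (\<lambda>k. \<Phi>0 (x k, \<eta>h k))" unfolding lim by (rule \<Phi>0lim)
    fix \<theta> assume exps: "KL_exponent \<Phi>0 (xb, 0) \<theta>"
    show "\<exists>\<rho>. 0 < \<rho> \<and> \<rho> < 1 \<and>
             (\<lambda>k. real_of_ereal \<bar>\<Phi>0 (x k, \<eta>h k) - \<Phi>0 (xb, 0)\<bar>) \<in> O(\<lambda>k. \<rho> ^ k) \<and>
             (\<lambda>k. norm (\<eta>h k) + norm (\<eta> k)) \<in> O(\<lambda>k. \<rho> ^ k) \<and>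
             (\<lambda>k. norm (x k - xb)) \<in> O(\<lambda>k. \<rho> ^ k)" if "\<kappa>2 = 0 \<and> \<theta> \<le> 1/2"
      unfolding gabs using conclusion_geometric[OF exps] that by blast
    show "let \<theta>b = (if \<kappa>2 > 0 then max \<theta> (r / (2 * (r - 1))) else \<theta>);
             \<kappa> = (if \<kappa>2 = 0 then (1 - \<theta>) / (2 * \<theta> - 1)
                  else Min {(1 - \<theta>b) / (2 * \<theta>b - 1), r * (1 - \<theta>b) / (2 * \<theta>b), (r - 2) / 2})
         in 1/2 < \<theta>b \<and> \<theta>b < 1 \<longrightarrow>
             (\<lambda>k. real_of_ereal \<bar>\<Phi>0 (x k, \<eta>h k) - \<Phi>0 (xb, 0)\<bar>)
               \<in> O(\<lambda>k. real k powr (- 1 / (2 * \<theta>b - 1)) + real k powr (- r / (2 * \<theta>b))) \<and>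
             (\<lambda>k. norm (\<eta>h k) + norm (\<eta> k))
               \<in> O(\<lambda>k. real k powr (- 1 / (4 * \<theta>b - 2)) + real k powr (- r / (4 * \<theta>b))) \<and>
             (\<lambda>k. norm (x k - xb)) \<in> O(\<lambda>k. real k powr (- \<kappa>))"
      unfolding Let_def gabs
    proof (rule impI, rule conclusion_powr[OF exps])
      let ?\<theta>b = "if \<kappa>2 > 0 then max \<theta> (r / (2 * (r - 1))) else \<theta>"
      assume b: "1/2 < ?\<theta>b \<and> ?\<theta>b < 1"
      show "1 / 2 < ?\<theta>b" "?\<theta>b < 1" using b by auto
      \<comment> \<open>For \<kappa>2 = 0 the maximum with \<theta>0 = 1/2 changes nothing, because
        here \<theta> > 1/2.\<close>
      show "?\<theta>b = max \<theta> \<theta>0" unfolding \<theta>0_def using b pos(6) by auto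
      let ?M = "Min {(1 - ?\<theta>b) / (2 * ?\<theta>b - 1), r * (1 - ?\<theta>b) / (2 * ?\<theta>b), (r - 2) / 2}"
      have M: "?M \<le> (1 - ?\<theta>b) / (2 * ?\<theta>b - 1)" "?M \<le> r * (1 - ?\<theta>b) / (2 * ?\<theta>b)" "?M \<le> (r - 2) / 2"
        by (rule Min_le, simp, simp)+
      show "(if \<kappa>2 = 0 then (1 - \<theta>) / (2 * \<theta> - 1) else ?M) \<le> (1 - ?\<theta>b) / (2 * ?\<theta>b - 1)"
        using M(1) by auto
      show "(if \<kappa>2 = 0 then (1 - \<theta>) / (2 * \<theta> - 1) else ?M) \<le> r * (1 - ?\<theta>b) / (2 * ?\<theta>b)" if "\<kappa>2 \<noteq> 0"
        using M(2) that by auto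
      show "(if \<kappa>2 = 0 then (1 - \<theta>) / (2 * \<theta> - 1) else ?M) \<le> (r - 2) / 2" if "\<kappa>2 \<noteq> 0"
        using M(3) that by auto
    qed
  qed
qed

end

text \<open>This explains the constant \<open>Ca\<close>: with s = sqrt \<alpha>, the base of the
  square is the positive root of the quadratic equation A s s + 2 s sqrt b = t.\<close>

lemma stepsize_bound:
  fixes A b t :: real
  assumes "A > 0" "b \<ge> 0" "t > 0" "0 < \<alpha>" "\<alpha> < ((sqrt (b + A * t) - sqrt b) / A)\<^sup>2"
  shows "A * \<alpha> + 2 * sqrt \<alpha> * sqrt b \<le> t"
proof -
  define X where "X = (sqrt (b + A * t) - sqrt b) / A"
  define s where "s = sqrt \<alpha>"
  have s: "s \<ge> 0" "s\<^sup>2 = \<alpha>" unfolding s_def using assms by auto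
  have "X \<ge> 0" unfolding X_def using assms by simp
  then have "s < X" unfolding s_def using assms(5) unfolding X_def[symmetric] by (intro real_less_lsqrt) auto
  then have "A * s + sqrt b \<le> sqrt (b + A * t)" unfolding X_def using assms by (simp add: field_simps)
  then have "(A * s + sqrt b)\<^sup>2 \<le> (sqrt (b + A * t))\<^sup>2" using assms s by (intro power_mono) auto
  then have "A * (A * s\<^sup>2 + 2 * s * sqrt b) \<le> A * t"
    using assms by (simp add: power2_eq_square algebra_simps)
  then show ?thesis using assms(1) s by (simp add: s_def)
qed

text \<open>k + 1 \<le> (k0 + 1) * (k + 1 - k0), so shifting the index by k0 costs only a constant
  factor.\<close>

lemma powr_shift_le:
  fixes r :: real
  assumes "k0 \<le> k" "r \<ge> 0"
  shows "(real k + 1 - real k0) powr (- r) \<le> (real k0 + 1) powr r * (real k + 1) powr (- r)"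
proof -
  have d: "real k + 1 - real k0 \<ge> 1" using assms by simp
  have "real k + 1 \<le> (real k0 + 1) * (real k + 1 - real k0)"
    using mult_left_mono[OF d, of "real k0"] by (simp add: algebra_simps)
  then have "((real k0 + 1) * (real k + 1 - real k0)) powr (- r) \<le> (real k + 1) powr (- r)"
    using assms by (intro powr_mono2') auto
  then have "(real k0 + 1) powr r * ((real k0 + 1) * (real k + 1 - real k0)) powr (- r)
      \<le> (real k0 + 1) powr r * (real k + 1) powr (- r)"
    by (intro mult_left_mono) auto
  moreover have "(real k0 + 1) powr r * ((real k0 + 1) * (real k + 1 - real k0)) powr (- r) = (real k + 1 - real k0) powr (- r)"
    using d by (simp add: powr_mult flip: powr_add mult.assoc)
  ultimately show ?thesis by simp
qed

theorem corollary4p11: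
  fixes M U :: "'a::euclidean_space set"
    and I :: "'i set" and V W :: "'i \<Rightarrow> 'a set"
    and \<psi> :: "'i \<Rightarrow> 'a \<Rightarrow> 'b::euclidean_space" and sel :: "'a \<Rightarrow> 'i"
    and B :: "'a \<Rightarrow> 'a \<Rightarrow> 'b"
    and Retr :: "'a \<Rightarrow> 'a \<Rightarrow> 'a"
    and n :: nat and f :: "nat \<Rightarrow> 'a \<Rightarrow> real" and F R \<Phi> :: "'a \<Rightarrow> real"
    and \<Phi>0 :: "'a \<times> 'a \<Rightarrow> ereal" and \<Phi>s :: ereal and \<Omega>s :: "('a \<times> 'a) set"
    and lf lR Mf cf Mu C0 C1 Ca :: real
    and \<alpha> \<alpha>b \<gamma>l tolb chib :: real
    and \<delta> CR CQ LR L\<Phi> LF \<delta>T LT :: real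
    and ce \<mu> \<nu> \<kappa>1 \<kappa>2 r \<rho>1 \<rho>2 chie a c\<eta> Csh d\<alpha> :: real and k0 :: nat
    and \<gamma> tol chi Er :: "nat \<Rightarrow> real"
    and x u uh mb m w \<eta> \<eta>h e :: "nat \<Rightarrow> 'a" and l :: "nat \<Rightarrow> 'b"
  defines "B \<equiv> (\<lambda>y. frechet_derivative (\<psi> (sel y)) (at y))"
    and "F \<equiv> (\<lambda>y. (\<Sum>j=1..n. f j y) / real n)"
    and "\<Phi> \<equiv> (\<lambda>y. F y + R y)"
    and "\<Phi>0 \<equiv> shifted_objective M \<Phi>"
    and "Mu \<equiv> cf * Mf"
    and "C1 \<equiv> 2 * sqrt (lR * C0 * \<alpha>b)"
    and "Ca \<equiv> ((sqrt (lR * C0 * tolb + (Mu + lR) * min \<delta> \<delta>T) - sqrt (lR * C0 * tolb)) / (Mu + lR))\<^sup>2"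
    and "e \<equiv> (\<lambda>k. m k - riem_grad M F (x k))"
    and "a \<equiv> 1 / (2 * \<alpha>) - lf / 2 - \<rho>2 / 2"
    and "c\<eta> \<equiv> 1 / (4 * \<alpha>) + lf\<^sup>2 * \<rho>1 + 2 * L\<Phi>"
    and "Csh \<equiv> C1\<^sup>2 / \<alpha> + 2 * L\<Phi> * C1\<^sup>2 + C1\<^sup>2 / (2 * \<rho>1) + 2 * C0 * lR"
    and "d\<alpha> \<equiv> a - c\<eta>"
    and "\<Phi>s \<equiv> lim (\<lambda>k. \<Phi>0 (x k, \<eta>h k))"
    and "\<Omega>s \<equiv> {(y, v) \<in> tangent_bundle M. norm v \<le> (Mu + lR) * \<alpha>b \<and> \<Phi>0 (y, v) = \<Phi>s \<and>
                 0 \<in> limiting_subdifferential \<Phi>0 (y, v)}"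
  (* manifold and retraction *)
  assumes "compact M" and "defining_cover M I V W \<psi>"
    and "\<forall>y\<in>M. sel y \<in> I \<and> y \<in> V (sel y)"
    and "C0 > 0" and "\<forall>y\<in>M. \<forall>v. infdist v (tangent_space M y) \<le> C0 * norm (B y v)"
    and "manifold_retraction M Retr"
  (* objective *)
    and "n = 1"
    and "\<forall>j\<in>{1..n}. (\<forall>y. f j differentiable (at y)) \<and> continuous_on UNIV (nabla (f j))"
    and "open U" and "M \<subseteq> U" and "\<forall>j\<in>{1..n}. lf-lipschitz_on U (nabla (f j))"
    and "Mf > 0" and "\<forall>j\<in>{1..n}. \<forall>y\<in>M. norm (nabla (f j) y) \<le> Mf"
    and "convex_on UNIV R" and "lR-lipschitz_on UNIV R"
  (* constants of the geometry *)
    and "\<delta> > 0" and "CR > 0" and "CQ > 0" and "LR > 0" and "L\<Phi> > 0" and "LF > 0"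
    and "\<forall>y\<in>M. \<forall>v\<in>tangent_space M y. norm v \<le> \<delta> \<longrightarrow>
           y + v \<in> U \<and>
           norm (Retr y v - y) \<le> CR * norm v \<and>
           norm (Retr y v - y - v) \<le> CQ * (norm v)\<^sup>2 \<and>
           \<bar>R (Retr y v) - R (y + v)\<bar> \<le> LR * (norm v)\<^sup>2 \<and>
           \<bar>\<Phi> (Retr y v) - \<Phi> (y + v)\<bar> \<le> L\<Phi> * (norm v)\<^sup>2 \<and>
           F (Retr y v) - F y - inner (riem_grad M F y) v \<le> LF / 2 * (norm v)\<^sup>2"
    and "\<delta>T > 0" and "LT > 0"
    and "\<forall>h \<in> insert F (f ` {1..n}). \<forall>y\<in>M. \<forall>v\<in>tangent_space M y. norm v \<le> \<delta>T \<longrightarrow>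
           norm (riem_grad M h (Retr y v) -
                 closest_point (tangent_space M (Retr y v)) (riem_grad M h y)) \<le> LT * norm v"
  (* algorithm *)
    and "0 < \<alpha>" and "\<alpha> \<le> \<alpha>b" and "0 < \<gamma>l" and "\<gamma>l \<le> 1" and "tolb \<ge> 0" and "0 \<le> chib" and "chib < 1"
    and "cf \<ge> 1"
    and "\<forall>k. \<gamma> k \<in> {\<gamma>l..1}" and "\<forall>k. tol k \<in> {0..tolb}" and "\<forall>k. chi k \<in> {0..chib}"
    and "iRPMVR M F R B Retr \<alpha> Mu \<gamma> tol chi x u uh mb m l w \<eta>"
    and "\<forall>k. \<gamma> k = 1"
    and "\<forall>k. is_arg_min (step_model R \<alpha> (x k) (m k)) (\<lambda>v. v \<in> tangent_space M (x k)) (\<eta>h k)"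
  (* error dissipation *)
    and "ce > 0" and "\<mu> > 0" and "\<nu> > 0" and "\<forall>k. Er k \<ge> 0"
    and "\<forall>k. (norm (e k))\<^sup>2 + \<mu> * Er k \<le> ce * (Er k - Er (Suc k)) + \<nu> * (norm (\<eta> k))\<^sup>2"
  (* inexactness and stepsize conditions *)
    and "\<kappa>1 \<ge> 0" and "\<kappa>2 \<ge> 0" and "r > 2"
    and "\<forall>k\<ge>k0 + 1. tol k \<le> min tolb (max (\<kappa>1 * (norm (\<eta> (k - 1)))\<^sup>2)
                                       (\<kappa>2 * (real k - real k0) powr (- r)))"
    and "\<rho>1 > 0" and "\<rho>2 > 0" and "chie > \<rho>1"
    and "0 < \<alpha>b"
    and "\<alpha>b < Min {Ca, 1 / (lf + \<rho>2),
           1 / (2 * lf + 2 * \<rho>2 + 4 * lf\<^sup>2 * \<rho>1 + 8 * L\<Phi> + 8 * \<nu> / \<rho>2 + 16 * chie * \<nu>)}"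
    and "\<kappa>1 < (d\<alpha> / 4 - \<nu> / (2 * \<rho>2) - chie * \<nu>) / (d\<alpha> * C1\<^sup>2 / 2 + Csh)"
  (* KL assumption *)
    and "\<Omega>s \<noteq> {}" and "\<forall>z\<in>\<Omega>s. KL_property \<Phi>0 z"
  shows "\<bar>\<Phi>s\<bar> \<noteq> \<infinity> \<and> (\<lambda>k. \<Phi>0 (x k, \<eta>h k)) \<longlonglongrightarrow> \<Phi>s \<and>
    (\<exists>xs. x \<longlonglongrightarrow> xs \<and> critical_point M F R xs \<and>
      (\<forall>\<theta>. KL_exponent \<Phi>0 (xs, 0) \<theta> \<longrightarrow>
        (\<kappa>2 = 0 \<and> \<theta> \<le> 1/2 \<longrightarrow>
          (\<exists>\<rho>. 0 < \<rho> \<and> \<rho> < 1 \<and>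
             (\<lambda>k. real_of_ereal \<bar>\<Phi>0 (x k, \<eta>h k) - \<Phi>0 (xs, 0)\<bar>) \<in> O(\<lambda>k. \<rho> ^ k) \<and>
             (\<lambda>k. norm (\<eta>h k) + norm (\<eta> k)) \<in> O(\<lambda>k. \<rho> ^ k) \<and>
             (\<lambda>k. norm (x k - xs)) \<in> O(\<lambda>k. \<rho> ^ k))) \<and>
        (let \<theta>b = (if \<kappa>2 > 0 then max \<theta> (r / (2 * (r - 1))) else \<theta>);
             \<kappa> = (if \<kappa>2 = 0 then (1 - \<theta>) / (2 * \<theta> - 1)
                  else Min {(1 - \<theta>b) / (2 * \<theta>b - 1), r * (1 - \<theta>b) / (2 * \<theta>b), (r - 2) / 2})
         in 1/2 < \<theta>b \<and> \<theta>b < 1 \<longrightarrow>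
             (\<lambda>k. real_of_ereal \<bar>\<Phi>0 (x k, \<eta>h k) - \<Phi>0 (xs, 0)\<bar>)
               \<in> O(\<lambda>k. real k powr (- 1 / (2 * \<theta>b - 1)) + real k powr (- r / (2 * \<theta>b))) \<and>
             (\<lambda>k. norm (\<eta>h k) + norm (\<eta> k))
               \<in> O(\<lambda>k. real k powr (- 1 / (4 * \<theta>b - 2)) + real k powr (- r / (4 * \<theta>b))) \<and>
             (\<lambda>k. norm (x k - xs)) \<in> O(\<lambda>k. real k powr (- \<kappa>)))))"
proof -
  interpret covered_manifold M I V W \<psi> sel C0
    by unfold_locales (use \<open>compact M\<close> \<open>defining_cover M I V W \<psi>\<close> \<open>\<forall>y\<in>M. sel y \<in> I \<and> y \<in> V (sel y)\<close> \<open>C0 > 0\<close>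
      \<open>\<forall>y\<in>M. \<forall>v. infdist v (tangent_space M y) \<le> C0 * norm (B y v)\<close> in \<open>auto simp: B_def\<close>)
  have F: "F = f 1" unfolding F_def using \<open>n = 1\<close> by simp
  have dF: "GDERIV F z :> nabla F z" for z
    unfolding F using assms \<open>n = 1\<close> by (intro GDERIV_nabla) auto
  have cF: "continuous_on UNIV (nabla F)" and lipF: "lf-lipschitz_on U (nabla F)"
    and MfF: "\<And>y. y \<in> M \<Longrightarrow> norm (nabla F y) \<le> Mf"
    unfolding F using \<open>\<forall>j\<in>{1..n}. (\<forall>y. f j differentiable (at y)) \<and> continuous_on UNIV (nabla (f j))\<close>
      \<open>\<forall>j\<in>{1..n}. lf-lipschitz_on U (nabla (f j))\<close> \<open>\<forall>j\<in>{1..n}. \<forall>y\<in>M. norm (nabla (f j) y) \<le> Mf\<close> \<open>n = 1\<close>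
    by auto
  have lf: "lf \<ge> 0" using lipF by (rule lipschitz_on_nonneg)
  have lR: "lR \<ge> 0" using \<open>lR-lipschitz_on UNIV R\<close> by (rule lipschitz_on_nonneg)
  have Mu: "Mu > 0" "Mf \<le> Mu" unfolding Mu_def using \<open>Mf > 0\<close> \<open>cf \<ge> 1\<close> by auto
  note geo = \<open>\<forall>y\<in>M. \<forall>v\<in>tangent_space M y. norm v \<le> \<delta> \<longrightarrow>
           y + v \<in> U \<and>
           norm (Retr y v - y) \<le> CR * norm v \<and>
           norm (Retr y v - y - v) \<le> CQ * (norm v)\<^sup>2 \<and>
           \<bar>R (Retr y v) - R (y + v)\<bar> \<le> LR * (norm v)\<^sup>2 \<and>
           \<bar>\<Phi> (Retr y v) - \<Phi> (y + v)\<bar> \<le> L\<Phi> * (norm v)\<^sup>2 \<and>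
           F (Retr y v) - F y - inner (riem_grad M F y) v \<le> LF / 2 * (norm v)\<^sup>2\<close>[rule_format]
  have run: "x 0 \<in> M" "u 0 = riem_grad M F (x 0)" "uh 0 = u 0" "mb 0 = u 0"
    "\<And>k. k \<noteq> 0 \<Longrightarrow> uh k = closest_point (cball 0 Mu) (u k)"
    "\<And>k. m k = chi k *\<^sub>R mb k + (1 - chi k) *\<^sub>R uh k"
    "\<And>k. norm (nabla (dual_model R \<alpha> (B (x k)) (x k) (m k)) (l k)) \<le> tol k"
    "\<And>k. w k = prox (\<lambda>z. \<alpha> * R z) (x k - \<alpha> *\<^sub>R (m k + adjoint (B (x k)) (l k))) - x k"
    "\<And>k. \<eta> k = closest_point (tangent_space M (x k)) (w k)"
    "\<And>k. x (Suc k) = Retr (x k) (\<eta> k)"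
    "\<And>k. mb (Suc k) = closest_point (tangent_space M (x (Suc k))) (m k)"
    using \<open>iRPMVR M F R B Retr \<alpha> Mu \<gamma> tol chi x u uh mb m l w \<eta>\<close> \<open>\<forall>k. \<gamma> k = 1\<close>
    unfolding iRPMVR_def by auto
  have xM: "x k \<in> M" for k
  proof (induction k)
    case 0 show ?case by (rule run(1))
  next
    case (Suc k)
    have "\<eta> k \<in> tangent_space M (x k)"
      unfolding run(9) by (rule closest_point_subspace(1)[OF subspace_tangent[OF Suc]])
    then show ?case using \<open>manifold_retraction M Retr\<close> Suc unfolding run(10) manifold_retraction_def by blast
  qed
  note cp = closest_point_subspace[OF subspace_tangent[OF xM]]
  have \<eta>T: "\<eta> k \<in> tangent_space M (x k)" for k unfolding run(9) by (rule cp(1))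
  have uh: "norm (uh k) \<le> Mu" for k
  proof (cases "k = 0")
    case True
    have "norm (riem_grad M F (x 0)) \<le> norm (nabla F (x 0))" unfolding riem_grad_def by (rule cp(5))
    then show ?thesis using True run(2,3) MfF[OF xM[of 0]] Mu by simp
  next
    case False
    have "closest_point (cball 0 Mu) (u k) \<in> cball 0 Mu"
      using Mu by (intro closest_point_in_set) auto
    then show ?thesis unfolding run(5)[OF False] by simp
  qed
  have chi: "0 \<le> chi k" "chi k \<le> 1" for k
    using \<open>\<forall>k. chi k \<in> {0..chib}\<close>[rule_format, of k] \<open>chib < 1\<close> by auto
  have m_le: "norm (m k) \<le> Mu" if "norm (mb k) \<le> Mu" for k
  proof -
    have "norm (m k) \<le> chi k * norm (mb k) + (1 - chi k) * norm (uh k)"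
      unfolding run(6)[of k] using norm_triangle_ineq[of "chi k *\<^sub>R mb k" "(1 - chi k) *\<^sub>R uh k"] chi[of k] by simp
    then show ?thesis
      using convex_bound_le[OF that uh[of k], of "chi k" "1 - chi k"] chi[of k] by simp
  qed
  have "norm (mb k) \<le> Mu" for k
  proof (induction k)
    case 0 show ?case using uh[of 0] run(3,4) by simp
  next
    case (Suc k) then show ?case unfolding run(11) by (rule order_trans[OF cp(5) m_le])
  qed
  then have m: "norm (m k) \<le> Mu" for k by (rule m_le)
  note R = \<open>lR-lipschitz_on UNIV R\<close> \<open>convex_on UNIV R\<close>
  have \<alpha>b: "\<alpha>b < Ca" "\<alpha>b < 1 / (lf + \<rho>2)"
    "\<alpha>b < 1 / (2 * lf + 2 * \<rho>2 + 4 * lf\<^sup>2 * \<rho>1 + 8 * L\<Phi> + 8 * \<nu> / \<rho>2 + 16 * chie * \<nu>)"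
    using \<open>\<alpha>b < Min {Ca, 1 / (lf + \<rho>2),
           1 / (2 * lf + 2 * \<rho>2 + 4 * lf\<^sup>2 * \<rho>1 + 8 * L\<Phi> + 8 * \<nu> / \<rho>2 + 16 * chie * \<nu>)}\<close> by simp_all
  have \<eta>hT: "\<eta>h k \<in> tangent_space M (x k)"
    and \<eta>h_min: "\<And>v. v \<in> tangent_space M (x k) \<Longrightarrow> step_model R \<alpha> (x k) (m k) (\<eta>h k) \<le> step_model R \<alpha> (x k) (m k) v" for k
    using \<open>\<forall>k. is_arg_min (step_model R \<alpha> (x k) (m k)) (\<lambda>v. v \<in> tangent_space M (x k)) (\<eta>h k)\<close>
    unfolding is_arg_min_def by (auto simp: not_less)
  have tol0: "tol k \<ge> 0" "tol k \<le> tolb" for k using \<open>\<forall>k. tol k \<in> {0..tolb}\<close> by auto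
  have B_eq: "B y = frechet_derivative (\<psi> (sel y)) (at y)" for y unfolding B_def by simp
  \<comment> \<open>The gradient of the dual is minus B applied to w k, so the tolerance bounds that
    vector. C0 converts this into the distance of w k from the tangent space, which is the norm of w
    k - \<eta> k.\<close>
  have step: "norm (w k - \<eta> k) \<le> C0 * tol k"
    "(norm (\<eta> k - \<eta>h k))\<^sup>2 \<le> 2 * \<alpha> * lR * norm (w k - \<eta> k)"
    "step_model R \<alpha> (x k) (m k) (\<eta> k) \<le> step_model R \<alpha> (x k) (m k) (\<eta>h k) + 2 * lR * norm (w k - \<eta> k)" for k
  proof -
    let ?c = "adjoint (B (x k)) (l k)"
    have linB: "linear (B (x k))" unfolding B_eq by (rule linear_B[OF xM])
    have wmin: "step_model R \<alpha> (x k) (m k + ?c) (w k) \<le> step_model R \<alpha> (x k) (m k + ?c) v" for v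
      unfolding run(8) by (rule prox_minimises[OF R(1) \<open>0 < \<alpha>\<close>])
    have "nabla (dual_model R \<alpha> (B (x k)) (x k) (m k)) (l k) = - B (x k) (w k)"
      by (rule nabla_dual_model[OF R \<open>0 < \<alpha>\<close> linB wmin])
    then have "norm (B (x k) (w k)) \<le> tol k" using run(7)[of k] by simp
    moreover have "norm (w k - \<eta> k) \<le> C0 * norm (B (x k) (w k))"
      unfolding run(9) cp(4) B_eq using C0 xM by blast
    ultimately show "norm (w k - \<eta> k) \<le> C0 * tol k" using \<open>C0 > 0\<close> by (meson less_imp_le mult_left_mono order_trans)
    have c: "inner ?c v = 0" if "v \<in> tangent_space M (x k)" for v
      using adjoint_works[OF linB, of v "l k"] that unfolding tangent_eq[OF xM] B_eq by (simp add: inner_commute)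
    have perp: "inner (w k - \<eta> k) v = 0" if "v \<in> tangent_space M (x k)" for v
      unfolding run(9) by (rule cp(2)[OF that])
    note inex = inexact_step[OF R \<open>0 < \<alpha>\<close> subspace_tangent[OF xM] c wmin \<eta>T perp \<eta>h_min \<eta>hT]
    show "(norm (\<eta> k - \<eta>h k))\<^sup>2 \<le> 2 * \<alpha> * lR * norm (w k - \<eta> k)" by (rule inex(1))
    show "step_model R \<alpha> (x k) (m k) (\<eta> k) \<le> step_model R \<alpha> (x k) (m k) (\<eta>h k) + 2 * lR * norm (w k - \<eta> k)"
      by (rule inex(2))
  qed
  have C1: "C1\<^sup>2 = 4 * (lR * C0 * \<alpha>b)"
    unfolding C1_def using lR \<open>C0 > 0\<close> \<open>0 < \<alpha>b\<close> by (simp add: power_mult_distrib)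
  have dist_sq: "(norm (\<eta> k - \<eta>h k))\<^sup>2 \<le> C1\<^sup>2 * tol k" for k
  proof -
    have "2 * \<alpha> * lR * norm (w k - \<eta> k) \<le> 2 * \<alpha>b * lR * (C0 * tol k)"
      using step(1)[of k] \<open>0 < \<alpha>\<close> \<open>\<alpha> \<le> \<alpha>b\<close> lR by (intro mult_mono) auto
    also have "\<dots> \<le> C1\<^sup>2 * tol k"
      unfolding C1 using lR \<open>C0 > 0\<close> \<open>0 < \<alpha>b\<close> tol0(1)[of k] by (simp add: mult_nonneg_nonneg)
    finally show ?thesis using step(2)[of k] by simp
  qed
  have \<eta>h_le: "norm (\<eta>h k) \<le> (Mu + lR) * \<alpha>b" for k
  proof -
    have "norm (\<eta>h k) \<le> \<alpha> * (norm (m k) + lR)"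
      by (rule step_model_bound[OF R \<open>0 < \<alpha>\<close> subspace_tangent[OF xM] \<eta>h_min \<eta>hT])
    also have "\<dots> \<le> \<alpha>b * (Mu + lR)"
      using m[of k] \<open>0 < \<alpha>\<close> \<open>\<alpha> \<le> \<alpha>b\<close> lR Mu by (intro mult_mono) auto
    finally show ?thesis by (simp add: mult.commute)
  qed
  \<comment> \<open>The first summand bounds the exact step, the second its distance to the inexact
    step; together they keep both steps within the radius \<delta>.\<close>
  have small: "(Mu + lR) * \<alpha>b + 2 * sqrt \<alpha>b * sqrt (lR * C0 * tolb) \<le> min \<delta> \<delta>T"
    using \<alpha>b(1) lR Mu \<open>C0 > 0\<close> \<open>tolb \<ge> 0\<close> \<open>\<delta> > 0\<close> \<open>\<delta>T > 0\<close> \<open>0 < \<alpha>b\<close> unfolding Ca_def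
    by (intro stepsize_bound) auto
  have \<eta>h\<delta>: "norm (\<eta>h k) \<le> \<delta>" for k
  proof -
    have "2 * sqrt \<alpha>b * sqrt (lR * C0 * tolb) \<ge> 0" using lR \<open>C0 > 0\<close> \<open>tolb \<ge> 0\<close> \<open>0 < \<alpha>b\<close> by simp
    then show ?thesis using \<eta>h_le[of k] small by simp
  qed
  have \<eta>\<delta>: "norm (\<eta> k) \<le> \<delta>" for k
  proof -
    have "(norm (\<eta> k - \<eta>h k))\<^sup>2 \<le> C1\<^sup>2 * tolb"
      using dist_sq[of k] tol0(2)[of k] mult_left_mono[of "tol k" tolb "C1\<^sup>2"] by simp
    then have "norm (\<eta> k - \<eta>h k) \<le> sqrt (C1\<^sup>2 * tolb)" by (rule real_le_rsqrt)
    also have "C1\<^sup>2 * tolb = 4 * (\<alpha>b * (lR * C0 * tolb))" unfolding C1 by simp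
    also have "sqrt \<dots> = 2 * sqrt \<alpha>b * sqrt (lR * C0 * tolb)"
      by (simp only: real_sqrt_mult real_sqrt_four mult.assoc)
    finally have "norm (\<eta> k - \<eta>h k) \<le> 2 * sqrt \<alpha>b * sqrt (lR * C0 * tolb)" .
    then show ?thesis using \<eta>h_le[of k] small norm_triangle_ineq[of "\<eta>h k" "\<eta> k - \<eta>h k"] by simp
  qed
  have chie: "chie > 0" using \<open>chie > \<rho>1\<close> \<open>\<rho>1 > 0\<close> by simp
  define E where "E = 2 * lf + 2 * \<rho>2 + 4 * lf\<^sup>2 * \<rho>1 + 8 * L\<Phi> + 8 * \<nu> / \<rho>2 + 16 * chie * \<nu>"
  have terms: "4 * lf\<^sup>2 * \<rho>1 \<ge> 0" "8 * \<nu> / \<rho>2 > 0" "16 * chie * \<nu> > 0"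
    using \<open>\<rho>1 > 0\<close> \<open>\<rho>2 > 0\<close> \<open>\<nu> > 0\<close> chie by simp_all
  have E: "E > 0" unfolding E_def using lf \<open>\<rho>2 > 0\<close> \<open>L\<Phi> > 0\<close> terms by linarith
  have "\<alpha> < 1 / E" using \<alpha>b(3) \<open>\<alpha> \<le> \<alpha>b\<close> unfolding E_def by simp
  then have "E < 1 / \<alpha>" using E \<open>0 < \<alpha>\<close> by (simp add: field_simps)
  \<comment> \<open>4 * d\<alpha> is 1 / \<alpha> minus the first four terms of E, so E < 1 /
    \<alpha> leaves the two terms with \<nu>.\<close>
  then have d_low: "d\<alpha> > 2 * \<nu> / \<rho>2 + 4 * chie * \<nu>"
    unfolding d\<alpha>_def a_def c\<eta>_def E_def by (simp add: field_simps)
  have \<nu>\<rho>: "\<nu> / \<rho>2 > 0" "chie * \<nu> > 0" using \<open>\<rho>2 > 0\<close> \<open>\<nu> > 0\<close> chie by simp_all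
  then have d_pos: "d\<alpha> > 0" using d_low by simp
  have gap_pos: "d\<alpha> / 4 - \<nu> / (2 * \<rho>2) - chie * \<nu> > 0" using d_low by simp
  have \<kappa>1: "\<kappa>1 * (d\<alpha> * C1\<^sup>2 / 2 + Csh) < d\<alpha> / 4 - \<nu> / (2 * \<rho>2) - chie * \<nu>"
  proof (cases "d\<alpha> * C1\<^sup>2 / 2 + Csh > 0")
    case True
    then show ?thesis
      using \<open>\<kappa>1 < (d\<alpha> / 4 - \<nu> / (2 * \<rho>2) - chie * \<nu>) / (d\<alpha> * C1\<^sup>2 / 2 + Csh)\<close> by (simp add: pos_less_divide_eq)
  next
    case False
    then have "\<kappa>1 * (d\<alpha> * C1\<^sup>2 / 2 + Csh) \<le> 0" using \<open>\<kappa>1 \<ge> 0\<close> by (simp add: mult_nonneg_nonpos)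
    then show ?thesis using gap_pos by simp
  qed
  have "\<alpha> < 1 / (lf + \<rho>2)" using \<alpha>b(2) \<open>\<alpha> \<le> \<alpha>b\<close> by simp
  then have "lf + \<rho>2 < 1 / \<alpha>" using lf \<open>\<rho>2 > 0\<close> \<open>0 < \<alpha>\<close> by (simp add: field_simps)
  then have lf\<alpha>: "lf \<le> 1 / \<alpha>" using \<open>\<rho>2 > 0\<close> by simp
  \<comment> \<open>Absorbs the index shift by k0; it is zero or positive together with \<kappa>2,
    so the case distinctions of the conclusion carry over.\<close>
  define \<kappa> where "\<kappa> = \<kappa>2 * (real k0 + 1) powr r"
  have \<kappa>: "\<kappa> \<ge> 0" "\<kappa> = 0 \<longleftrightarrow> \<kappa>2 = 0" "0 < \<kappa> \<longleftrightarrow> 0 < \<kappa>2"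
    unfolding \<kappa>_def using \<open>\<kappa>2 \<ge> 0\<close> by (auto simp: zero_less_mult_iff)
  have tol_rec: "tol (Suc k) \<le> \<kappa>1 * (norm (\<eta> k))\<^sup>2 + \<kappa> * (real k + 1) powr (- r)" if k: "k0 + 1 \<le> k" for k
  proof -
    have "tol (Suc k) \<le> max (\<kappa>1 * (norm (\<eta> k))\<^sup>2) (\<kappa>2 * (real (Suc k) - real k0) powr (- r))"
      using \<open>\<forall>k\<ge>k0 + 1. tol k \<le> min tolb (max (\<kappa>1 * (norm (\<eta> (k - 1)))\<^sup>2)
                                       (\<kappa>2 * (real k - real k0) powr (- r)))\<close>[rule_format, of "Suc k"] k by simp
    also have "\<dots> \<le> \<kappa>1 * (norm (\<eta> k))\<^sup>2 + \<kappa>2 * (real (Suc k) - real k0) powr (- r)"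
      using \<open>\<kappa>1 \<ge> 0\<close> \<open>\<kappa>2 \<ge> 0\<close> by simp
    also have "\<kappa>2 * (real (Suc k) - real k0) powr (- r) \<le> \<kappa> * (real k + 1) powr (- r)"
      using mult_left_mono[OF powr_shift_le[of k0 k r], of \<kappa>2] k \<open>r > 2\<close> \<open>\<kappa>2 \<ge> 0\<close>
      unfolding \<kappa>_def by (simp add: algebra_simps)
    finally show ?thesis by simp
  qed
  \<comment> \<open>Starting at k0 + 1 ensures that the starting index is at least 1.\<close>
  interpret dissipative_run M I V W \<psi> sel C0 F R U lf lR Mf Mu \<alpha> \<delta> CR L\<Phi> C1 \<rho>1 \<rho>2 x m \<eta> \<eta>h tol
    Er ce \<mu> \<nu> \<kappa>1 \<kappa> r chie a c\<eta> Csh "k0 + 1"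
  proof unfold_locales
    show "a \<equiv> 1 / (2 * \<alpha>) - lf / 2 - \<rho>2 / 2" by (rule a_def)
    show "c\<eta> \<equiv> 1 / (4 * \<alpha>) + lf\<^sup>2 * \<rho>1 + 2 * L\<Phi>" by (rule c\<eta>_def)
    show "Csh \<equiv> C1\<^sup>2 / \<alpha> + 2 * L\<Phi> * C1\<^sup>2 + C1\<^sup>2 / (2 * \<rho>1) + 2 * C0 * lR" by (rule Csh_def)
    show "y + v \<in> U" if "y \<in> M" "v \<in> tangent_space M y" "norm v \<le> \<delta>" for y v
      using geo[OF that] by blast
    fix k
    show "step_model R \<alpha> (x k) (m k) (\<eta> k) \<le> step_model R \<alpha> (x k) (m k) (\<eta>h k) + 2 * C0 * lR * tol k"
      using step(3)[of k] mult_left_mono[OF step(1)[of k], of "2 * lR"] lR by (simp add: algebra_simps)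
    show "norm (x (Suc k) - x k) \<le> CR * norm (\<eta> k)"
      unfolding run(10) using geo[OF xM \<eta>T \<eta>\<delta>] by blast
    have "\<bar>\<Phi> (Retr (x k) (\<eta> k)) - \<Phi> (x k + \<eta> k)\<bar> \<le> L\<Phi> * (norm (\<eta> k))\<^sup>2"
      using geo[OF xM \<eta>T \<eta>\<delta>] by blast
    then show "F (x (Suc k)) + R (x (Suc k)) \<le> F (x k + \<eta> k) + R (x k + \<eta> k) + L\<Phi> * (norm (\<eta> k))\<^sup>2"
      unfolding run(10) \<Phi>_def by simp
    show "(norm (m k - riem_grad M F (x k)))\<^sup>2 + \<mu> * Er k \<le> ce * (Er k - Er (Suc k)) + \<nu> * (norm (\<eta> k))\<^sup>2"
      using \<open>\<forall>k. (norm (e k))\<^sup>2 + \<mu> * Er k \<le> ce * (Er k - Er (Suc k)) + \<nu> * (norm (\<eta> k))\<^sup>2\<close> unfolding e_def by blast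
    show "Er k \<ge> 0" using \<open>\<forall>k. Er k \<ge> 0\<close> by blast
    show "\<kappa>1 * ((1 / (2 * \<alpha>) - lf / 2 - \<rho>2 / 2 - (1 / (4 * \<alpha>) + lf\<^sup>2 * \<rho>1 + 2 * L\<Phi>)) * C1\<^sup>2 / 2 + (C1\<^sup>2 / \<alpha> + 2 * L\<Phi> * C1\<^sup>2 + C1\<^sup>2 / (2 * \<rho>1) + 2 * C0 * lR))
        < (1 / (2 * \<alpha>) - lf / 2 - \<rho>2 / 2 - (1 / (4 * \<alpha>) + lf\<^sup>2 * \<rho>1 + 2 * L\<Phi>)) / 4 - \<nu> / (2 * \<rho>2) - chie * \<nu>"
      using \<kappa>1 unfolding d\<alpha>_def a_def c\<eta>_def Csh_def .
    show "0 < 1 / (2 * \<alpha>) - lf / 2 - \<rho>2 / 2 - (1 / (4 * \<alpha>) + lf\<^sup>2 * \<rho>1 + 2 * L\<Phi>)"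
      using d_pos unfolding d\<alpha>_def a_def c\<eta>_def by simp
  qed (use dF cF lipF MfF R lf\<alpha> xM m \<eta>T \<eta>\<delta> \<eta>hT \<eta>h\<delta> \<eta>h_min dist_sq tol0(1) Mu tol_rec \<kappa>
      \<open>M \<subseteq> U\<close> \<open>0 < \<alpha>\<close> \<open>L\<Phi> > 0\<close> \<open>CR > 0\<close> \<open>\<rho>1 > 0\<close> \<open>\<rho>2 > 0\<close> \<open>ce > 0\<close> \<open>\<mu> > 0\<close> \<open>\<nu> > 0\<close>
      \<open>chie > \<rho>1\<close> \<open>\<kappa>1 \<ge> 0\<close> \<open>r > 2\<close> in \<open>simp_all\<close>)
  have \<Phi>0: "\<Phi>0 = shifted_objective M (\<lambda>z. F z + R z)" unfolding \<Phi>0_def \<Phi>_def by simp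
  show ?thesis
    using run_conclusion[of "(Mu + lR) * \<alpha>b"] \<open>\<forall>z\<in>\<Omega>s. KL_property \<Phi>0 z\<close> Mu lR \<open>0 < \<alpha>b\<close>
    unfolding \<Omega>s_def \<Phi>s_def \<Phi>0 \<kappa>(2,3) by auto
qed

end
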